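(* Let $(X_1,Y_1),\dots,(X_n,Y_n)$ be obtained independently from the linear model $Y=\beta_*^TX+e$ with $X\in\mathbb{R}^d$, $\beta_*\in\mathbb{R}^d$, where the error $e$ has zero mean and variance $\sigma^2\in(0,\infty)$ and is independent of $X$; let $\Sigma=\mathbb{E}[XX^T]$ (assumed finite). Let $q\in(1,\infty]$, $1/p+1/q=1$, consider the cost function $c((x,y),(u,v))=\big(N_q((x,y),(u,v))\big)^2$, and for $\beta\in\mathbb{R}^d$ let $$R_n(\beta)=\inf\big\{\mathcal{D}_c(\mathbb{P},\mathbb{P}_n):\ \mathbb{E}_{\mathbb{P}}[(Y-\beta^TX)X]=\mathbf 0\big\}.$$ Then, as $n\to\infty$, $$nR_n(\beta_* )\Rightarrow L_1:=\max_{\xi\in\mathbb{R}^d}\Big\{2\sigma\,\xi^TZ-\mathbb{E}\big\|e\xi-(\xi^TX)\beta_*\big\|_p^2\Big\},$$ where $Z\sim\mathcal{N}(\mathbf 0,\Sigma)$ (the expectation being over $(X,e)$ with $\xi$, $Z$ fixed). Further, $$L_1\overset{D}{\le}L_2:=\frac{\mathbb{E}[e^2]}{\mathbb{E}[e^2]-(\mathbb{E}|e|)^2}\,\|Z\|_q^2.$$ Specifically, if $e$ follows a centered normal distribution, then $$L_1\overset{D}{\le}L_2:=\frac{\pi}{\pi-2}\,\|Z\|_q^2.$$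
   Context: $\mathbb{P}_n=\frac1n\sum_{i=1}^n\delta_{(X_i,Y_i)}$. $N_q((x,y),(u,v))=\|x-u\|_q$ if $y=v$, and $=\infty$ otherwise. $\mathcal{D}_c(\mathbb{P},\mathbb{Q})=\inf\{\mathbb{E}_\pi[c(U,V)]\}$ over joint distributions $\pi$ on $\mathbb{R}^{d+1}\times\mathbb{R}^{d+1}$ with marginals $\pi_U=\mathbb{P}$, $\pi_V=\mathbb{Q}$. The infimum in $R_n$ is over Borel probability measures $\mathbb{P}$ on $\mathbb{R}^{d+1}$. $\Rightarrow$ denotes convergence in distribution. $A\overset{D}{\le}B$ means $\Pr(A\ge x)\le\Pr(B\ge x)$ for all $x\in\mathbb{R}$. If $\mathbb{E}[e^2]=(\mathbb{E}|e|)^2$ the factor in $L_2$ is read as $+\infty$ and the bound is void. *)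

theory Defs
  imports "HOL-Probability.Probability"
begin

text \<open>The usual norm for exponents in [1, infinity]; infnorm is the maximum of the absolute
  values of the coordinates.\<close>

definition lnorm :: "ereal \<Rightarrow> real ^ 'd::finite \<Rightarrow> real" where
  "lnorm r x = (if r = \<infinity> then infnorm x
     else (\<Sum>i\<in>UNIV. \<bar>x $ i\<bar> powr real_of_ereal r) powr (1 / real_of_ereal r))"

definition N_dist :: "ereal \<Rightarrow> (real ^ 'd::finite) \<times> real \<Rightarrow> (real ^ 'd) \<times> real \<Rightarrow> ennreal" where
  "N_dist q a b = (if snd a = snd b then ennreal (lnorm q (fst a - fst b)) else \<infinity>)"

definition couplings :: "'a::topological_space measure \<Rightarrow> 'a measure \<Rightarrow> ('a \<times> 'a) measure set" where
  "couplings P Q = {\<pi>. prob_space \<pi> \<and> sets \<pi> = sets borel \<and>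
     distr \<pi> borel fst = P \<and> distr \<pi> borel snd = Q}"

definition transport_cost ::
  "('a::topological_space \<Rightarrow> 'a \<Rightarrow> ennreal) \<Rightarrow> 'a measure \<Rightarrow> 'a measure \<Rightarrow> ennreal" where
  "transport_cost c P Q = (INF \<pi>\<in>couplings P Q. \<integral>\<^sup>+ z. c (fst z) (snd z) \<partial>\<pi>)"

definition empirical :: "nat \<Rightarrow> (nat \<Rightarrow> 'a::topological_space) \<Rightarrow> 'a measure" where
  "empirical n s = distr (uniform_count_measure {1..n}) borel s"

text \<open>Integrability is required explicitly because the Bochner integral of a
  non-integrable function is 0.\<close>

definition score_zero :: "real ^ 'd::finite \<Rightarrow> ((real ^ 'd) \<times> real) measure set" where
  "score_zero \<beta> = {P. prob_space P \<and> sets P = sets borel \<and>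
     integrable P (\<lambda>(x, y). (y - \<beta> \<bullet> x) *\<^sub>R x) \<and>
     integral\<^sup>L P (\<lambda>(x, y). (y - \<beta> \<bullet> x) *\<^sub>R x) = 0}"

definition profile :: "ereal \<Rightarrow> ((real ^ 'd::finite) \<times> real) measure \<Rightarrow> real ^ 'd \<Rightarrow> ennreal" where
  "profile q Q \<beta> = (INF P\<in>score_zero \<beta>. transport_cost (\<lambda>a b. (N_dist q a b)\<^sup>2) P Q)"

text \<open>The library constant indep_var only covers two random variables with the same codomain type.\<close>

definition independent_rvs ::
  "'w measure \<Rightarrow> ('w \<Rightarrow> 'a::topological_space) \<Rightarrow> ('w \<Rightarrow> 'b::topological_space) \<Rightarrow> bool" where
  "independent_rvs M X Y \<longleftrightarrow> X \<in> borel_measurable M \<and> Y \<in> borel_measurable M \<and>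
     prob_space.indep_set M {X -` A \<inter> space M |A. A \<in> sets borel}
                            {Y -` B \<inter> space M |B. B \<in> sets borel}"

definition second_moment :: "'w measure \<Rightarrow> ('w \<Rightarrow> real ^ 'd::finite) \<Rightarrow> real ^ 'd ^ 'd" where
  "second_moment M X = (\<chi> i j. prob_space.expectation M (\<lambda>w. X w $ i * X w $ j))"

definition normal_law :: "real \<Rightarrow> real \<Rightarrow> real measure" where
  "normal_law m v = (if v = 0 then return borel m else density lborel (normal_density m (sqrt v)))"

text \<open>The covariance matrix may be singular, so the law is fixed by its one-dimensional
  projections instead of by a density.\<close>

definition centered_gaussian :: "'z measure \<Rightarrow> ('z \<Rightarrow> real ^ 'd::finite) \<Rightarrow> real ^ 'd ^ 'd \<Rightarrow> bool" where
  "centered_gaussian N Z S \<longleftrightarrow> Z \<in> borel_measurable N \<and>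
     (\<forall>t. distr N borel (\<lambda>w. t \<bullet> Z w) = normal_law 0 (t \<bullet> (S *v t)))"

definition converges_in_distribution ::
  "'w measure \<Rightarrow> (nat \<Rightarrow> 'w \<Rightarrow> real) \<Rightarrow> 'z measure \<Rightarrow> ('z \<Rightarrow> real) \<Rightarrow> bool" where
  "converges_in_distribution M A N B \<longleftrightarrow>
     (\<forall>n. A n \<in> borel_measurable M) \<and> B \<in> borel_measurable N \<and>
     weak_conv_m (\<lambda>n. distr M borel (A n)) (distr N borel B)"

definition stoch_le :: "'z measure \<Rightarrow> ('z \<Rightarrow> real) \<Rightarrow> ('z \<Rightarrow> real) \<Rightarrow> bool" where
  "stoch_le N A B \<longleftrightarrow>
     (\<forall>x. measure N {w \<in> space N. A w \<ge> x} \<le> measure N {w \<in> space N. B w \<ge> x})"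

text \<open>With square-integrable X and e the integrand below is integrable, so the default value 0
  of the Bochner integral never occurs where this is used.\<close>

definition L1_objective ::
  "'w measure \<Rightarrow> ('w \<Rightarrow> real ^ 'd::finite) \<Rightarrow> ('w \<Rightarrow> real) \<Rightarrow> real ^ 'd \<Rightarrow> real \<Rightarrow> ereal \<Rightarrow>
     real ^ 'd \<Rightarrow> real ^ 'd \<Rightarrow> real" where
  "L1_objective M X e \<beta> \<sigma> p z \<xi> =
     2 * \<sigma> * (\<xi> \<bullet> z) -
     prob_space.expectation M (\<lambda>w. (lnorm p (e w *\<^sub>R \<xi> - (\<xi> \<bullet> X w) *\<^sub>R \<beta>))\<^sup>2)"

text \<open>A supremum in the reals; that it is a maximum has to be stated separately.\<close>

definition L1 ::
  "'w measure \<Rightarrow> ('w \<Rightarrow> real ^ 'd::finite) \<Rightarrow> ('w \<Rightarrow> real) \<Rightarrow> real ^ 'd \<Rightarrow> real \<Rightarrow> ereal \<Rightarrow>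
     real ^ 'd \<Rightarrow> real" where
  "L1 M X e \<beta> \<sigma> p z = (SUP \<xi>. L1_objective M X e \<beta> \<sigma> p z \<xi>)"

lemma lnorm_measurable [measurable]: "lnorm r \<in> borel_measurable borel"
proof -
  have "(\<lambda>x::real^'d. \<Sum>i\<in>UNIV. \<bar>x $ i\<bar> powr real_of_ereal r) \<in> borel_measurable borel"
    by measurable
  moreover have "(infnorm :: real^'d \<Rightarrow> real) \<in> borel_measurable borel"
    by (intro borel_measurable_continuous_onI continuous_intros continuous_on_infnorm)
  ultimately show ?thesis
    unfolding lnorm_def by (cases "r = \<infinity>") auto
qed

lemma N_dist_measurable:
  "(\<lambda>z. N_dist q (fst z) (snd z)) \<in>
     borel_measurable (borel :: (((real ^ 'd::finite) \<times> real) \<times> ((real ^ 'd) \<times> real)) measure)"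
  unfolding N_dist_def borel_prod[symmetric] by measurable

text \<open>Collapsing every observed covariate to 0 is feasible at finite cost, so passing from
  ennreal to real by enn2real loses nothing.\<close>

lemma profile_empirical_finite:
  assumes "n > 0"
  shows "profile q (empirical n s) (\<beta> :: real ^ 'd::finite) < \<infinity>"
proof -
  let ?U = "uniform_count_measure {1..n}"
  define g where "g i = ((0 :: real^'d, snd (s i)), s i)" for i
  define \<pi> where "\<pi> = distr ?U borel g"
  define P where "P = distr ?U borel (\<lambda>i. (0 :: real^'d, snd (s i)))"
  interpret U: prob_space ?U
    using assms by (intro prob_space_uniform_count_measure) auto
  have meas: "f \<in> measurable ?U borel" for f :: "nat \<Rightarrow> 'b::topological_space"
    by (auto simp: measurable_def space_uniform_count_measure sets_uniform_count_measure)
  have pd: "prob_space (distr ?U borel f)" for f :: "nat \<Rightarrow> 'b::topological_space"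
    by (rule U.prob_space_distr[OF meas])
  have fst_m: "fst \<in> measurable (borel :: (((real ^ 'd) \<times> real) \<times> ((real ^ 'd) \<times> real)) measure) borel"
    and snd_m: "snd \<in> measurable (borel :: (((real ^ 'd) \<times> real) \<times> ((real ^ 'd) \<times> real)) measure) borel"
    by (auto intro!: borel_measurable_continuous_onI continuous_intros)
  have "\<pi> \<in> couplings P (empirical n s)"
    unfolding couplings_def \<pi>_def P_def empirical_def
    by (auto simp: pd meas distr_distr fst_m snd_m o_def g_def simp del: One_nat_def)
  moreover have "P \<in> score_zero \<beta>"
  proof -
    have m: "(\<lambda>(x, y). (y - \<beta> \<bullet> x) *\<^sub>R x) \<in>
       borel_measurable (borel :: ((real^'d) \<times> real) measure)"
      unfolding borel_prod[symmetric] by measurable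
    show ?thesis
      unfolding score_zero_def P_def
      by (auto simp: pd meas integrable_distr_eq integral_distr m simp del: One_nat_def)
  qed
  moreover have "(\<integral>\<^sup>+ z. (N_dist q (fst z) (snd z))\<^sup>2 \<partial>\<pi>) < \<infinity>"
  proof -
    have "(\<integral>\<^sup>+ z. (N_dist q (fst z) (snd z))\<^sup>2 \<partial>\<pi>) =
        (\<integral>\<^sup>+ i. (N_dist q (fst (g i)) (snd (g i)))\<^sup>2 \<partial>?U)"
      unfolding \<pi>_def
      by (intro nn_integral_distr meas)
         (simp only: measurable_distr_eq1 power2_eq_square
            borel_measurable_times_ennreal N_dist_measurable)
    also have "\<dots> < \<infinity>"
      using assms unfolding uniform_count_measure_def
      by (subst nn_integral_point_measure_finite)
         (auto simp: g_def N_dist_def ennreal_mult_less_top power_less_top_ennreal)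
    finally show ?thesis .
  qed
  ultimately show ?thesis
    unfolding profile_def transport_cost_def
    by (meson INF_lower le_less_trans)
qed

end

theory Submission
  imports Defs
begin

text \<open>Moving an observation \<open>(x, y)\<close> by \<open>D\<close> changes the score \<open>(y - \<beta> \<bullet> x) x\<close>, tested against a
  multiplier \<open>\<zeta>\<close>, by \<open>tilt \<bullet> D\<close> with \<open>tilt = e \<zeta> - (\<zeta> \<bullet> x) \<beta>\<close>, up to the quadratic term
  \<open>(\<beta> \<bullet> D) (\<zeta> \<bullet> D)\<close>. Lagrangian duality for the transport problem therefore represents
  \<open>n R_n\<close> as the supremum over \<open>\<zeta>\<close> of \<open>2 \<zeta> \<bullet> S_n - A_n \<zeta>\<close>, up to a relative error of order
  \<open>|\<zeta>| / sqrt n\<close>, where \<open>S_n\<close> is the normalised score sum and \<open>A_n \<zeta>\<close> the sample mean of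
  the squared p-norm of the tilt. Both \<open>A_n\<close> and its expectation \<open>A\<close> are 2-homogeneous and \<open>A\<close> is
  coercive, so a uniform law of large numbers on the unit sphere gives
  \<open>(1 - \<eta>) A \<le> A_n \<le> (1 + \<eta>) A\<close> everywhere. Hence \<open>n R_n\<close> lies within a factor
  \<open>1 + O(\<eta>)\<close> of \<open>F S_n\<close>, where \<open>F s\<close> is the supremum over \<open>\<zeta>\<close> of
  \<open>2 \<zeta> \<bullet> s - A \<zeta>\<close>, and the multivariate central limit theorem together with the
  continuity of \<open>F\<close> yields the limit. The bound by \<open>L_2\<close> is Hoelder's
  inequality after \<open>A \<zeta> \<ge> Var |e| * |\<zeta>|_p^2\<close>.\<close>

section \<open>Conjugate norms\<close>

text \<open>Three obstacles shape the argument. The term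
  \<open>(\<beta> \<bullet> D) (\<zeta> \<bullet> D)\<close> is indefinite, so the inner
  minimisation is not solved exactly: Hoelder's inequality bounds the term by a multiple of the
  transport cost, which is small only for multipliers small compared with sqrt n. Duality gives no
  such bound on the multiplier and may even return a vertical hyperplane; the multiplier is
  therefore shrunk into a fixed ball, and coercivity of \<open>A\<close> later refutes the
  alternative in which it ends on the sphere without an objective bound. Next, the profile is an
  infimum over uncountably many measures, so its measurability, which convergence in distribution
  presupposes, needs a form of strong duality with countable quantifiers. Finally, only second
  moments of \<open>X\<close> and \<open>e\<close> are finite: the squared norm of the tilt has
  merely an expectation, so the law of large numbers goes through truncation, and the limit theorem
  in several dimensions is assembled from one-dimensional projections by trigonometric
  polynomials.\<close>

lemma lnorm_real: "lnorm (ereal r) x = (\<Sum>i\<in>UNIV. \<bar>x $ i\<bar> powr r) powr (1 / r)"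
  by (simp add: lnorm_def)

lemma lnorm_infinity: "lnorm \<infinity> x = infnorm x"
  by (simp add: lnorm_def)

lemma lnorm_nonneg: "0 \<le> lnorm r x"
  by (auto simp: lnorm_def infnorm_pos_le)

lemma lnorm_scaleR:
  assumes "1 \<le> r"
  shows "lnorm r (c *\<^sub>R x) = \<bar>c\<bar> * lnorm r x"
proof (cases r)
  case (real t)
  have t: "1 \<le> t" using assms real by simp
  have "(\<Sum>i\<in>UNIV. \<bar>(c *\<^sub>R x) $ i\<bar> powr t) = \<bar>c\<bar> powr t * (\<Sum>i\<in>UNIV. \<bar>x $ i\<bar> powr t)"
    by (simp add: abs_mult powr_mult sum_distrib_left)
  then show ?thesis
    using t real by (simp add: lnorm_real powr_mult sum_nonneg powr_powr)
qed (use assms in \<open>auto simp: lnorm_infinity infnorm_mul\<close>)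

lemma lnorm_zero:
  assumes "1 \<le> r"
  shows "lnorm r 0 = 0"
  using lnorm_scaleR[OF assms, of 0 0] by simp

lemma lnorm_minus:
  assumes "1 \<le> r"
  shows "lnorm r (- x) = lnorm r x"
  using lnorm_scaleR[OF assms, of "-1" x] by simp

text \<open>The factor \<open>CARD('d)\<close> is crude but the same for every exponent, so size
  estimates can be made in the Euclidean norm throughout.\<close>

lemma lnorm_le_norm:
  fixes x :: "real ^ 'd::finite"
  assumes "1 \<le> r"
  shows "lnorm r x \<le> CARD('d) * norm x"
proof (cases r)
  case (real t)
  have t: "1 \<le> t" using assms real by simp
  have "(\<Sum>i\<in>UNIV. \<bar>x $ i\<bar> powr t) \<le> (\<Sum>i\<in>(UNIV::'d set). norm x powr t)"
    using t by (intro sum_mono powr_mono2 component_le_norm_cart) auto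
  then have "lnorm r x \<le> (real CARD('d) * norm x powr t) powr (1 / t)"
    using real t by (simp add: lnorm_real powr_mono2 sum_nonneg)
  also have "\<dots> = real CARD('d) powr (1 / t) * norm x"
    using t by (simp add: powr_mult powr_powr)
  also have "\<dots> \<le> real CARD('d) powr 1 * norm x"
    using t by (intro mult_right_mono powr_mono) (auto simp: Suc_leI)
  finally show ?thesis by simp
next
  case PInf
  have "infnorm x \<le> norm x" by (rule infnorm_le_norm)
  also have "norm x \<le> CARD('d) * norm x"
    using mult_right_mono[of 1 "real CARD('d)" "norm x"] by (simp add: Suc_leI)
  finally show ?thesis using PInf by (simp add: lnorm_infinity)
qed (use assms in auto)

locale conjugate_exponents =
  fixes p q :: ereal
  assumes q_gt_1: "1 < q" and conjugate: "1 / p + 1 / q = 1"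
begin

text \<open>In \<open>ereal\<close>, \<open>1 / \<infinity>\<close> is 0, so
  \<open>p = \<infinity>\<close> would force \<open>q = 1\<close>, and \<open>1 / 0\<close> is
  infinite, which rules out \<open>p = 0\<close>. The maximum norm thus occurs on the side of
  \<open>q\<close> only.\<close>

lemma exponent_cases:
  obtains (infinity) "q = \<infinity>" "p = ereal 1"
  | (finite) a b where "p = ereal a" "q = ereal b" "1 < a" "1 < b" "1 / a + 1 / b = 1"
proof (cases q)
  case (real b)
  have b: "1 < b" using q_gt_1 real by simp
  show ?thesis
  proof (cases p)
    case (real a)
    have "a \<noteq> 0"
      using conjugate b \<open>q = ereal b\<close> real by (auto simp: divide_ereal_def)
    moreover have *: "1 / a + 1 / b = 1"
      using conjugate b \<open>q = ereal b\<close> real \<open>a \<noteq> 0\<close>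
      by (auto simp: divide_ereal_def inverse_eq_divide one_ereal_def)
    moreover have "1 < a"
    proof -
      have "0 < 1 / b" "1 / b < 1" using b by auto
      then have "0 < 1 / a" "1 / a < 1" using * by linarith+
      then show ?thesis by (simp add: field_simps split: if_splits)
    qed
    ultimately show ?thesis using finite real \<open>q = ereal b\<close> b by blast
  qed (use conjugate b real in \<open>auto simp: divide_ereal_def one_ereal_def\<close>)
next
  case PInf
  show ?thesis
  proof (cases p)
    case (real a)
    have "a \<noteq> 0"
      using conjugate PInf real by (auto simp: divide_ereal_def)
    then have "a = 1"
      using conjugate PInf real by (auto simp: divide_ereal_def one_ereal_def)
    then show ?thesis using infinity PInf real by simp
  qed (use conjugate PInf in \<open>auto simp: divide_ereal_def one_ereal_def\<close>)
qed (use q_gt_1 in auto)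

lemma p_ge_1: "1 \<le> p"
  by (cases rule: exponent_cases) (auto simp: one_ereal_def)

lemma q_ge_1: "1 \<le> q"
  using q_gt_1 by simp

lemma lnorm_Holder:
  fixes x y :: "real ^ 'd::finite"
  shows "\<bar>x \<bullet> y\<bar> \<le> lnorm p x * lnorm q y"
proof (cases rule: exponent_cases)
  case infinity
  have "\<bar>x \<bullet> y\<bar> \<le> (\<Sum>i\<in>UNIV. \<bar>x $ i\<bar> * \<bar>y $ i\<bar>)"
    unfolding inner_vec_def by (rule order_trans[OF sum_abs]) (simp add: abs_mult)
  also have "\<dots> \<le> (\<Sum>i\<in>UNIV. \<bar>x $ i\<bar> * infnorm y)"
    by (intro sum_mono mult_left_mono component_le_infnorm_cart) auto
  finally show ?thesis
    using infinity by (simp add: lnorm_real lnorm_infinity sum_distrib_right sum_nonneg)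
next
  case (finite a b)
  define u v where "u = lnorm p x" and "v = lnorm q y"
  have uv: "u powr a = (\<Sum>i\<in>UNIV. \<bar>x $ i\<bar> powr a)" "v powr b = (\<Sum>i\<in>UNIV. \<bar>y $ i\<bar> powr b)"
    using finite by (auto simp: u_def v_def lnorm_real powr_powr sum_nonneg)
  have nn: "0 \<le> u" "0 \<le> v" by (auto simp: u_def v_def lnorm_nonneg)
  show ?thesis
  proof (cases "u = 0 \<or> v = 0")
    case True
    then have "(\<forall>i. x $ i = 0) \<or> (\<forall>i. y $ i = 0)"
      using uv by (force simp: sum_nonneg_eq_0_iff)
    then have "x \<bullet> y = 0" by (auto simp: inner_vec_def)
    then show ?thesis by (simp add: lnorm_nonneg)
  next
    case False
    then have pos: "0 < u" "0 < v" using nn by auto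
    have "\<bar>x \<bullet> y\<bar> / (u * v) \<le> (\<Sum>i\<in>UNIV. (\<bar>x $ i\<bar> / u) * (\<bar>y $ i\<bar> / v))"
      unfolding inner_vec_def using pos
      by (simp add: sum_divide_distrib[symmetric] divide_simps order_trans[OF sum_abs] abs_mult)
    also have "\<dots> \<le> (\<Sum>i\<in>UNIV. (\<bar>x $ i\<bar> / u) powr a / a + (\<bar>y $ i\<bar> / v) powr b / b)"
      using pos finite by (intro sum_mono Youngs_inequality) auto
    also have "\<dots> = u powr a / u powr a / a + v powr b / v powr b / b"
      using pos by (simp add: sum.distrib powr_divide sum_divide_distrib[symmetric] uv)
    also have "\<dots> = 1" using pos finite by simp
    finally show ?thesis using pos by (simp add: u_def v_def divide_simps)
  qed
qed

text \<open>The equality case of Hoelder's inequality, scaled so that \<open>g\<close> is a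
  subgradient of half the squared p-norm at \<open>x\<close>. It yields both the triangle inequality
  and the displacement that nearly minimises the Lagrangian.\<close>

lemma ex_dual_vector:
  fixes x :: "real ^ 'd::finite"
  obtains g where "x \<bullet> g = (lnorm p x)\<^sup>2" "lnorm q g = lnorm p x"
proof (cases "x = 0")
  case True
  then show ?thesis using that[of 0] by (simp add: lnorm_zero p_ge_1 q_ge_1)
next
  case False
  then obtain k where k: "x $ k \<noteq> 0" by (metis vec_eq_iff zero_index)
  show ?thesis
  proof (cases rule: exponent_cases)
    case infinity
    have u: "lnorm p x = (\<Sum>i\<in>UNIV. \<bar>x $ i\<bar>)"
      using infinity by (simp add: lnorm_real sum_nonneg)
    define s :: "real ^ 'd" where "s = (\<chi> i. sgn (x $ i))"
    have "infnorm s = 1"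
    proof (rule antisym)
      have "\<bar>s $ i\<bar> \<le> 1" for i by (simp add: s_def sgn_if)
      then show "infnorm s \<le> 1" unfolding infnorm_cart by (intro cSup_least) auto
      have "\<bar>s $ k\<bar> \<le> infnorm s" by (rule component_le_infnorm_cart)
      then show "1 \<le> infnorm s" using k by (simp add: s_def sgn_if split: if_splits)
    qed
    then have "lnorm q (lnorm p x *\<^sub>R s) = lnorm p x"
      using infinity by (simp add: lnorm_infinity infnorm_mul lnorm_nonneg)
    moreover have "x \<bullet> s = lnorm p x"
      unfolding u by (simp add: inner_vec_def s_def abs_sgn)
    ultimately show ?thesis
      using that[of "lnorm p x *\<^sub>R s"] by (simp add: power2_eq_square)
  next
    case (finite a b)
    define u where "u = lnorm p x"
    have ua: "u powr a = (\<Sum>i\<in>UNIV. \<bar>x $ i\<bar> powr a)"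
      using finite by (auto simp: u_def lnorm_real powr_powr sum_nonneg)
    have "0 < \<bar>x $ k\<bar> powr a" using k by simp
    also have "\<dots> \<le> u powr a" unfolding ua by (rule member_le_sum) auto
    finally have u: "0 < u" using lnorm_nonneg[of p x] by (cases "u = 0") (auto simp: u_def)
    have ab: "(a - 1) * b = a" "a / b = a - 1" using finite by (auto simp: field_simps)
    define s :: "real ^ 'd" where "s = (\<chi> i. sgn (x $ i) * \<bar>x $ i\<bar> powr (a - 1))"
    have "\<bar>s $ i\<bar> powr b = \<bar>x $ i\<bar> powr a" for i
      using ab by (simp add: s_def abs_mult powr_powr abs_sgn_eq)
    then have "lnorm q s = (u powr a) powr (1 / b)"
      using finite by (simp add: lnorm_real ua)
    also have "\<dots> = u powr (a - 1)" using ab by (simp add: powr_powr)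
    finally have s: "lnorm q s = u powr (a - 1)" .
    have "x $ i * s $ i = \<bar>x $ i\<bar> powr a" for i
    proof -
      have "x $ i * s $ i = \<bar>x $ i\<bar> powr 1 * \<bar>x $ i\<bar> powr (a - 1)"
        by (simp add: s_def sgn_if)
      then show ?thesis by (subst (asm) powr_add[symmetric]) simp
    qed
    then have xs: "x \<bullet> s = u powr a" by (simp add: inner_vec_def ua)
    \<comment> \<open>The vector \<open>s\<close> attains equality in Hoelder's inequality but has
      q-norm \<open>u powr (a - 1)\<close>; the factor \<open>u powr (2 - a)\<close> brings this to
      \<open>u\<close>.\<close>
    have "u powr (2 - a) * u powr (a - 1) = u" "u powr (2 - a) * u powr a = u\<^sup>2"
      using u by (auto simp: powr_add[symmetric] powr_numeral)
    then show ?thesis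
      using that[of "u powr (2 - a) *\<^sub>R s"] s xs
      by (simp add: lnorm_scaleR q_ge_1 u_def)
  qed
qed

text \<open>Minkowski's inequality by duality: \<open>x + y\<close> is paired with its own dual
  vector, and Hoelder's inequality is applied to each summand.\<close>

lemma lnorm_triangle:
  fixes x y :: "real ^ 'd::finite"
  shows "lnorm p (x + y) \<le> lnorm p x + lnorm p y"
proof -
  obtain g where g: "(x + y) \<bullet> g = (lnorm p (x + y))\<^sup>2" "lnorm q g = lnorm p (x + y)"
    by (rule ex_dual_vector)
  have "(lnorm p (x + y))\<^sup>2 \<le> (lnorm p x + lnorm p y) * lnorm p (x + y)"
    using lnorm_Holder[of x g] lnorm_Holder[of y g] g by (simp add: algebra_simps inner_add_left)
  then show ?thesis
    using lnorm_nonneg[of p "x + y"] lnorm_nonneg[of p x] lnorm_nonneg[of p y]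
    by (cases "lnorm p (x + y) = 0") (auto simp: power2_eq_square)
qed

lemma lnorm_diff_triangle:
  fixes x y :: "real ^ 'd::finite"
  shows "\<bar>lnorm p x - lnorm p y\<bar> \<le> lnorm p (x - y)"
  using lnorm_triangle[of y "x - y"] lnorm_triangle[of x "y - x"] lnorm_minus[OF p_ge_1, of "x - y"]
  by simp

end

section \<open>Duality for the profile function\<close>

definition score :: "real ^ 'd::finite \<Rightarrow> (real ^ 'd) \<times> real \<Rightarrow> real ^ 'd" where
  "score \<beta> = (\<lambda>(x, y). (y - \<beta> \<bullet> x) *\<^sub>R x)"

lemma measurable_fst_borel:
  "fst \<in> measurable (borel :: ('a::topological_space \<times> 'b::topological_space) measure) borel"
  by (intro borel_measurable_continuous_onI continuous_intros)

lemma measurable_snd_borel: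
  "snd \<in> measurable (borel :: ('a::topological_space \<times> 'b::topological_space) measure) borel"
  by (intro borel_measurable_continuous_onI continuous_intros)

lemma measurable_score: "score \<beta> \<in> borel_measurable borel"
proof -
  have "(\<lambda>(x, y). (y - \<beta> \<bullet> x) *\<^sub>R x) \<in> borel_measurable (borel \<Otimes>\<^sub>M borel)"
    by measurable
  then show ?thesis unfolding score_def borel_prod .
qed

lemma score_zero_alt:
  "score_zero \<beta> = {P. prob_space P \<and> sets P = sets borel \<and> integrable P (score \<beta>) \<and>
     integral\<^sup>L P (score \<beta>) = 0}"
  by (simp add: score_zero_def score_def)

text \<open>Weak duality. Only the values of \<open>\<rho>\<close> at the finitely many observations matter, so \<open>\<rho>\<close>
  may be an infimum over an uncountable set, without any measurability.\<close>

lemma profile_empirical_ge: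
  fixes s :: "nat \<Rightarrow> (real ^ 'd::finite) \<times> real"
  assumes "0 < n"
    and bound: "\<And>i u. i \<in> {1..n} \<Longrightarrow>
      \<rho> (s i) \<le> (lnorm q (u - fst (s i)))\<^sup>2 + \<kappa> \<bullet> score \<beta> (u, snd (s i))"
  shows "ennreal ((\<Sum>i=1..n. \<rho> (s i)) / n) \<le> profile q (empirical n s) \<beta>"
  unfolding profile_def transport_cost_def
proof (intro INF_greatest)
  fix P \<pi>
  assume P: "P \<in> score_zero \<beta>" and \<pi>: "\<pi> \<in> couplings P (empirical n s)"
  let ?U = "uniform_count_measure {1..n}"
  let ?c = "\<lambda>z. (lnorm q (fst (fst z) - fst (snd z)))\<^sup>2"
  have sets_\<pi>: "sets \<pi> = sets borel" and P_eq: "distr \<pi> borel fst = P"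
    and E_eq: "distr \<pi> borel snd = empirical n s" and "prob_space \<pi>"
    using \<pi> by (auto simp: couplings_def)
  interpret prob_space \<pi> by fact
  have meas_\<pi>: "f \<in> measurable \<pi> N \<longleftrightarrow> f \<in> measurable borel N" for f and N :: "'z measure"
    using measurable_cong_sets[OF sets_\<pi> refl] by auto
  have fst_m: "fst \<in> measurable \<pi> borel" and snd_m: "snd \<in> measurable \<pi> borel"
    using measurable_fst_borel measurable_snd_borel by (auto simp: meas_\<pi>)
  have s_m: "s \<in> measurable ?U borel"
    by (auto simp: measurable_def space_uniform_count_measure sets_uniform_count_measure)
  show "ennreal ((\<Sum>i=1..n. \<rho> (s i)) / n) \<le> (\<integral>\<^sup>+ z. (N_dist q (fst z) (snd z))\<^sup>2 \<partial>\<pi>)"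
  proof (cases "(\<integral>\<^sup>+ z. (N_dist q (fst z) (snd z))\<^sup>2 \<partial>\<pi>) = \<infinity>")
    case False
    have N_m: "(\<lambda>z. (N_dist q (fst z) (snd z))\<^sup>2) \<in> borel_measurable \<pi>"
      unfolding meas_\<pi> using N_dist_measurable[of q] by measurable
    have "AE z in \<pi>. (N_dist q (fst z) (snd z))\<^sup>2 \<noteq> \<infinity>"
      using nn_integral_noteq_infinite[OF N_m] False by simp
    then have same: "AE z in \<pi>. snd (fst z) = snd (snd z)"
      by eventually_elim (auto simp: N_dist_def power2_eq_square split: if_splits)
    have "AE v in empirical n s. v \<in> s ` {1..n}"
    proof -
      have "AE i in ?U. s i \<in> s ` {1..n}"
        by (rule AE_I2) (simp add: space_uniform_count_measure)
      then show ?thesis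
        unfolding empirical_def
        by (subst AE_distr_iff[OF s_m]) (auto intro!: borel_closed finite_imp_closed)
    qed
    then have atom: "AE z in \<pi>. snd z \<in> s ` {1..n}"
      unfolding E_eq[symmetric]
      by (subst (asm) AE_distr_iff[OF snd_m]) (auto intro!: borel_closed finite_imp_closed)
    have "AE z in \<pi>. (N_dist q (fst z) (snd z))\<^sup>2 = ennreal (?c z)"
      using same by eventually_elim (auto simp: N_dist_def ennreal_power lnorm_nonneg)
    then have cost: "(\<integral>\<^sup>+ z. (N_dist q (fst z) (snd z))\<^sup>2 \<partial>\<pi>) = (\<integral>\<^sup>+ z. ennreal (?c z) \<partial>\<pi>)"
      by (rule nn_integral_cong_AE)
    have c_m: "?c \<in> borel_measurable \<pi>"
    proof -
      have [measurable]: "(\<lambda>z. fst (fst z) - fst (snd z)) \<in> borel_measurable \<pi>"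
        unfolding meas_\<pi> by (intro borel_measurable_continuous_onI continuous_intros)
      show ?thesis by measurable
    qed
    have c_int: "integrable \<pi> ?c"
      using c_m False by (intro integrableI_nonneg) (auto simp: cost less_top)
    have score_int: "integrable \<pi> (\<lambda>z. score \<beta> (fst z))"
      and score_0: "(\<integral>z. score \<beta> (fst z) \<partial>\<pi>) = 0"
      using P unfolding score_zero_alt P_eq[symmetric]
      by (auto simp: integrable_distr_eq[OF fst_m measurable_score]
          integral_distr[OF fst_m measurable_score])
    \<comment> \<open>Agrees with \<open>\<rho>\<close> on the observations and is a finite
      combination of indicators of points, hence Borel whatever \<open>\<rho>\<close> is.\<close>
    define g where "g v = (\<Sum>a\<in>s ` {1..n}. \<rho> a * indicator {a} v)" for v
    have g: "g v = \<rho> v" if "v \<in> s ` {1..n}" for v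
      using that by (auto simp: g_def indicator_def if_distrib cong: if_cong)
    have g_m: "g \<in> borel_measurable borel"
      unfolding g_def by measurable
    have g_int: "integrable \<pi> (\<lambda>z. g (snd z))"
    proof (rule integrable_const_bound)
      show "AE z in \<pi>. norm (g (snd z)) \<le> (\<Sum>a\<in>s ` {1..n}. \<bar>\<rho> a\<bar>)"
        unfolding g_def
        by (intro always_eventually allI order_trans[OF norm_sum] sum_mono)
          (auto simp: indicator_def)
      show "(\<lambda>z. g (snd z)) \<in> borel_measurable \<pi>"
        using measurable_compose[OF snd_m g_m] .
    qed
    have "(\<Sum>i=1..n. \<rho> (s i)) / n = (\<integral>i. g (s i) \<partial>?U)"
      by (subst integral_uniform_count_measure) (auto simp: g)
    also have "\<dots> = (\<integral>v. g v \<partial>empirical n s)"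
      unfolding empirical_def by (rule integral_distr[OF s_m g_m, symmetric])
    also have "\<dots> = (\<integral>z. g (snd z) \<partial>\<pi>)"
      unfolding E_eq[symmetric] by (rule integral_distr[OF snd_m g_m])
    also have "\<dots> \<le> (\<integral>z. ?c z + \<kappa> \<bullet> score \<beta> (fst z) \<partial>\<pi>)"
    proof (rule integral_mono_AE[OF g_int])
      show "integrable \<pi> (\<lambda>z. ?c z + \<kappa> \<bullet> score \<beta> (fst z))"
        using c_int score_int by (intro Bochner_Integration.integrable_add integrable_inner_right)
      show "AE z in \<pi>. g (snd z) \<le> ?c z + \<kappa> \<bullet> score \<beta> (fst z)"
        using same atom
      proof eventually_elim
        case (elim z)
        then obtain i where i: "i \<in> {1..n}" "snd z = s i" by auto
        then have "fst z = (fst (fst z), snd (s i))" using elim by (metis prod.collapse)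
        with bound[OF i(1), of "fst (fst z)"] i show ?case by (simp add: g)
      qed
    qed
    also have "\<dots> = (\<integral>z. ?c z \<partial>\<pi>)"
      using c_int score_int score_0 by (simp add: integrable_inner_right)
    finally have "ennreal ((\<Sum>i=1..n. \<rho> (s i)) / n) \<le> ennreal (\<integral>z. ?c z \<partial>\<pi>)"
      by (rule ennreal_leI)
    then show ?thesis
      unfolding cost using nn_integral_eq_integral[OF c_int] by simp
  qed simp
qed

text \<open>Every finite feasible transport plan bounds the profile from above. An atom
  \<open>(i, u)\<close> stands for mass \<open>w (i, u)\<close> carried from observation
  \<open>i\<close> to the covariate \<open>u\<close> with the response kept. Plans are indexed by
  \<open>i\<close> rather than by \<open>s i\<close> because observations may coincide.\<close>

lemma profile_empirical_le:
  fixes s :: "nat \<Rightarrow> (real ^ 'd::finite) \<times> real" and w :: "nat \<times> (real ^ 'd) \<Rightarrow> real"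
  assumes "0 < n" and F: "finite F" "F \<subseteq> {1..n} \<times> UNIV" and w: "\<And>z. z \<in> F \<Longrightarrow> 0 \<le> w z"
    and marginal: "\<And>i. i \<in> {1..n} \<Longrightarrow> (\<Sum>z\<in>{z\<in>F. fst z = i}. w z) = 1 / n"
    and mean: "(\<Sum>z\<in>F. w z *\<^sub>R score \<beta> (snd z, snd (s (fst z)))) = 0"
  shows "profile q (empirical n s) \<beta> \<le>
    ennreal (\<Sum>z\<in>F. w z * (lnorm q (snd z - fst (s (fst z))))\<^sup>2)"
proof -
  let ?U = "uniform_count_measure {1..n}"
  define Q where "Q = point_measure F (\<lambda>z. ennreal (w z))"
  have meas: "f \<in> measurable Q borel" for f :: "nat \<times> (real ^ 'd) \<Rightarrow> 'b::topological_space"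
    by (auto simp: measurable_def Q_def space_point_measure sets_point_measure)
  have meas_U: "f \<in> measurable ?U borel" for f :: "nat \<Rightarrow> 'b::topological_space"
    by (auto simp: measurable_def space_uniform_count_measure sets_uniform_count_measure)
  have fst_Q: "fst \<in> measurable Q (count_space {1..n})"
    using F by (auto simp: measurable_def Q_def space_point_measure sets_point_measure)
  have fst_distr: "distr Q (count_space {1..n}) fst = ?U"
  proof (rule measure_eqI_finite[of _ "{1..n}"])
    fix i assume i: "i \<in> {1..n}"
    have "emeasure (distr Q (count_space {1..n}) fst) {i} = emeasure Q {z\<in>F. fst z = i}"
      using i by (subst emeasure_distr[OF fst_Q])
        (auto intro!: arg_cong2[where f=emeasure] simp: Q_def space_point_measure)
    also have "\<dots> = (\<Sum>z\<in>{z\<in>F. fst z = i}. ennreal (w z))"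
      unfolding Q_def using F by (subst emeasure_point_measure_finite) auto
    also have "\<dots> = ennreal (1 / n)"
      using w marginal[OF i] by (subst sum_ennreal) auto
    also have "\<dots> = emeasure ?U {i}"
      using i assms(1) by (subst emeasure_uniform_count_measure) (auto simp: divide_ennreal ennreal_of_nat_eq_real_of_nat)
    finally show "emeasure (distr Q (count_space {1..n}) fst) {i} = emeasure ?U {i}" .
  qed (auto simp: sets_uniform_count_measure)
  have U_prob: "prob_space ?U"
    using assms(1) by (intro prob_space_uniform_count_measure) auto
  \<comment> \<open>The total mass of \<open>Q\<close> is recovered from its image under
    \<open>fst\<close>, the uniform measure on the indices.\<close>
  have "prob_space (distr Q (count_space {1..n}) fst)"
    unfolding fst_distr by fact
  then have Q_prob: "prob_space Q"
    using prob_space_distrD[OF fst_Q] by simp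
  define g where "g z = ((snd z, snd (s (fst z))), s (fst z))" for z :: "nat \<times> (real ^ 'd)"
  define \<pi> where "\<pi> = distr Q borel g"
  define P where "P = distr Q borel (\<lambda>z. (snd z, snd (s (fst z))))"
  have pd: "prob_space (distr Q borel f)" for f :: "nat \<times> (real ^ 'd) \<Rightarrow> 'b::topological_space"
    by (rule prob_space.prob_space_distr[OF Q_prob meas])
  have "distr Q borel (s \<circ> fst) = empirical n s"
    unfolding empirical_def fst_distr[symmetric]
    by (rule distr_distr[symmetric, OF _ fst_Q]) auto
  then have "\<pi> \<in> couplings P (empirical n s)"
    unfolding couplings_def \<pi>_def P_def
    by (auto simp: pd meas distr_distr measurable_fst_borel measurable_snd_borel o_def g_def)
  moreover have "P \<in> score_zero \<beta>"
  proof -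
    have "integrable Q f" for f :: "nat \<times> (real ^ 'd) \<Rightarrow> real ^ 'd"
      unfolding Q_def using F(1) w by (intro integrable_point_measure_finite)
    moreover have "(\<integral>z. score \<beta> (snd z, snd (s (fst z))) \<partial>Q) = 0"
      unfolding Q_def using F(1) w mean by (simp add: lebesgue_integral_point_measure_finite)
    ultimately show ?thesis
      unfolding score_zero_alt P_def
      by (simp add: pd integrable_distr_eq[OF meas measurable_score]
        integral_distr[OF meas measurable_score])
  qed
  moreover have "(\<integral>\<^sup>+ z. (N_dist q (fst z) (snd z))\<^sup>2 \<partial>\<pi>) =
    ennreal (\<Sum>z\<in>F. w z * (lnorm q (snd z - fst (s (fst z))))\<^sup>2)"
  proof -
    have "(\<integral>\<^sup>+ z. (N_dist q (fst z) (snd z))\<^sup>2 \<partial>\<pi>) = (\<integral>\<^sup>+ z. (N_dist q (fst (g z)) (snd (g z)))\<^sup>2 \<partial>Q)"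
      unfolding \<pi>_def
      by (intro nn_integral_distr meas)
         (simp only: measurable_distr_eq1 power2_eq_square
            borel_measurable_times_ennreal N_dist_measurable)
    also have "\<dots> = (\<Sum>z\<in>F. ennreal (w z) * ennreal ((lnorm q (snd z - fst (s (fst z))))\<^sup>2))"
      unfolding Q_def using F(1)
      by (subst nn_integral_point_measure_finite) (auto simp: g_def N_dist_def ennreal_power lnorm_nonneg)
    also have "\<dots> = (\<Sum>z\<in>F. ennreal (w z * (lnorm q (snd z - fst (s (fst z))))\<^sup>2))"
      using w by (intro sum.cong) (auto simp: ennreal_mult)
    also have "\<dots> = ennreal (\<Sum>z\<in>F. w z * (lnorm q (snd z - fst (s (fst z))))\<^sup>2)"
      using w by (intro sum_ennreal) auto
    finally show ?thesis .
  qed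
  ultimately show ?thesis
    unfolding profile_def transport_cost_def
    by (smt (verit) INF_lower order_trans)
qed

text \<open>The constraint couples only finitely many real numbers, so finitely supported couplings
  already give a convex set of attainable pairs (cost, score). A qualification that would force
  \<open>\<alpha> > 0\<close> is deliberately avoided.\<close>

lemma profile_separation:
  fixes s :: "nat \<Rightarrow> (real ^ 'd::finite) \<times> real"
  assumes n: "0 < n" and r: "ennreal r < profile q (empirical n s) \<beta>"
  obtains \<alpha> \<kappa> where "0 \<le> \<alpha>" "\<alpha> \<noteq> 0 \<or> \<kappa> \<noteq> 0"
    "\<And>u. \<alpha> * r \<le>
      (\<Sum>i=1..n. \<alpha> * (lnorm q (u i - fst (s i)))\<^sup>2 + \<kappa> \<bullet> score \<beta> (u i, snd (s i))) / n"
proof -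
  define c where "c z = (lnorm q (snd z - fst (s (fst z))))\<^sup>2" for z :: "nat \<times> (real ^ 'd)"
  define m where "m z = score \<beta> (snd z, snd (s (fst z)))" for z :: "nat \<times> (real ^ 'd)"
  \<comment> \<open>Weights vanish off \<open>F\<close>, so a plan is unaffected by enlarging
    \<open>F\<close>, and two plans can be averaged over a common support.\<close>
  define W where "W F w \<longleftrightarrow> finite F \<and> F \<subseteq> {1..n} \<times> (UNIV :: (real ^ 'd) set) \<and>
    (\<forall>z. 0 \<le> w z) \<and> (\<forall>z. z \<notin> F \<longrightarrow> w z = 0) \<and>
    (\<forall>i\<in>{1..n}. (\<Sum>z\<in>{z\<in>F. fst z = i}. w z) = 1 / n)" for F and w :: "nat \<times> (real ^ 'd) \<Rightarrow> real"
  \<comment> \<open>The cost is only required to be at most \<open>a\<close>; this upward closedness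
    is what forces \<open>0 \<le> \<alpha>\<close> below.\<close>
  define C where "C = {(a, b). \<exists>F w. W F w \<and> (\<Sum>z\<in>F. w z * c z) \<le> a \<and> b = (\<Sum>z\<in>F. w z *\<^sub>R m z)}"
  have W_mono: "W G w" if "W F w" "F \<subseteq> G" "finite G" "G \<subseteq> {1..n} \<times> UNIV" for F G w
  proof -
    have "(\<Sum>z\<in>{z\<in>G. fst z = i}. w z) = (\<Sum>z\<in>{z\<in>F. fst z = i}. w z)" for i
      using that by (intro sum.mono_neutral_right) (auto simp: W_def)
    moreover have "\<forall>z. z \<notin> G \<longrightarrow> w z = 0" using that unfolding W_def by blast
    ultimately show ?thesis using that by (simp add: W_def)
  qed
  have "convex C"
  proof (rule convexI)
    fix x y and u v :: real
    assume xy: "x \<in> C" "y \<in> C" and uv: "0 \<le> u" "0 \<le> v" "u + v = 1"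
    from xy obtain F w where F: "W F w" "(\<Sum>z\<in>F. w z * c z) \<le> fst x" "snd x = (\<Sum>z\<in>F. w z *\<^sub>R m z)"
      by (auto simp: C_def)
    from xy obtain G t where G: "W G t" "(\<Sum>z\<in>G. t z * c z) \<le> fst y" "snd y = (\<Sum>z\<in>G. t z *\<^sub>R m z)"
      by (auto simp: C_def)
    let ?H = "F \<union> G" and ?r = "\<lambda>z. u * w z + v * t z"
    have fin: "finite ?H" "?H \<subseteq> {1..n} \<times> UNIV"
      using F(1) G(1) by (simp_all add: W_def)
    have H: "W ?H w" "W ?H t"
      by (rule W_mono[OF F(1) Un_upper1 fin], rule W_mono[OF G(1) Un_upper2 fin])
    have "W ?H ?r"
    proof -
      have "(\<Sum>z\<in>{z\<in>?H. fst z = i}. ?r z) = 1 / n" if "i \<in> {1..n}" for i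
      proof -
        have "(\<Sum>z\<in>{z\<in>?H. fst z = i}. ?r z) = u * (1 / n) + v * (1 / n)"
          using H that by (simp add: W_def sum.distrib sum_distrib_left[symmetric])
        then show ?thesis using uv by (simp add: add_divide_distrib[symmetric])
      qed
      then show ?thesis using H uv by (simp add: W_def)
    qed
    moreover have "(\<Sum>z\<in>?H. w z * c z) = (\<Sum>z\<in>F. w z * c z)"
        "(\<Sum>z\<in>?H. t z * c z) = (\<Sum>z\<in>G. t z * c z)"
        "(\<Sum>z\<in>?H. w z *\<^sub>R m z) = (\<Sum>z\<in>F. w z *\<^sub>R m z)"
        "(\<Sum>z\<in>?H. t z *\<^sub>R m z) = (\<Sum>z\<in>G. t z *\<^sub>R m z)"
      using F(1) G(1) by (auto intro!: sum.mono_neutral_right simp: W_def)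
    moreover have "(\<Sum>z\<in>?H. ?r z * c z) = u * (\<Sum>z\<in>?H. w z * c z) + v * (\<Sum>z\<in>?H. t z * c z)"
      by (simp add: distrib_right sum.distrib sum_distrib_left mult.assoc)
    moreover have "(\<Sum>z\<in>?H. ?r z *\<^sub>R m z) =
        u *\<^sub>R (\<Sum>z\<in>?H. w z *\<^sub>R m z) + v *\<^sub>R (\<Sum>z\<in>?H. t z *\<^sub>R m z)"
      by (simp add: scaleR_add_left sum.distrib scaleR_sum_right)
    ultimately have "W ?H ?r" "(\<Sum>z\<in>?H. ?r z * c z) \<le> fst (u *\<^sub>R x + v *\<^sub>R y)"
      "snd (u *\<^sub>R x + v *\<^sub>R y) = (\<Sum>z\<in>?H. ?r z *\<^sub>R m z)"
      using F(2,3) G(2,3) uv by (simp_all add: add_mono mult_left_mono)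
    then show "u *\<^sub>R x + v *\<^sub>R y \<in> C"
      unfolding C_def by (simp add: case_prod_beta) blast
  qed
  \<comment> \<open>Plans that move each observation as a whole; these are the only points of
    \<open>C\<close> at which the hyperplane is evaluated.\<close>
  have det: "(a, (\<Sum>i=1..n. m (i, u i)) /\<^sub>R n) \<in> C" if a: "(\<Sum>i=1..n. c (i, u i)) / n \<le> a" for a u
  proof -
    define F where "F = (\<lambda>i. (i, u i)) ` {1..n}"
    define w where "w z = (if z \<in> F then 1 / real n else 0)" for z
    have inj: "inj_on (\<lambda>i. (i, u i)) {1..n}" by (auto simp: inj_on_def)
    have "{z \<in> F. fst z = i} = {(i, u i)}" "w (i, u i) = 1 / n" if "i \<in> {1..n}" for i
      using that by (auto simp: F_def w_def)
    then have "\<forall>i\<in>{1..n}. (\<Sum>z\<in>{z\<in>F. fst z = i}. w z) = 1 / n" by simp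
    moreover have "finite F" "F \<subseteq> {1..n} \<times> UNIV" by (auto simp: F_def)
    ultimately have "W F w" by (simp add: W_def w_def)
    moreover have "(\<Sum>z\<in>F. w z * c z) = (\<Sum>i=1..n. c (i, u i)) / n"
      by (simp add: w_def del: One_nat_def) (simp add: F_def sum.reindex[OF inj] sum_divide_distrib del: One_nat_def)
    moreover have "(\<Sum>z\<in>F. w z *\<^sub>R m z) = (\<Sum>i=1..n. m (i, u i)) /\<^sub>R n"
      by (simp add: w_def del: One_nat_def) (simp add: F_def sum.reindex[OF inj] scaleR_sum_right inverse_eq_divide del: One_nat_def)
    ultimately show ?thesis
      unfolding C_def using a by fastforce
  qed
  then have "C \<noteq> {}" by blast
  moreover have "{(r, 0)} \<inter> C = {}"
  proof (rule ccontr)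
    assume "{(r, 0)} \<inter> C \<noteq> {}"
    then obtain F w where F: "W F w" "(\<Sum>z\<in>F. w z * c z) \<le> r" "(\<Sum>z\<in>F. w z *\<^sub>R m z) = 0"
      by (auto simp: C_def)
    then have "profile q (empirical n s) \<beta> \<le> ennreal (\<Sum>z\<in>F. w z * c z)"
      unfolding c_def m_def W_def using n by (intro profile_empirical_le) auto
    also have "\<dots> \<le> ennreal r" using F by (intro ennreal_leI)
    finally show False using r by simp
  qed
  ultimately obtain a b where "a \<noteq> 0" "\<forall>x\<in>{(r, 0)}. a \<bullet> x \<le> b" "\<forall>x\<in>C. b \<le> a \<bullet> x"
    using separating_hyperplane_sets[of "{(r, 0)}" C] \<open>convex C\<close> by blast
  then have ab: "a \<noteq> 0" "a \<bullet> (r, 0) \<le> b" "\<And>x. x \<in> C \<Longrightarrow> b \<le> a \<bullet> x"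
    by blast+
  obtain \<alpha> \<kappa> where a: "a = (\<alpha>, \<kappa>)" by (cases a)
  have main: "\<alpha> * r \<le> \<alpha> * t + \<kappa> \<bullet> ((\<Sum>i=1..n. m (i, u i)) /\<^sub>R n)"
    if "(\<Sum>i=1..n. c (i, u i)) / n \<le> t" for t u
    using ab(2) ab(3)[OF det[OF that]] by (simp add: a)
  have "0 \<le> \<alpha>"
  proof (rule ccontr)
    assume "\<not> 0 \<le> \<alpha>"
    define u where "u = (\<lambda>i::nat. 0 :: real ^ 'd)"
    define k where "k = \<kappa> \<bullet> ((\<Sum>i=1..n. m (i, u i)) /\<^sub>R n)"
    define t0 where "t0 = (\<Sum>i=1..n. c (i, u i)) / n"
    \<comment> \<open>Large enough to push \<open>\<alpha> * t + k\<close> down to at most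
      \<open>\<alpha> * r - 1\<close> for negative \<open>\<alpha>\<close>.\<close>
    define t where "t = max t0 (r + (k + 1) / (- \<alpha>))"
    have "\<alpha> * r \<le> \<alpha> * t + k" using main[of u t] by (simp add: k_def t_def t0_def)
    moreover have "\<alpha> * t \<le> \<alpha> * (r + (k + 1) / (- \<alpha>))"
      using \<open>\<not> 0 \<le> \<alpha>\<close> by (intro mult_left_mono_neg) (auto simp: t_def)
    moreover have "\<alpha> * (r + (k + 1) / (- \<alpha>)) = \<alpha> * r - (k + 1)"
      using \<open>\<not> 0 \<le> \<alpha>\<close> by (simp add: field_simps)
    ultimately show False by linarith
  qed
  moreover have "\<alpha> \<noteq> 0 \<or> \<kappa> \<noteq> 0" using ab(1) by (simp add: a zero_prod_def)
  moreover have "\<alpha> * r \<le>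
      (\<Sum>i=1..n. \<alpha> * (lnorm q (u i - fst (s i)))\<^sup>2 + \<kappa> \<bullet> score \<beta> (u i, snd (s i))) / n" for u
    using main[of u, OF order_refl]
    by (simp add: c_def m_def sum.distrib sum_distrib_left[symmetric] inner_sum_right
        divide_inverse algebra_simps)
  ultimately show ?thesis by (rule that)
qed

section \<open>The rescaled dual problem\<close>

definition resid :: "real ^ 'd::finite \<Rightarrow> (real ^ 'd) \<times> real \<Rightarrow> real" where
  "resid \<beta> a = snd a - \<beta> \<bullet> fst a"

definition tilt :: "real ^ 'd::finite \<Rightarrow> (real ^ 'd) \<times> real \<Rightarrow> real ^ 'd \<Rightarrow> real ^ 'd" where
  "tilt \<beta> a \<zeta> = resid \<beta> a *\<^sub>R \<zeta> - (\<zeta> \<bullet> fst a) *\<^sub>R \<beta>"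

definition score_sum :: "real ^ 'd::finite \<Rightarrow> nat \<Rightarrow> (nat \<Rightarrow> (real ^ 'd) \<times> real) \<Rightarrow> real ^ 'd" where
  "score_sum \<beta> n s = (\<Sum>i=1..n. resid \<beta> (s i) *\<^sub>R fst (s i)) /\<^sub>R sqrt n"

definition tilt_mean ::
  "ereal \<Rightarrow> real ^ 'd::finite \<Rightarrow> nat \<Rightarrow> (nat \<Rightarrow> (real ^ 'd) \<times> real) \<Rightarrow> real ^ 'd \<Rightarrow> real" where
  "tilt_mean p \<beta> n s \<zeta> = (\<Sum>i=1..n. (lnorm p (tilt \<beta> (s i) \<zeta>))\<^sup>2) / n"

lemma tilt_scaleR: "tilt \<beta> a (t *\<^sub>R \<zeta>) = t *\<^sub>R tilt \<beta> a \<zeta>"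
  by (simp add: tilt_def algebra_simps)

lemma tilt_diff: "tilt \<beta> a (\<zeta> - \<xi>) = tilt \<beta> a \<zeta> - tilt \<beta> a \<xi>"
  by (simp add: tilt_def algebra_simps inner_diff_left)

lemma inner_score_shift:
  "\<kappa> \<bullet> score \<beta> (fst a + D, snd a) =
    resid \<beta> a * (\<kappa> \<bullet> fst a) + tilt \<beta> a \<kappa> \<bullet> D - (\<beta> \<bullet> D) * (\<kappa> \<bullet> D)"
  by (simp add: score_def tilt_def resid_def algebra_simps inner_add_left inner_add_right
      inner_diff_left inner_diff_right)

lemma inner_score_sum:
  assumes "0 < n"
  shows "(\<Sum>i=1..n. resid \<beta> (s i) * (((2 / sqrt n) *\<^sub>R \<zeta>) \<bullet> fst (s i))) = 2 * (\<zeta> \<bullet> score_sum \<beta> n s)"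
  using assms
  by (simp add: score_sum_def inner_sum_right inner_scaleR_right divide_inverse sum_distrib_left
      mult_ac)

text \<open>The Fenchel conjugate of \<open>A\<close> at \<open>2 s\<close>, called \<open>F\<close>
  in the overview. The real supremum is meaningful only when the range is bounded above, which
  coercivity of \<open>A\<close> provides.\<close>

definition quad_sup :: "(real ^ 'd::finite \<Rightarrow> real) \<Rightarrow> real ^ 'd \<Rightarrow> real" where
  "quad_sup A s = (SUP \<zeta>. 2 * (\<zeta> \<bullet> s) - A \<zeta>)"

text \<open>Cauchy-Schwarz reduces the claim to norms, where it is the square
  \<open>(c * norm \<zeta> - norm s)\<^sup>2\<close> divided by \<open>c\<close>.\<close>

lemma quad_le:
  fixes \<zeta> s :: "'a::real_inner"
  assumes "0 < c" "c * (norm \<zeta>)\<^sup>2 \<le> a"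
  shows "2 * (\<zeta> \<bullet> s) - a \<le> (norm s)\<^sup>2 / c"
proof -
  have "0 \<le> (c * norm \<zeta> - norm s)\<^sup>2 / c" using assms by simp
  also have "\<dots> = c * (norm \<zeta>)\<^sup>2 - 2 * (norm \<zeta> * norm s) + (norm s)\<^sup>2 / c"
    using assms by (simp add: field_simps power2_eq_square)
  finally show ?thesis
    using norm_cauchy_schwarz[of \<zeta> s] assms by linarith
qed

lemma quad_sup_bdd:
  assumes "0 < c" "\<And>\<zeta>. c * (norm \<zeta>)\<^sup>2 \<le> A \<zeta>"
  shows "bdd_above (range (\<lambda>\<zeta>. 2 * (\<zeta> \<bullet> s) - A \<zeta>))"
  using quad_le[OF assms] by (intro bdd_aboveI) auto

lemma quad_sup_nonneg:
  assumes "0 < c" "\<And>\<zeta>. c * (norm \<zeta>)\<^sup>2 \<le> A \<zeta>" "A 0 = 0"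
  shows "0 \<le> quad_sup A s"
  unfolding quad_sup_def
  by (rule cSUP_upper2[OF quad_sup_bdd[OF assms(1,2)], where x = 0]) (use assms in auto)

context conjugate_exponents
begin

text \<open>Hoelder's inequality on each factor. The quadratic remainder of the score is thereby a
  multiple of the transport cost itself, so it only perturbs the coefficient of the cost.\<close>

lemma product_le_lnorm: "\<bar>(\<beta> \<bullet> D) * (\<kappa> \<bullet> D)\<bar> \<le> lnorm p \<beta> * lnorm p \<kappa> * (lnorm q D)\<^sup>2"
proof -
  have "\<bar>(\<beta> \<bullet> D) * (\<kappa> \<bullet> D)\<bar> \<le> (lnorm p \<beta> * lnorm q D) * (lnorm p \<kappa> * lnorm q D)"
    unfolding abs_mult by (intro mult_mono lnorm_Holder) (auto intro!: mult_nonneg_nonneg lnorm_nonneg)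
  then show ?thesis by (simp add: power2_eq_square mult_ac)
qed

text \<open>Weak duality. At a displacement of length \<open>t\<close> the quadratic remainder is at
  most \<open>\<delta> * t\<^sup>2\<close>, so besides its linear term each observation contributes
  at least the minimum over \<open>t\<close> of \<open>(1 - \<delta>) * t\<^sup>2 - v * t\<close>,
  where \<open>v\<close> is the p-norm of the tilt; hence the division by
  \<open>1 - \<delta>\<close>.\<close>

lemma profile_lower:
  fixes s :: "nat \<Rightarrow> (real ^ 'd::finite) \<times> real"
  assumes n: "0 < n" and \<delta>: "2 * lnorm p \<beta> * lnorm p \<zeta> / sqrt n \<le> \<delta>" "\<delta> < 1"
  shows "2 * (\<zeta> \<bullet> score_sum \<beta> n s) - tilt_mean p \<beta> n s \<zeta> / (1 - \<delta>)
    \<le> n * enn2real (profile q (empirical n s) \<beta>)"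
proof -
  \<comment> \<open>In this scaling the linear terms add up to
    \<open>2 * (\<zeta> \<bullet> score_sum \<beta> n s)\<close>, and a quarter of the squared norm
    of the tilt is one summand of \<open>tilt_mean\<close>.\<close>
  define \<kappa> where "\<kappa> = (2 / sqrt n) *\<^sub>R \<zeta>"
  define \<rho> where "\<rho> a = resid \<beta> a * (\<kappa> \<bullet> fst a) - (lnorm p (tilt \<beta> a \<kappa>))\<^sup>2 / (4 * (1 - \<delta>))" for a
  have B: "lnorm p \<beta> * lnorm p \<kappa> \<le> \<delta>"
    using \<delta> by (simp add: \<kappa>_def lnorm_scaleR p_ge_1 mult_ac)
  have "\<rho> a \<le> (lnorm q (u - fst a))\<^sup>2 + \<kappa> \<bullet> score \<beta> (u, snd a)" for a u
  proof -
    define D where "D = u - fst a"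
    define t v where "t = lnorm q D" and "v = lnorm p (tilt \<beta> a \<kappa>)"
    have "\<bar>(\<beta> \<bullet> D) * (\<kappa> \<bullet> D)\<bar> \<le> \<delta> * t\<^sup>2"
      using product_le_lnorm[of \<beta> D \<kappa>] mult_right_mono[OF B, of "t\<^sup>2"] by (simp add: t_def)
    moreover have "\<bar>tilt \<beta> a \<kappa> \<bullet> D\<bar> \<le> v * t"
      unfolding t_def v_def by (rule lnorm_Holder)
    moreover have "0 \<le> (2 * (1 - \<delta>) * t - v)\<^sup>2 / (4 * (1 - \<delta>))"
      using \<delta> by simp
    then have "0 \<le> (1 - \<delta>) * t\<^sup>2 - v * t + v\<^sup>2 / (4 * (1 - \<delta>))"
      using \<delta> by (simp add: field_simps power2_eq_square)
    moreover have "\<kappa> \<bullet> score \<beta> (u, snd a) =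
        resid \<beta> a * (\<kappa> \<bullet> fst a) + tilt \<beta> a \<kappa> \<bullet> D - (\<beta> \<bullet> D) * (\<kappa> \<bullet> D)"
      using inner_score_shift[of \<kappa> \<beta> a D] by (simp add: D_def)
    ultimately show ?thesis
      unfolding \<rho>_def t_def[symmetric] v_def[symmetric] D_def[symmetric]
      by (simp add: algebra_simps abs_le_iff)
  qed
  then have "ennreal ((\<Sum>i=1..n. \<rho> (s i)) / n) \<le> profile q (empirical n s) \<beta>"
    using n by (intro profile_empirical_ge)
  then have "(\<Sum>i=1..n. \<rho> (s i)) / n \<le> enn2real (profile q (empirical n s) \<beta>)"
    using profile_empirical_finite[OF n, of q s \<beta>]
    by (cases "profile q (empirical n s) \<beta>") (auto simp: ennreal_le_iff2)
  moreover have "(\<Sum>i=1..n. \<rho> (s i)) =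
      2 * (\<zeta> \<bullet> score_sum \<beta> n s) - (\<Sum>i=1..n. (lnorm p (tilt \<beta> (s i) \<kappa>))\<^sup>2 / (4 * (1 - \<delta>)))"
    unfolding \<rho>_def sum_subtractf \<kappa>_def inner_score_sum[OF n] ..
  moreover have "(lnorm p (tilt \<beta> a \<kappa>))\<^sup>2 / (4 * (1 - \<delta>)) = (lnorm p (tilt \<beta> a \<zeta>))\<^sup>2 / n / (1 - \<delta>)" for a
    using n \<delta> by (simp add: \<kappa>_def tilt_scaleR lnorm_scaleR p_ge_1 power_mult_distrib power_divide field_simps)
  then have "(\<Sum>i=1..n. (lnorm p (tilt \<beta> (s i) \<kappa>))\<^sup>2 / (4 * (1 - \<delta>))) = tilt_mean p \<beta> n s \<zeta> / (1 - \<delta>)"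
    by (simp add: tilt_mean_def sum_divide_distrib)
  ultimately show ?thesis
    using n by (simp add: divide_le_eq mult.commute)
qed

text \<open>The separating functional belonging to a value below the profile is tested on a single
  displacement per observation. The second alternative covers a multiplier that had to be shrunk
  onto the sphere of radius \<open>K\<close>, including the vertical case
  \<open>\<alpha> = 0\<close>; there only nonnegativity of the objective survives.\<close>

lemma profile_upper:
  fixes s :: "nat \<Rightarrow> (real ^ 'd::finite) \<times> real"
  assumes n: "0 < n" and r: "0 \<le> r" "r < n * enn2real (profile q (empirical n s) \<beta>)" and K: "0 < K"
  obtains \<zeta> where "norm \<zeta> \<le> K"
    "r \<le> 2 * (\<zeta> \<bullet> score_sum \<beta> n s) - (1 - 2 * lnorm p \<beta> * lnorm p \<zeta> / sqrt n) * tilt_mean p \<beta> n s \<zeta> \<or>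
     norm \<zeta> = K \<and> 0 \<le> 2 * (\<zeta> \<bullet> score_sum \<beta> n s) - (1 - 2 * lnorm p \<beta> * lnorm p \<zeta> / sqrt n) * tilt_mean p \<beta> n s \<zeta>"
proof -
  have less: "ennreal (r / n) < profile q (empirical n s) \<beta>"
    using r n by (cases "profile q (empirical n s) \<beta>")
      (auto simp: ennreal_less_iff field_simps)
  obtain \<alpha> \<kappa>0 where ak: "0 \<le> \<alpha>" "\<alpha> \<noteq> 0 \<or> \<kappa>0 \<noteq> 0" and
    sep: "\<And>u. \<alpha> * (r / n) \<le>
      (\<Sum>i=1..n. \<alpha> * (lnorm q (u i - fst (s i)))\<^sup>2 + \<kappa>0 \<bullet> score \<beta> (u i, snd (s i))) / n"
    by (rule profile_separation[OF n less]) (rule that)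
  txt \<open>Rescaling the multiplier into the ball of radius K: by concavity of the dual function,
    which vanishes at the origin, a multiplier outside the ball yields one on the sphere.\<close>
  obtain h where h: "0 < h" "h * \<alpha> \<le> 1" "norm (h *\<^sub>R \<kappa>0) \<le> 2 * K / sqrt n"
    "h * \<alpha> = 1 \<or> norm (h *\<^sub>R \<kappa>0) = 2 * K / sqrt n"
  proof (cases "norm \<kappa>0 \<le> \<alpha> * (2 * K / sqrt n)")
    case True
    then have "0 < \<alpha>" using ak by (cases "\<alpha> = 0") auto
    then show ?thesis using True by (intro that[of "1 / \<alpha>"]) (auto simp: field_simps)
  next
    case False
    define R where "R = 2 * K / sqrt n"
    have R: "0 < R" "\<alpha> * R < norm \<kappa>0" using K n False by (auto simp: R_def)
    then have "0 < norm \<kappa>0" using ak(1) by (meson le_less_trans less_imp_le mult_nonneg_nonneg)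
    then show ?thesis using R
      by (intro that[of "R / norm \<kappa>0"]) (auto simp: divide_le_eq mult.commute[of R \<alpha>] simp flip: R_def)
  qed
  define \<zeta> where "\<zeta> = (sqrt n / 2) *\<^sub>R (h *\<^sub>R \<kappa>0)"
  have \<zeta>: "(2 / sqrt n) *\<^sub>R \<zeta> = h *\<^sub>R \<kappa>0" "norm \<zeta> = sqrt n / 2 * norm (h *\<^sub>R \<kappa>0)"
    using n by (auto simp: \<zeta>_def abs_mult)
  define \<kappa> where "\<kappa> = h *\<^sub>R \<kappa>0"
  obtain g where g: "\<And>a. tilt \<beta> a \<kappa> \<bullet> g a = (lnorm p (tilt \<beta> a \<kappa>))\<^sup>2"
     "\<And>a. lnorm q (g a) = lnorm p (tilt \<beta> a \<kappa>)"
  proof -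
    have "\<exists>g. tilt \<beta> a \<kappa> \<bullet> g = (lnorm p (tilt \<beta> a \<kappa>))\<^sup>2 \<and> lnorm q g = lnorm p (tilt \<beta> a \<kappa>)" for a
      by (rule ex_dual_vector[of "tilt \<beta> a \<kappa>"]) blast
    then show ?thesis using that by metis
  qed
  \<comment> \<open>The displacement \<open>D = - g / 2\<close> minimises the squared q-norm of
    \<open>D\<close> plus \<open>tilt \<bullet> D\<close>, that is, the Lagrangian without its
    quadratic remainder; the minimum is minus a quarter of the squared p-norm of the tilt.\<close>
  define u where "u i = fst (s i) + (- 1 / 2) *\<^sub>R g (s i)" for i
  define \<delta> where "\<delta> = 2 * lnorm p \<beta> * lnorm p \<zeta> / sqrt n"
  have \<delta>: "lnorm p \<beta> * lnorm p \<kappa> = \<delta>"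
    using n by (simp add: \<kappa>_def \<zeta>(1)[symmetric] lnorm_scaleR p_ge_1 \<delta>_def)
  have summand: "(h * \<alpha>) * (lnorm q (u i - fst (s i)))\<^sup>2 + \<kappa> \<bullet> score \<beta> (u i, snd (s i)) \<le>
      resid \<beta> (s i) * (\<kappa> \<bullet> fst (s i)) - (1 - \<delta>) * ((lnorm p (tilt \<beta> (s i) \<zeta>))\<^sup>2 / n)" for i
  proof -
    define D where "D = (- 1 / 2) *\<^sub>R g (s i)"
    define t where "t = lnorm p (tilt \<beta> (s i) \<kappa>)"
    define v where "v = (lnorm p (tilt \<beta> (s i) \<zeta>))\<^sup>2 / n"
    have D: "lnorm q D = t / 2" "tilt \<beta> (s i) \<kappa> \<bullet> D = - t\<^sup>2 / 2"
      unfolding D_def t_def lnorm_scaleR[OF q_ge_1] inner_scaleR_right g by auto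
    have "\<kappa> \<bullet> score \<beta> (u i, snd (s i)) =
        resid \<beta> (s i) * (\<kappa> \<bullet> fst (s i)) + tilt \<beta> (s i) \<kappa> \<bullet> D - (\<beta> \<bullet> D) * (\<kappa> \<bullet> D)"
      using inner_score_shift[of \<kappa> \<beta> "s i" D] by (simp add: D_def u_def)
    moreover have "\<bar>(\<beta> \<bullet> D) * (\<kappa> \<bullet> D)\<bar> \<le> \<delta> * t\<^sup>2 / 4"
      using product_le_lnorm[of \<beta> D \<kappa>] unfolding \<delta> D by (simp add: power_divide)
    moreover have "u i - fst (s i) = D" by (simp add: u_def D_def)
    moreover have "(h * \<alpha>) * (t / 2)\<^sup>2 \<le> 1 * (t / 2)\<^sup>2"
      using h by (intro mult_right_mono) auto
    moreover have "t\<^sup>2 = 4 * v"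
      using n by (simp add: v_def t_def \<kappa>_def \<zeta>(1)[symmetric] tilt_scaleR lnorm_scaleR p_ge_1 power_mult_distrib power_divide)
    ultimately show ?thesis
      unfolding v_def[symmetric] by (simp add: D power_divide algebra_simps abs_le_iff)
  qed
  have "h * (\<alpha> * r) \<le> h * (\<Sum>i=1..n. \<alpha> * (lnorm q (u i - fst (s i)))\<^sup>2 + \<kappa>0 \<bullet> score \<beta> (u i, snd (s i)))"
    using sep[of u] n h(1) by (intro mult_left_mono) (auto simp: field_simps)
  also have "\<dots> = (\<Sum>i=1..n. (h * \<alpha>) * (lnorm q (u i - fst (s i)))\<^sup>2 + \<kappa> \<bullet> score \<beta> (u i, snd (s i)))"
    by (simp add: sum_distrib_left \<kappa>_def algebra_simps)
  also have "\<dots> \<le> (\<Sum>i=1..n. resid \<beta> (s i) * (\<kappa> \<bullet> fst (s i)) - (1 - \<delta>) * ((lnorm p (tilt \<beta> (s i) \<zeta>))\<^sup>2 / n))"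
    by (intro sum_mono summand)
  also have "\<dots> = 2 * (\<zeta> \<bullet> score_sum \<beta> n s) - (1 - \<delta>) * tilt_mean p \<beta> n s \<zeta>"
    unfolding sum_subtractf \<kappa>_def \<zeta>(1)[symmetric] inner_score_sum[OF n]
    by (simp add: tilt_mean_def sum_distrib_left sum_divide_distrib)
  finally have main: "(h * \<alpha>) * r \<le> 2 * (\<zeta> \<bullet> score_sum \<beta> n s) - (1 - \<delta>) * tilt_mean p \<beta> n s \<zeta>"
    by (simp add: mult_ac)
  have "norm \<zeta> \<le> K"
    using h(3) n unfolding \<zeta>(2) by (simp add: field_simps)
  moreover have "h * \<alpha> = 1 \<or> norm \<zeta> = K"
    using h(4) n unfolding \<zeta>(2) by (auto simp: field_simps)
  moreover have "0 \<le> (h * \<alpha>) * r" using h ak r by simp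
  ultimately show ?thesis
    using main by (intro that[of \<zeta>]) (auto simp: \<delta>_def)
qed

text \<open>Only multipliers in a ball of radius \<open>K\<close> matter, and there
  \<open>large\<close> keeps the relative error below \<open>\<eta>\<close>. For the lower bound, a
  multiplier with positive objective has norm at most \<open>2 * L / c\<close> by coercivity. For
  the upper bound, coercivity refutes the alternative on the sphere. Homogeneity turns the factors
  in front of \<open>A\<close> into factors in front of the conjugate.\<close>

lemma profile_sandwich:
  fixes s :: "nat \<Rightarrow> (real ^ 'd::finite) \<times> real" and A :: "real ^ 'd \<Rightarrow> real"
  assumes n: "0 < n" and c: "0 < c" "\<And>\<zeta>. c * (norm \<zeta>)\<^sup>2 \<le> A \<zeta>"
    and hom: "\<And>t \<zeta>. A (t *\<^sub>R \<zeta>) = t\<^sup>2 * A \<zeta>"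
    and \<eta>: "0 < \<eta>" "\<eta> \<le> 1 / 2"
    and close: "\<And>\<zeta>. (1 - \<eta>) * A \<zeta> \<le> tilt_mean p \<beta> n s \<zeta>" "\<And>\<zeta>. tilt_mean p \<beta> n s \<zeta> \<le> (1 + \<eta>) * A \<zeta>"
    and L: "norm (score_sum \<beta> n s) \<le> L"
    and large: "2 * lnorm p \<beta> * (CARD('d) * (8 * L / c + 1)) / sqrt n \<le> \<eta>"
  shows "(1 - \<eta>) / (1 + \<eta>) * quad_sup A (score_sum \<beta> n s) \<le> n * enn2real (profile q (empirical n s) \<beta>)"
    and "n * enn2real (profile q (empirical n s) \<beta>) \<le> quad_sup A (score_sum \<beta> n s) / (1 - \<eta>)\<^sup>2"
proof -
  define S where "S = score_sum \<beta> n s"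
  define R where "R = n * enn2real (profile q (empirical n s) \<beta>)"
  \<comment> \<open>On the sphere of radius \<open>K\<close> the quadratic part is at least
    \<open>c * K\<^sup>2 / 4\<close>, because \<open>(1 - \<eta>)\<^sup>2\<close> is at least
    \<open>1 / 4\<close>, while the linear part is at most \<open>2 * K * L\<close>. Any
    \<open>K\<close> above \<open>8 * L / c\<close> lets the former win.\<close>
  define K where "K = 8 * L / c + 1"
  have L0: "0 \<le> L" using L norm_ge_zero order_trans by blast
  have K0: "0 < K" using L0 c by (simp add: K_def add_nonneg_pos)
  have A0: "0 \<le> A \<zeta>" for \<zeta> using c(2)[of \<zeta>] c(1) by (meson mult_nonneg_nonneg order_trans less_imp_le zero_le_power2)
  have A_zero: "A 0 = 0" using hom[of 0 0] by simp
  have small: "2 * lnorm p \<beta> * lnorm p \<zeta> / sqrt n \<le> \<eta>" if "norm \<zeta> \<le> K" for \<zeta> :: "real ^ 'd"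
  proof -
    have "lnorm p \<zeta> \<le> CARD('d) * K"
      using lnorm_le_norm[OF p_ge_1, of \<zeta>] mult_left_mono[OF that, of "real CARD('d)"] by linarith
    then have "2 * lnorm p \<beta> * lnorm p \<zeta> / sqrt n \<le> 2 * lnorm p \<beta> * (CARD('d) * K) / sqrt n"
      by (intro divide_right_mono mult_left_mono) (auto simp: lnorm_nonneg)
    then show ?thesis using large by (simp add: K_def)
  qed
  have R0: "0 \<le> R" by (simp add: R_def)
  show "(1 - \<eta>) / (1 + \<eta>) * quad_sup A (score_sum \<beta> n s) \<le> n * enn2real (profile q (empirical n s) \<beta>)"
  proof -
    have "2 * (\<xi> \<bullet> S) - A \<xi> \<le> (1 + \<eta>) / (1 - \<eta>) * R" for \<xi>
    proof (cases "2 * (\<xi> \<bullet> S) - A \<xi> \<le> 0")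
      case True
      moreover have "0 \<le> (1 + \<eta>) / (1 - \<eta>) * R" using R0 \<eta> by simp
      ultimately show ?thesis by linarith
    next
      case False
      define k where "k = (1 + \<eta>) / (1 - \<eta>)"
      have k: "1 \<le> k" "(1 + \<eta>) = k * (1 - \<eta>)" using \<eta> by (auto simp: k_def)
      have "c * (norm \<xi>)\<^sup>2 \<le> 2 * (norm \<xi> * L)"
        using False c(2)[of \<xi>] norm_cauchy_schwarz[of \<xi> S] mult_left_mono[OF L, of "norm \<xi>"] unfolding S_def by simp
      moreover have "\<xi> \<noteq> 0" using False A_zero by auto
      ultimately have "c * norm \<xi> \<le> 2 * L"
        by (simp add: power2_eq_square)
      then have "norm \<xi> \<le> 2 * L / c" using c by (simp add: field_simps)
      also have "\<dots> \<le> K" using L0 c by (simp add: K_def field_simps)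
      finally have \<xi>: "norm \<xi> \<le> K" .
      \<comment> \<open>At this multiplier the linear term and \<open>k * A \<zeta>\<close> both
        carry the factor \<open>1 / k\<close>, so the whole objective is scaled by it.\<close>
      define \<zeta> where "\<zeta> = (1 / k) *\<^sub>R \<xi>"
      have "norm \<zeta> \<le> norm \<xi>" using k(1) mult_left_mono[of 1 k "norm \<xi>"] by (simp add: \<zeta>_def divide_le_eq)
      then have "2 * (\<zeta> \<bullet> S) - tilt_mean p \<beta> n s \<zeta> / (1 - \<eta>) \<le> R"
        unfolding S_def R_def using \<eta> \<xi> by (intro profile_lower[OF n small]) auto
      moreover have "tilt_mean p \<beta> n s \<zeta> / (1 - \<eta>) \<le> (k * (1 - \<eta>)) * A \<zeta> / (1 - \<eta>)"
        using close(2)[of \<zeta>] k(2) \<eta> by (intro divide_right_mono) auto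
      moreover have "(k * (1 - \<eta>)) * A \<zeta> / (1 - \<eta>) = A \<xi> / k"
        using \<eta> k(1) by (simp add: \<zeta>_def hom power2_eq_square field_simps)
      ultimately have "(2 * (\<xi> \<bullet> S) - A \<xi>) / k \<le> R"
        by (simp add: \<zeta>_def diff_divide_distrib)
      then show ?thesis using k(1) by (simp add: k_def[symmetric] divide_le_eq mult.commute)
    qed
    then have "quad_sup A S \<le> (1 + \<eta>) / (1 - \<eta>) * R"
      unfolding quad_sup_def by (intro cSUP_least) auto
    then show ?thesis using \<eta> by (simp add: S_def R_def field_simps)
  qed
  show "n * enn2real (profile q (empirical n s) \<beta>) \<le> quad_sup A (score_sum \<beta> n s) / (1 - \<eta>)\<^sup>2"
  proof (rule ccontr)
    assume neg: "\<not> ?thesis"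
    define k where "k = (1 - \<eta>)\<^sup>2"
    have k: "0 < k" "1 / 4 \<le> k"
      using \<eta> power_mono[of "1 / 2" "1 - \<eta>" 2] by (auto simp: k_def power_divide)
    define r where "r = (quad_sup A S / k + R) / 2"
    have r: "quad_sup A S / k < r" "r < R" using neg by (auto simp: r_def S_def R_def k_def field_simps)
    have Q: "0 \<le> quad_sup A S / k"
      using quad_sup_nonneg[OF c A_zero, of S] k by simp
    obtain \<zeta> where \<zeta>: "norm \<zeta> \<le> K"
      "r \<le> 2 * (\<zeta> \<bullet> S) - (1 - 2 * lnorm p \<beta> * lnorm p \<zeta> / sqrt n) * tilt_mean p \<beta> n s \<zeta> \<or>
       norm \<zeta> = K \<and> 0 \<le> 2 * (\<zeta> \<bullet> S) - (1 - 2 * lnorm p \<beta> * lnorm p \<zeta> / sqrt n) * tilt_mean p \<beta> n s \<zeta>"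
      using profile_upper[OF n _ _ K0, of r s \<beta>] r Q unfolding S_def R_def by force
    have "k * A \<zeta> \<le> (1 - \<eta>) * tilt_mean p \<beta> n s \<zeta>"
      using mult_left_mono[OF close(1)[of \<zeta>], of "1 - \<eta>"] \<eta> by (simp add: k_def power2_eq_square)
    also have "\<dots> \<le> (1 - 2 * lnorm p \<beta> * lnorm p \<zeta> / sqrt n) * tilt_mean p \<beta> n s \<zeta>"
      using small[OF \<zeta>(1)] by (intro mult_right_mono) (auto simp: tilt_mean_def intro!: divide_nonneg_nonneg sum_nonneg)
    finally have le: "2 * (\<zeta> \<bullet> S) - (1 - 2 * lnorm p \<beta> * lnorm p \<zeta> / sqrt n) * tilt_mean p \<beta> n s \<zeta>
        \<le> 2 * (\<zeta> \<bullet> S) - k * A \<zeta>" by simp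
    from \<zeta>(2) show False
    proof
      assume "r \<le> 2 * (\<zeta> \<bullet> S) - (1 - 2 * lnorm p \<beta> * lnorm p \<zeta> / sqrt n) * tilt_mean p \<beta> n s \<zeta>"
      \<comment> \<open>The factor \<open>k\<close> moves into the multiplier:
        \<open>k * (2 * (\<zeta> \<bullet> S) - k * A \<zeta>)\<close> is the objective at
        \<open>k *\<^sub>R \<zeta>\<close>.\<close>
      then have "k * r \<le> k * (2 * (\<zeta> \<bullet> S) - k * A \<zeta>)"
        using le k by (intro mult_left_mono) auto
      also have "\<dots> = 2 * ((k *\<^sub>R \<zeta>) \<bullet> S) - A (k *\<^sub>R \<zeta>)"
        by (simp add: hom power2_eq_square algebra_simps)
      also have "\<dots> \<le> quad_sup A S"
        unfolding quad_sup_def by (rule cSUP_upper[OF _ quad_sup_bdd[OF c]]) auto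
      finally show False using r k by (simp add: field_simps)
    next
      assume \<section>: "norm \<zeta> = K \<and> 0 \<le> 2 * (\<zeta> \<bullet> S) - (1 - 2 * lnorm p \<beta> * lnorm p \<zeta> / sqrt n) * tilt_mean p \<beta> n s \<zeta>"
      have "K * norm S \<le> K * L" using L K0 by (simp add: S_def)
      then have "\<zeta> \<bullet> S \<le> K * L"
        using norm_cauchy_schwarz[of \<zeta> S] \<section> by (metis order_trans)
      moreover have "1 / 4 * (c * K\<^sup>2) \<le> k * A \<zeta>"
        using k c(2)[of \<zeta>] c(1) \<section> by (intro mult_mono) auto
      ultimately have "0 \<le> 2 * (K * L) - 1 / 4 * (c * K\<^sup>2)" using le \<section> by linarith
      also have "\<dots> = K / 4 * (8 * L - c * K)" by (simp add: power2_eq_square algebra_simps)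
      also have "8 * L - c * K = - c" using c by (simp add: K_def field_simps)
      finally show False using K0 c by (simp add: mult_le_0_iff zero_le_mult_iff)
    qed
  qed
qed

end

section \<open>Measurability of the profile function\<close>

lemma continuous_on_lnorm:
  assumes "1 \<le> r"
  shows "continuous_on UNIV (lnorm r)"
proof (cases r)
  case (real t)
  have "1 \<le> t" using assms real by simp
  then have "continuous_on UNIV (\<lambda>x. (\<Sum>i\<in>UNIV. \<bar>x $ i\<bar> powr t) powr (1 / t))"
    by (intro continuous_on_powr' continuous_intros) (auto intro: sum_nonneg)
  then show ?thesis using real by (simp add: lnorm_def)
next
  case PInf
  have "continuous_on UNIV (infnorm :: real ^ 'a \<Rightarrow> real)"
    by (intro continuous_intros)
  then show ?thesis using PInf by (simp add: lnorm_def)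
qed (use assms in auto)

definition lagrangian ::
  "ereal \<Rightarrow> real ^ 'd::finite \<Rightarrow> real ^ 'd \<Rightarrow> (real ^ 'd) \<times> real \<Rightarrow> real ^ 'd \<Rightarrow> real" where
  "lagrangian q \<beta> \<kappa> a u = (lnorm q (u - fst a))\<^sup>2 + \<kappa> \<bullet> score \<beta> (u, snd a)"

lemma continuous_on_lagrangian:
  assumes "1 \<le> q"
  shows "continuous_on UNIV (lagrangian q \<beta> \<kappa> a)"
  unfolding lagrangian_def score_def prod.case
  by (intro continuous_intros continuous_on_compose2[OF continuous_on_lnorm[OF assms]]) auto

lemma measurable_lagrangian: "(\<lambda>a. lagrangian q \<beta> \<kappa> a u) \<in> borel_measurable borel"
  unfolding lagrangian_def score_def prod.case borel_prod[symmetric] by measurable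

text \<open>Being affine in the multiplier makes the dual function, an infimum over displacements,
  concave.\<close>

lemma lagrangian_affine:
  "lagrangian q \<beta> ((1 - t) *\<^sub>R \<kappa> + t *\<^sub>R \<kappa>') a u =
    (1 - t) * lagrangian q \<beta> \<kappa> a u + t * lagrangian q \<beta> \<kappa>' a u"
  by (simp add: lagrangian_def algebra_simps inner_add_left)

text \<open>The displacements vary independently, so a bound on the mean over all joint choices is a
  bound on the mean of the separate infima, to which weak duality applies.\<close>

lemma ennreal_le_profile:
  fixes s :: "nat \<Rightarrow> (real ^ 'd::finite) \<times> real"
  assumes n: "0 < n" and bound: "\<And>u. r \<le> (\<Sum>i=1..n. lagrangian q \<beta> \<kappa> (s i) (u i)) / n"
  shows "ennreal r \<le> profile q (empirical n s) \<beta>"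
proof -
  define \<rho> where "\<rho> a = (INF x. lagrangian q \<beta> \<kappa> a x)" for a
  \<comment> \<open>One displacement varies while the others stay at 0. Boundedness is what makes
    the real-valued \<open>INF\<close> in \<open>\<rho>\<close> a true infimum.\<close>
  have bdd: "bdd_below (range (lagrangian q \<beta> \<kappa> (s i)))" if i: "i \<in> {1..n}" for i
  proof (rule bdd_belowI2)
    fix x
    define k where "k = (\<Sum>j\<in>{1..n}-{i}. lagrangian q \<beta> \<kappa> (s j) 0)"
    have "r * n \<le> (\<Sum>j=1..n. lagrangian q \<beta> \<kappa> (s j) (if j = i then x else 0))"
      using bound[of "\<lambda>j. if j = i then x else 0"] n by (simp add: field_simps)
    also have "\<dots> = lagrangian q \<beta> \<kappa> (s i) x + k"
      using i by (subst sum.remove[of _ i]) (auto simp: k_def intro!: sum.cong)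
    finally show "r * n - k \<le> lagrangian q \<beta> \<kappa> (s i) x" by simp
  qed
  have "r \<le> (\<Sum>i=1..n. \<rho> (s i)) / n"
  proof (rule field_le_epsilon)
    fix \<epsilon> :: real assume \<epsilon>: "0 < \<epsilon>"
    have "\<exists>x. lagrangian q \<beta> \<kappa> (s i) x < \<rho> (s i) + \<epsilon>" if "i \<in> {1..n}" for i
      using cINF_less_iff[OF _ bdd[OF that], of "\<rho> (s i) + \<epsilon>"] \<epsilon> by (auto simp: \<rho>_def)
    then obtain u where u: "\<And>i. i \<in> {1..n} \<Longrightarrow> lagrangian q \<beta> \<kappa> (s i) (u i) < \<rho> (s i) + \<epsilon>"
      by metis
    have "r \<le> (\<Sum>i=1..n. lagrangian q \<beta> \<kappa> (s i) (u i)) / n" by (rule bound)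
    also have "\<dots> \<le> (\<Sum>i=1..n. \<rho> (s i) + \<epsilon>) / n"
      using u by (intro divide_right_mono sum_mono) (auto intro: less_imp_le)
    also have "\<dots> = (\<Sum>i=1..n. \<rho> (s i)) / n + \<epsilon>"
      using n by (simp add: sum.distrib add_divide_distrib)
    finally show "r \<le> (\<Sum>i=1..n. \<rho> (s i)) / n + \<epsilon>" .
  qed
  then have "ennreal r \<le> ennreal ((\<Sum>i=1..n. \<rho> (s i)) / n)" by (rule ennreal_leI)
  also have "\<dots> \<le> profile q (empirical n s) \<beta>"
  proof (rule profile_empirical_ge[OF n])
    fix i u assume "i \<in> {1..n}"
    then show "\<rho> (s i) \<le> (lnorm q (u - fst (s i)))\<^sup>2 + \<kappa> \<bullet> score \<beta> (u, snd (s i))"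
      unfolding \<rho>_def lagrangian_def[symmetric] by (intro cINF_lower bdd) auto
  qed
  finally show ?thesis .
qed

context conjugate_exponents
begin

text \<open>For a small multiplier the quadratic remainder uses up at most half of the cost, and the
  other half absorbs the linear term in the displacement. The lower bound depends on the
  observation, the radius \<open>\<delta>\<close> does not.\<close>

lemma lagrangian_bounded_below:
  fixes \<beta> :: "real ^ 'd::finite"
  obtains \<delta> where "0 < \<delta>"
    "\<And>a. \<exists>m. \<forall>\<kappa> u. norm \<kappa> \<le> \<delta> \<longrightarrow> - m \<le> lagrangian q \<beta> \<kappa> a u"
proof -
  \<comment> \<open>Ensures \<open>lnorm p \<beta> * lnorm p \<kappa> \<le> 1 / 2\<close> on the
    ball; the added 1 keeps the denominator positive at \<open>\<beta> = 0\<close>.\<close>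
  define \<delta> where "\<delta> = 1 / (2 * CARD('d) * (lnorm p \<beta> + 1))"
  have b: "0 < lnorm p \<beta> + 1" using lnorm_nonneg[of p \<beta>] by linarith
  have "lnorm p \<beta> * (CARD('d) * \<delta>) = lnorm p \<beta> / (2 * (lnorm p \<beta> + 1))"
    by (simp add: \<delta>_def)
  also have "\<dots> \<le> 1 / 2" using b by (simp add: divide_le_eq)
  finally have \<delta>: "0 < \<delta>" "lnorm p \<beta> * (CARD('d) * \<delta>) \<le> 1 / 2"
    using b by (auto simp: \<delta>_def)
  have "\<exists>m. \<forall>\<kappa> u. norm \<kappa> \<le> \<delta> \<longrightarrow> - m \<le> lagrangian q \<beta> \<kappa> a u" for a :: "(real ^ 'd) \<times> real"
  proof (intro exI allI impI)
    fix \<kappa> u :: "real ^ 'd" assume \<kappa>: "norm \<kappa> \<le> \<delta>"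
    define V where "V = CARD('d) * ((\<bar>resid \<beta> a\<bar> + norm (fst a) * norm \<beta>) * \<delta>)"
    define D where "D = u - fst a"
    define t v where "t = lnorm q D" and "v = lnorm p (tilt \<beta> a \<kappa>)"
    have "lnorm p \<kappa> \<le> CARD('d) * \<delta>"
      using lnorm_le_norm[OF p_ge_1, of \<kappa>] mult_left_mono[OF \<kappa>, of "real CARD('d)"] by linarith
    then have "lnorm p \<beta> * lnorm p \<kappa> \<le> 1 / 2"
      using \<delta>(2) mult_left_mono[OF _ lnorm_nonneg[of p \<beta>]] order_trans by blast
    from mult_right_mono[OF this, of "t\<^sup>2"]
    have 1: "\<bar>(\<beta> \<bullet> D) * (\<kappa> \<bullet> D)\<bar> \<le> t\<^sup>2 / 2"
      using product_le_lnorm[of \<beta> D \<kappa>] by (simp add: t_def)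
    have 2: "\<bar>tilt \<beta> a \<kappa> \<bullet> D\<bar> \<le> v * t"
      unfolding t_def v_def by (rule lnorm_Holder)
    have "norm (tilt \<beta> a \<kappa>) \<le> \<bar>resid \<beta> a\<bar> * norm \<kappa> + \<bar>\<kappa> \<bullet> fst a\<bar> * norm \<beta>"
      unfolding tilt_def by (rule order_trans[OF norm_triangle_ineq4]) simp
    also have "\<dots> \<le> \<bar>resid \<beta> a\<bar> * norm \<kappa> + (norm \<kappa> * norm (fst a)) * norm \<beta>"
      by (intro add_left_mono mult_right_mono Cauchy_Schwarz_ineq2) auto
    also have "\<dots> = (\<bar>resid \<beta> a\<bar> + norm (fst a) * norm \<beta>) * norm \<kappa>"
      by (simp add: algebra_simps)
    also have "\<dots> \<le> (\<bar>resid \<beta> a\<bar> + norm (fst a) * norm \<beta>) * \<delta>"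
      using \<kappa> by (intro mult_left_mono) auto
    finally have "CARD('d) * norm (tilt \<beta> a \<kappa>) \<le> V"
      unfolding V_def by (rule mult_left_mono) simp
    then have "v \<le> V" unfolding v_def
      using lnorm_le_norm[OF p_ge_1, of "tilt \<beta> a \<kappa>"] by linarith
    then have 3: "v\<^sup>2 \<le> V\<^sup>2" by (simp add: v_def lnorm_nonneg power_mono)
    have 4: "v * t \<le> t\<^sup>2 / 2 + v\<^sup>2 / 2"
      using zero_le_power2[of "t - v"] by (simp add: power2_eq_square algebra_simps)
    have "\<bar>\<kappa> \<bullet> fst a\<bar> \<le> \<delta> * norm (fst a)"
      using Cauchy_Schwarz_ineq2[of \<kappa> "fst a"] mult_right_mono[OF \<kappa>, of "norm (fst a)"] by simp
    then have "\<bar>resid \<beta> a * (\<kappa> \<bullet> fst a)\<bar> \<le> \<bar>resid \<beta> a\<bar> * (\<delta> * norm (fst a))"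
      unfolding abs_mult by (rule mult_left_mono) simp
    moreover have "lagrangian q \<beta> \<kappa> a u =
        t\<^sup>2 + (resid \<beta> a * (\<kappa> \<bullet> fst a) + tilt \<beta> a \<kappa> \<bullet> D - (\<beta> \<bullet> D) * (\<kappa> \<bullet> D))"
      using inner_score_shift[of \<kappa> \<beta> a D] by (simp add: lagrangian_def D_def t_def)
    ultimately show "- (\<bar>resid \<beta> a\<bar> * (\<delta> * norm (fst a)) + V\<^sup>2 / 2) \<le> lagrangian q \<beta> \<kappa> a u"
      using 1 2 3 4 by linarith
  qed
  then show ?thesis using \<delta>(1) that by blast
qed

text \<open>A nonzero response excludes a separating hyperplane with \<open>\<alpha> = 0\<close>, so strong duality
  holds; the countable sets of multipliers and displacements suffice because the dual function is
  concave and bounded near 0. If all responses vanish the duality argument breaks down, and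
  \<open>profile_no_response\<close> replaces it by a closed formula.\<close>

lemma less_profile_iff:
  fixes s :: "nat \<Rightarrow> (real ^ 'd::finite) \<times> real"
  assumes n: "0 < n" and r: "0 \<le> r" and y: "\<exists>i\<in>{1..n}. snd (s i) \<noteq> 0"
    and D: "\<And>V. open V \<Longrightarrow> V \<noteq> {} \<Longrightarrow> \<exists>d\<in>D. (d :: real ^ 'd) \<in> V"
  shows "ennreal r < profile q (empirical n s) \<beta> \<longleftrightarrow>
    (\<exists>\<kappa>\<in>D. \<exists>\<rho>\<in>\<rat>. r < \<rho> \<and> (\<forall>u\<in>{1..n} \<rightarrow>\<^sub>E D. \<rho> \<le> (\<Sum>i=1..n. lagrangian q \<beta> \<kappa> (s i) (u i)) / n))"
    (is "_ \<longleftrightarrow> ?rhs")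
proof
  assume ?rhs
  then obtain \<kappa> \<rho> where \<rho>: "r < \<rho>"
    "\<And>u. u \<in> {1..n} \<rightarrow>\<^sub>E D \<Longrightarrow> \<rho> \<le> (\<Sum>i=1..n. lagrangian q \<beta> \<kappa> (s i) (u i)) / n" by blast
  have "\<rho> \<le> (\<Sum>i=1..n. lagrangian q \<beta> \<kappa> (s i) (u i)) / n" for u
  proof (rule field_le_epsilon)
    fix \<epsilon> :: real assume \<epsilon>: "0 < \<epsilon>"
    \<comment> \<open>Continuity in the displacement replaces each \<open>u i\<close> by a point of
      the dense set at the price of \<open>\<epsilon>\<close>.\<close>
    have "\<exists>d\<in>D. lagrangian q \<beta> \<kappa> (s i) d < lagrangian q \<beta> \<kappa> (s i) (u i) + \<epsilon>" for i
    proof -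
      have "open {x. lagrangian q \<beta> \<kappa> (s i) x < lagrangian q \<beta> \<kappa> (s i) (u i) + \<epsilon>}"
        by (intro open_Collect_less continuous_on_lagrangian q_ge_1 continuous_intros)
      moreover have "u i \<in> {x. lagrangian q \<beta> \<kappa> (s i) x < lagrangian q \<beta> \<kappa> (s i) (u i) + \<epsilon>}"
        using \<epsilon> by simp
      ultimately show ?thesis using D by blast
    qed
    then obtain d where d: "\<And>i. d i \<in> D" "\<And>i. lagrangian q \<beta> \<kappa> (s i) (d i) < lagrangian q \<beta> \<kappa> (s i) (u i) + \<epsilon>"
      by metis
    have "\<rho> \<le> (\<Sum>i=1..n. lagrangian q \<beta> \<kappa> (s i) (restrict d {1..n} i)) / n"
      using d(1) by (intro \<rho>(2)) auto
    also have "\<dots> \<le> (\<Sum>i=1..n. lagrangian q \<beta> \<kappa> (s i) (u i) + \<epsilon>) / n"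
      using d(2) by (intro divide_right_mono sum_mono) (auto intro: less_imp_le)
    also have "\<dots> = (\<Sum>i=1..n. lagrangian q \<beta> \<kappa> (s i) (u i)) / n + \<epsilon>"
      using n by (simp add: sum.distrib add_divide_distrib)
    finally show "\<rho> \<le> (\<Sum>i=1..n. lagrangian q \<beta> \<kappa> (s i) (u i)) / n + \<epsilon>" .
  qed
  then have "ennreal \<rho> \<le> profile q (empirical n s) \<beta>"
    by (rule ennreal_le_profile[OF n])
  moreover have "ennreal r < ennreal \<rho>" using \<rho>(1) r by (simp add: ennreal_less_iff)
  ultimately show "ennreal r < profile q (empirical n s) \<beta>" by simp
next
  assume less: "ennreal r < profile q (empirical n s) \<beta>"
  obtain R where R: "profile q (empirical n s) \<beta> = ennreal R" "0 \<le> R"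
    using profile_empirical_finite[OF n, of q s \<beta>] by (cases "profile q (empirical n s) \<beta>") auto
  define r2 where "r2 = (r + R) / 2"
  have r2: "r < r2" "ennreal r2 < profile q (empirical n s) \<beta>"
    using less r by (auto simp: R r2_def ennreal_less_iff)
  obtain \<alpha> \<kappa>0 where ak: "0 \<le> \<alpha>" "\<alpha> \<noteq> 0 \<or> \<kappa>0 \<noteq> 0" and
    sep: "\<And>u. \<alpha> * r2 \<le>
      (\<Sum>i=1..n. \<alpha> * (lnorm q (u i - fst (s i)))\<^sup>2 + \<kappa>0 \<bullet> score \<beta> (u i, snd (s i))) / n"
    by (rule profile_separation[OF n r2(2)]) (rule that)
  have "\<alpha> \<noteq> 0"
  proof
    assume \<alpha>: "\<alpha> = 0"
    obtain j where j: "j \<in> {1..n}" "snd (s j) \<noteq> 0" using y by blast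
    define b where "b = \<beta> \<bullet> \<kappa>0"
    \<comment> \<open>Observation \<open>j\<close> is moved to \<open>t *\<^sub>R \<kappa>0\<close>
      and all other covariates go to 0, where the score vanishes. The sign of \<open>t\<close> is
      opposite to that of the response and the denominator keeps \<open>t * b\<close> smaller in
      size than the response, so \<open>(snd (s j) - t * b) * t\<close> is negative.\<close>
    define t where "t = - snd (s j) / (2 * (1 + \<bar>b\<bar>))"
    define u where "u = (\<lambda>i. if i = j then t *\<^sub>R \<kappa>0 else 0)"
    have eq: "\<kappa>0 \<bullet> score \<beta> (u i, snd (s i)) = (if i = j then \<kappa>0 \<bullet> score \<beta> (t *\<^sub>R \<kappa>0, snd (s j)) else 0)" for i
      by (simp add: u_def score_def)
    have "0 \<le> (\<Sum>i=1..n. \<kappa>0 \<bullet> score \<beta> (u i, snd (s i)))"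
      using sep[of u] n by (simp add: \<alpha> zero_le_divide_iff)
    also have "\<dots> = \<kappa>0 \<bullet> score \<beta> (t *\<^sub>R \<kappa>0, snd (s j))"
      unfolding eq using j(1) by simp
    also have "\<dots> = ((snd (s j) - t * b) * t) * (\<kappa>0 \<bullet> \<kappa>0)"
      by (simp add: score_def b_def)
    finally have "0 \<le> ((snd (s j) - t * b) * t) * (\<kappa>0 \<bullet> \<kappa>0)" .
    moreover have "0 < \<kappa>0 \<bullet> \<kappa>0" using ak(2) \<alpha> by simp
    ultimately have "0 \<le> (snd (s j) - t * b) * t"
      by (metis mult_le_cancel_right_pos mult_zero_left)
    moreover have "(snd (s j) - t * b) * t = - (snd (s j))\<^sup>2 * (2 * (1 + \<bar>b\<bar>) + b) / (2 * (1 + \<bar>b\<bar>))\<^sup>2"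
    proof -
      define k where "k = 2 * (1 + \<bar>b\<bar>)"
      have "0 < k" by (simp add: k_def add_pos_nonneg)
      then show ?thesis unfolding t_def k_def[symmetric]
        by (simp add: power2_eq_square field_simps)
    qed
    moreover have "0 < 2 * (1 + \<bar>b\<bar>) + b" by simp
    moreover have "0 < (2 * (1 + \<bar>b\<bar>))\<^sup>2" by (simp add: add_pos_nonneg)
    moreover have "0 < (snd (s j))\<^sup>2" using j(2) by simp
    ultimately show False by (smt (verit) divide_neg_pos minus_mult_left mult_pos_pos)
  qed
  then have \<alpha>: "0 < \<alpha>" using ak by simp
  define \<kappa>1 where "\<kappa>1 = \<kappa>0 /\<^sub>R \<alpha>"
  have \<kappa>1: "r2 \<le> (\<Sum>i=1..n. lagrangian q \<beta> \<kappa>1 (s i) (u i)) / n" for u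
  proof -
    have "\<alpha> * (\<Sum>i=1..n. lagrangian q \<beta> \<kappa>1 (s i) (u i)) =
      (\<Sum>i=1..n. \<alpha> * (lnorm q (u i - fst (s i)))\<^sup>2 + \<kappa>0 \<bullet> score \<beta> (u i, snd (s i)))"
    proof -
      have "\<alpha> * lagrangian q \<beta> \<kappa>1 a x =
          \<alpha> * (lnorm q (x - fst a))\<^sup>2 + \<kappa>0 \<bullet> score \<beta> (x, snd a)" for a x
        using \<alpha> by (simp add: lagrangian_def \<kappa>1_def distrib_left)
      then show ?thesis by (simp only: sum_distrib_left)
    qed
    then have "\<alpha> * r2 \<le> \<alpha> * ((\<Sum>i=1..n. lagrangian q \<beta> \<kappa>1 (s i) (u i)) / n)"
      using sep[of u] by simp
    then show ?thesis using \<alpha> by (simp only: mult_le_cancel_left_pos)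
  qed
  obtain \<delta> where \<delta>: "0 < \<delta>" "\<And>a. \<exists>m. \<forall>\<kappa> u. norm \<kappa> \<le> \<delta> \<longrightarrow> - m \<le> lagrangian q \<beta> \<kappa> a u"
    by (rule lagrangian_bounded_below[of \<beta>]) (rule that)
  then obtain m where m: "\<And>a \<kappa> u. norm \<kappa> \<le> \<delta> \<Longrightarrow> - m a \<le> lagrangian q \<beta> \<kappa> a u"
    by metis
  define k where "k = \<bar>\<Sum>i=1..n. m (s i)\<bar> / n"
  have k: "0 \<le> k" by (simp add: k_def)
  have mean: "- k \<le> (\<Sum>i=1..n. lagrangian q \<beta> \<kappa> (s i) (u i)) / n" if "norm \<kappa> \<le> \<delta>" for \<kappa> u
  proof -
    have "- k \<le> (\<Sum>i=1..n. - m (s i)) / n"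
      unfolding k_def minus_divide_left by (intro divide_right_mono) (auto simp: sum_negf)
    also have "\<dots> \<le> (\<Sum>i=1..n. lagrangian q \<beta> \<kappa> (s i) (u i)) / n"
      using m[OF that] by (intro divide_right_mono sum_mono) auto
    finally show ?thesis .
  qed
  \<comment> \<open>The weight given to an arbitrary multiplier of norm at most
    \<open>\<delta>\<close>, whose dual value is at least \<open>- k\<close>. Mixing it with
    \<open>\<kappa>1\<close> loses at most \<open>t * (r2 + k)\<close>, which is at most half the
    gap \<open>r2 - r\<close>.\<close>
  define t where "t = (r2 - r) / (2 * (r2 + k + 1))"
  have t: "0 < t" "t < 1" "r < (1 - t) * r2 + t * (- k)"
  proof -
    have pos: "0 < r2 + k + 1" using r2 r k by linarith
    show "0 < t" "t < 1" using pos r2 r k by (auto simp: t_def field_simps)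
    have "t * (r2 + k) \<le> t * (r2 + k + 1)" using \<open>0 < t\<close> by simp
    also have "\<dots> = (r2 - r) / 2" using pos by (simp add: t_def divide_simps del: distrib_left_numeral)
    finally show "r < (1 - t) * r2 + t * (- k)" using r2 by (simp add: algebra_simps)
  qed
  then obtain \<rho> where \<rho>: "\<rho> \<in> \<rat>" "r < \<rho>" "\<rho> < (1 - t) * r2 + t * (- k)"
    using Rats_dense_in_real by blast
  \<comment> \<open>All points of this ball arise from such a mixture, so their dual values exceed
    \<open>r\<close>; the dense set meets the ball.\<close>
  have "ball ((1 - t) *\<^sub>R \<kappa>1) (t * \<delta>) \<noteq> {}" using mult_pos_pos[OF t(1) \<delta>(1)] by simp
  then obtain \<kappa> where \<kappa>: "\<kappa> \<in> D" "\<kappa> \<in> ball ((1 - t) *\<^sub>R \<kappa>1) (t * \<delta>)"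
    using D[OF open_ball] by blast
  define \<kappa>2 where "\<kappa>2 = (\<kappa> - (1 - t) *\<^sub>R \<kappa>1) /\<^sub>R t"
  have "norm (\<kappa> - (1 - t) *\<^sub>R \<kappa>1) < t * \<delta>"
    using \<kappa>(2) by (simp add: dist_norm norm_minus_commute)
  then have \<kappa>2: "norm \<kappa>2 \<le> \<delta>" "\<kappa> = (1 - t) *\<^sub>R \<kappa>1 + t *\<^sub>R \<kappa>2"
    using t by (simp_all add: \<kappa>2_def divide_inverse_commute[symmetric] divide_le_eq mult.commute)
  have "\<rho> \<le> (\<Sum>i=1..n. lagrangian q \<beta> \<kappa> (s i) (u i)) / n" for u
  proof -
    have "(\<Sum>i=1..n. lagrangian q \<beta> \<kappa> (s i) (u i)) / n =
      (1 - t) * ((\<Sum>i=1..n. lagrangian q \<beta> \<kappa>1 (s i) (u i)) / n) +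
      t * ((\<Sum>i=1..n. lagrangian q \<beta> \<kappa>2 (s i) (u i)) / n)"
      unfolding \<kappa>2(2) lagrangian_affine sum.distrib sum_distrib_left[symmetric]
      by (simp add: add_divide_distrib)
    moreover have "(1 - t) * r2 \<le> (1 - t) * ((\<Sum>i=1..n. lagrangian q \<beta> \<kappa>1 (s i) (u i)) / n)"
      using t \<kappa>1 by (intro mult_left_mono) auto
    moreover have "t * (- k) \<le> t * ((\<Sum>i=1..n. lagrangian q \<beta> \<kappa>2 (s i) (u i)) / n)"
      using t mean[OF \<kappa>2(1)] by (intro mult_left_mono) auto
    ultimately show ?thesis using \<rho>(3) by linarith
  qed
  then show ?rhs using \<kappa>(1) \<rho> by blast
qed

text \<open>The score is now \<open>- (\<beta> \<bullet> x) x\<close>. Tested against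
  \<open>\<beta>\<close>, its vanishing mean forces \<open>\<beta> \<bullet> x = 0\<close> almost
  surely, so all mass must reach this hyperplane, which lies at q-distance
  \<open>|\<beta> \<bullet> x| / lnorm p \<beta>\<close>. The dual bound takes the multipliers
  \<open>(- k) *\<^sub>R \<beta>\<close> and lets \<open>k\<close> tend to infinity. At
  \<open>\<beta> = 0\<close> the quotients are 0 by convention, which is the right value.\<close>

lemma profile_no_response:
  fixes s :: "nat \<Rightarrow> (real ^ 'd::finite) \<times> real"
  assumes n: "0 < n" and y: "\<And>i. i \<in> {1..n} \<Longrightarrow> snd (s i) = 0"
  shows "profile q (empirical n s) \<beta> = ennreal ((\<Sum>i=1..n. (\<beta> \<bullet> fst (s i))\<^sup>2 / (lnorm p \<beta>)\<^sup>2) / n)"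
proof (rule antisym)
  define b where "b = lnorm p \<beta>"
  obtain g where g: "\<beta> \<bullet> g = b\<^sup>2" "lnorm q g = b"
    unfolding b_def by (rule ex_dual_vector)
  have b0: "0 \<le> b" by (simp add: b_def lnorm_nonneg)
  have \<beta>0: "\<beta> \<bullet> x = 0" if "b = 0" for x
    using lnorm_Holder[of \<beta> x] that by (simp add: b_def)
  define u where "u i = fst (s i) - (\<beta> \<bullet> fst (s i) / b\<^sup>2) *\<^sub>R g" for i
  define F where "F = (\<lambda>i. (i, u i)) ` {1..n}"
  have inj: "inj_on (\<lambda>i. (i, u i)) {1..n}" by (auto simp: inj_on_def)
  have u0: "\<beta> \<bullet> u i = 0" for i
    by (cases "b = 0") (auto simp: u_def inner_diff_right g \<beta>0)
  have "profile q (empirical n s) \<beta> \<le> ennreal (\<Sum>z\<in>F. 1 / n * (lnorm q (snd z - fst (s (fst z))))\<^sup>2)"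
  proof (rule profile_empirical_le[OF n])
    show "finite F" "F \<subseteq> {1..n} \<times> UNIV" by (auto simp: F_def)
    show "(\<Sum>z\<in>{z\<in>F. fst z = i}. 1 / real n) = 1 / real n" if "i \<in> {1..n}" for i
    proof -
      have "{z\<in>F. fst z = i} = {(i, u i)}" using that by (auto simp: F_def)
      then show ?thesis by simp
    qed
    show "(\<Sum>z\<in>F. (1 / real n) *\<^sub>R score \<beta> (snd z, snd (s (fst z)))) = 0"
      using y by (intro sum.neutral) (auto simp: F_def score_def u0)
  qed auto
  also have "(\<Sum>z\<in>F. 1 / n * (lnorm q (snd z - fst (s (fst z))))\<^sup>2) =
      (\<Sum>i=1..n. (\<beta> \<bullet> fst (s i))\<^sup>2 / (lnorm p \<beta>)\<^sup>2) / n"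
    unfolding sum_divide_distrib F_def sum.reindex[OF inj]
  proof (intro sum.cong refl)
    fix i
    have "u i - fst (s i) = (- (\<beta> \<bullet> fst (s i) / b\<^sup>2)) *\<^sub>R g" by (simp add: u_def)
    then have "lnorm q (u i - fst (s i)) = \<bar>\<beta> \<bullet> fst (s i) / b\<^sup>2\<bar> * b"
      by (simp only: lnorm_scaleR[OF q_ge_1] g abs_minus)
    then have "(lnorm q (u i - fst (s i)))\<^sup>2 = (\<beta> \<bullet> fst (s i))\<^sup>2 / b\<^sup>2"
      by (simp add: power_mult_distrib power_divide power2_eq_square)
    then show "((\<lambda>z. 1 / real n * (lnorm q (snd z - fst (s (fst z))))\<^sup>2) \<circ> (\<lambda>i. (i, u i))) i =
         (\<beta> \<bullet> fst (s i))\<^sup>2 / (lnorm p \<beta>)\<^sup>2 / n"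
      by (simp add: b_def)
  qed
  finally show "profile q (empirical n s) \<beta> \<le> ennreal ((\<Sum>i=1..n. (\<beta> \<bullet> fst (s i))\<^sup>2 / (lnorm p \<beta>)\<^sup>2) / n)" .
  show "ennreal ((\<Sum>i=1..n. (\<beta> \<bullet> fst (s i))\<^sup>2 / (lnorm p \<beta>)\<^sup>2) / n) \<le> profile q (empirical n s) \<beta>"
  proof (cases "b = 0")
    case False
    then have b: "0 < b" using b0 by simp
    define A where "A = (\<Sum>i=1..n. (\<beta> \<bullet> fst (s i))\<^sup>2) / n"
    have "ennreal (A * (real k / (1 + real k * b\<^sup>2))) \<le> profile q (empirical n s) \<beta>" for k :: nat
    proof -
      define t where "t = real k"
      have pos: "0 < 1 + t * b\<^sup>2" by (simp add: t_def add_pos_nonneg)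
      have "ennreal ((\<Sum>i=1..n. (\<lambda>a. (\<beta> \<bullet> fst a)\<^sup>2 * (t / (1 + t * b\<^sup>2))) (s i)) / n) \<le> profile q (empirical n s) \<beta>"
      proof (rule profile_empirical_ge[OF n])
        fix i v assume i: "i \<in> {1..n}"
        define x y d where "x = \<beta> \<bullet> fst (s i)" and "y = \<beta> \<bullet> v" and "d = lnorm q (v - fst (s i))"
        have "\<bar>y - x\<bar> \<le> b * d"
          using lnorm_Holder[of \<beta> "v - fst (s i)"] by (simp add: x_def y_def d_def b_def inner_diff_right)
        then have "(y - x)\<^sup>2 \<le> b\<^sup>2 * d\<^sup>2"
          by (metis abs_le_square_iff abs_of_nonneg abs_ge_zero order_trans power_mult_distrib)
        moreover have "0 \<le> (y + t * b\<^sup>2 * y - x)\<^sup>2" by simp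
        moreover have "x\<^sup>2 * t * b\<^sup>2 \<le> (1 + t * b\<^sup>2) * ((y - x)\<^sup>2 + b\<^sup>2 * (t * y\<^sup>2))"
        proof -
          \<comment> \<open>The minimum of
            \<open>(y - x)\<^sup>2 + t * b\<^sup>2 * y\<^sup>2\<close> over \<open>y\<close> is
            taken at \<open>y = x / (1 + t * b\<^sup>2)\<close>, where the square on the right
            vanishes.\<close>
          have "(1 + t * b\<^sup>2) * ((y - x)\<^sup>2 + b\<^sup>2 * (t * y\<^sup>2)) = x\<^sup>2 * t * b\<^sup>2 + (y + t * b\<^sup>2 * y - x)\<^sup>2"
            by (simp add: power2_eq_square algebra_simps)
          then show ?thesis by simp
        qed
        ultimately have "x\<^sup>2 * t * b\<^sup>2 \<le> (1 + t * b\<^sup>2) * (b\<^sup>2 * d\<^sup>2 + b\<^sup>2 * (t * y\<^sup>2))"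
          using mult_left_mono[of "(y - x)\<^sup>2 + b\<^sup>2 * (t * y\<^sup>2)" "b\<^sup>2 * d\<^sup>2 + b\<^sup>2 * (t * y\<^sup>2)" "1 + t * b\<^sup>2"] pos by linarith
        then have "b\<^sup>2 * (x\<^sup>2 * t) \<le> b\<^sup>2 * ((1 + t * b\<^sup>2) * (d\<^sup>2 + t * y\<^sup>2))"
          by (simp add: algebra_simps)
        then have "x\<^sup>2 * t \<le> (1 + t * b\<^sup>2) * (d\<^sup>2 + t * y\<^sup>2)"
          using b by simp
        then have "x\<^sup>2 * (t / (1 + t * b\<^sup>2)) \<le> d\<^sup>2 + t * y\<^sup>2"
          using pos by (simp add: divide_le_eq mult.commute)
        then show "(\<lambda>a. (\<beta> \<bullet> fst a)\<^sup>2 * (t / (1 + t * b\<^sup>2))) (s i) \<le>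
            (lnorm q (v - fst (s i)))\<^sup>2 + ((- t) *\<^sub>R \<beta>) \<bullet> score \<beta> (v, snd (s i))"
          using y[OF i] by (simp add: score_def x_def y_def d_def power2_eq_square mult_ac)
      qed
      moreover have "(\<Sum>i=1..n. (\<lambda>a. (\<beta> \<bullet> fst a)\<^sup>2 * (t / (1 + t * b\<^sup>2))) (s i)) / n = A * (real k / (1 + real k * b\<^sup>2))"
        unfolding A_def t_def by (simp only: sum_distrib_right[symmetric] times_divide_eq_left)
      ultimately show ?thesis by simp
    qed
    moreover have "(\<lambda>k. ennreal (A * (real k / (1 + real k * b\<^sup>2)))) \<longlonglongrightarrow> ennreal (A * (1 / b\<^sup>2))"
    proof (intro tendsto_ennrealI tendsto_mult tendsto_const)
      have "(\<lambda>k. 1 / (inverse (real (Suc k)) + b\<^sup>2)) \<longlonglongrightarrow> 1 / (0 + b\<^sup>2)"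
        using b by (intro tendsto_intros LIMSEQ_inverse_real_of_nat) auto
      moreover have "1 / (inverse (real (Suc k)) + b\<^sup>2) = real (Suc k) / (1 + real (Suc k) * b\<^sup>2)" for k
        by (simp add: field_simps add_pos_nonneg)
      ultimately have "(\<lambda>k. real (Suc k) / (1 + real (Suc k) * b\<^sup>2)) \<longlonglongrightarrow> 1 / b\<^sup>2" by simp
      then show "(\<lambda>k. real k / (1 + real k * b\<^sup>2)) \<longlonglongrightarrow> 1 / b\<^sup>2"
        by (rule LIMSEQ_imp_Suc)
    qed
    ultimately have "ennreal (A * (1 / b\<^sup>2)) \<le> profile q (empirical n s) \<beta>"
      by (intro LIMSEQ_le_const2) auto
    moreover have "A * (1 / b\<^sup>2) = (\<Sum>i=1..n. (\<beta> \<bullet> fst (s i))\<^sup>2 / (lnorm p \<beta>)\<^sup>2) / n"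
      by (simp add: A_def b_def sum_divide_distrib[symmetric])
    ultimately show ?thesis by simp
  qed (simp add: b_def)
qed

text \<open>On the event that some response is nonzero, duality writes the strict superlevel sets
  with countable quantifiers over measurable conditions; on its complement the profile is an
  explicit function of the sample.\<close>

lemma measurable_profile_empirical:
  fixes s :: "'w \<Rightarrow> nat \<Rightarrow> (real ^ 'd::finite) \<times> real"
  assumes n: "0 < n" and s: "\<And>i. i \<in> {1..n} \<Longrightarrow> (\<lambda>w. s w i) \<in> borel_measurable M"
  shows "(\<lambda>w. profile q (empirical n (s w)) \<beta>) \<in> borel_measurable M"
proof (rule borel_measurableI_greater)
  fix y :: ennreal
  obtain D :: "(real ^ 'd) set" where D: "countable D" "\<And>V. open V \<Longrightarrow> V \<noteq> {} \<Longrightarrow> \<exists>d\<in>D. d \<in> V"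
    by (rule countable_dense_setE) auto
  show "{w \<in> space M. y < profile q (empirical n (s w)) \<beta>} \<in> sets M"
  proof (cases y)
    case (real r)
    define E where "E w \<longleftrightarrow> (\<exists>i\<in>{1..n}. snd (s w i) \<noteq> 0)" for w
    define Z where "Z w = (\<Sum>i=1..n. (\<beta> \<bullet> fst (s w i))\<^sup>2 / (lnorm p \<beta>)\<^sup>2) / n" for w
    have snd_m: "(\<lambda>w. snd (s w i)) \<in> borel_measurable M" and fst_m: "(\<lambda>w. fst (s w i)) \<in> borel_measurable M"
      if "i \<in> {1..n}" for i
      using measurable_compose[OF s[OF that] measurable_snd_borel]
        measurable_compose[OF s[OF that] measurable_fst_borel] by auto
    have E_m: "{w \<in> space M. E w} \<in> sets M"
      unfolding E_def using snd_m
      by (intro sets.sets_Collect_finite_Ex borel_measurable_neq borel_measurable_const) auto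
    have Z_m: "Z \<in> borel_measurable M"
      unfolding Z_def using fst_m
      by (intro borel_measurable_divide borel_measurable_sum borel_measurable_power
          borel_measurable_inner borel_measurable_const) auto
    have L_m: "(\<lambda>w. (\<Sum>i=1..n. lagrangian q \<beta> \<kappa> (s w i) (u i)) / n) \<in> borel_measurable M" for \<kappa> u
      using measurable_compose[OF s measurable_lagrangian]
      by (intro borel_measurable_divide borel_measurable_sum borel_measurable_const) auto
    have U: "countable ({1..n} \<rightarrow>\<^sub>E D)" using D(1) by (intro countable_PiE) auto
    have eq: "y < profile q (empirical n (s w)) \<beta> \<longleftrightarrow>
      (E w \<and> (\<exists>\<kappa>\<in>D. \<exists>\<rho>\<in>\<rat>. r < \<rho> \<and> (\<forall>u\<in>{1..n} \<rightarrow>\<^sub>E D. \<rho> \<le> (\<Sum>i=1..n. lagrangian q \<beta> \<kappa> (s w i) (u i)) / n)))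
      \<or> (\<not> E w \<and> r < Z w)" for w
    proof (cases "E w")
      case True
      then show ?thesis
        using less_profile_iff[OF n, of r "s w" D \<beta>] D(2) real by (simp add: E_def)
    next
      case False
      then have "profile q (empirical n (s w)) \<beta> = ennreal (Z w)"
        unfolding Z_def by (intro profile_no_response[OF n]) (auto simp: E_def)
      then show ?thesis using real False by (simp add: ennreal_less_iff)
    qed
    have sets: "{w \<in> space M. \<rho> \<le> (\<Sum>i=1..n. lagrangian q \<beta> \<kappa> (s w i) (u i)) / n} \<in> sets M"
      "{w \<in> space M. E w} \<in> sets M" "{w \<in> space M. r < Z w} \<in> sets M" for \<rho> \<kappa> u
      using borel_measurable_le[OF borel_measurable_const L_m] E_m
        borel_measurable_less[OF borel_measurable_const Z_m] by simp_all
    show ?thesis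
      unfolding eq
      by (intro sets.sets_Collect_disj sets.sets_Collect_conj sets.sets_Collect_neg
          sets.sets_Collect_countable_Ex' sets.sets_Collect_countable_All' sets.sets_Collect_const
          sets D(1) U countable_rat)
  next
    case top
    then show ?thesis by simp
  qed
qed

end

section \<open>The Cramer-Wold device\<close>

text \<open>Frequencies lie in \<open>pi / L\<close> times the integer lattice, so the functions are
  periodic with period \<open>2 * L\<close> in each coordinate; the phase \<open>b\<close> brings in
  the sines. Each generator depends on \<open>x\<close> through the single projection
  \<open>t \<bullet> x\<close>, which is where convergence of projections enters.\<close>

inductive trig_poly :: "real \<Rightarrow> (real ^ 'd::finite \<Rightarrow> real) \<Rightarrow> bool" for L where
  cos: "(\<And>j. t $ j * L / pi \<in> \<int>) \<Longrightarrow> trig_poly L (\<lambda>x. c * cos (t \<bullet> x + b))"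
| add: "trig_poly L f \<Longrightarrow> trig_poly L g \<Longrightarrow> trig_poly L (\<lambda>x. f x + g x)"

lemma trig_poly_const: "trig_poly L (\<lambda>x. c)"
  using trig_poly.cos[of 0 L c 0] by simp

text \<open>The product-to-sum formula; sums and differences of lattice frequencies are lattice
  frequencies.\<close>

lemma trig_poly_mult_cos:
  assumes t: "\<And>j. t $ j * L / pi \<in> \<int>" and g: "trig_poly L g"
  shows "trig_poly L (\<lambda>x. c * cos (t \<bullet> x + b) * g x)"
  using g
proof induction
  case (cos u d a)
  have "trig_poly L (\<lambda>x. (c * d / 2) * cos ((t - u) \<bullet> x + (b - a)))"
    by (rule trig_poly.cos) (simp add: t cos left_diff_distrib diff_divide_distrib)
  moreover have "trig_poly L (\<lambda>x. (c * d / 2) * cos ((t + u) \<bullet> x + (b + a)))"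
    by (rule trig_poly.cos) (simp add: t cos distrib_right add_divide_distrib)
  ultimately have "trig_poly L (\<lambda>x. (c * d / 2) * cos ((t - u) \<bullet> x + (b - a)) +
      (c * d / 2) * cos ((t + u) \<bullet> x + (b + a)))"
    by (rule trig_poly.add)
  moreover have "(c * d / 2) * cos ((t - u) \<bullet> x + (b - a)) + (c * d / 2) * cos ((t + u) \<bullet> x + (b + a)) =
      c * cos (t \<bullet> x + b) * (d * cos (u \<bullet> x + a))" for x
  proof -
    have eqs: "(t - u) \<bullet> x + (b - a) = (t \<bullet> x + b) - (u \<bullet> x + a)"
      "(t + u) \<bullet> x + (b + a) = (t \<bullet> x + b) + (u \<bullet> x + a)"
      by (auto simp: inner_diff_left inner_add_left)
    have "(c * d / 2) * cos (A - C) + (c * d / 2) * cos (A + C) = c * cos A * (d * cos C)" for A C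
      by (simp add: cos_add cos_diff algebra_simps)
    then show ?thesis unfolding eqs .
  qed
  ultimately show ?case by simp
next
  case (add f g)
  then show ?case using trig_poly.add by (simp add: distrib_left)
qed

lemma trig_poly_mult:
  assumes "trig_poly L f" "trig_poly L g"
  shows "trig_poly L (\<lambda>x. f x * g x)"
  using assms(1)
proof induction
  case (cos t c b)
  then show ?case by (rule trig_poly_mult_cos) (rule assms(2))
next
  case (add f h)
  then show ?case using trig_poly.add by (simp add: distrib_right)
qed

lemma trig_poly_continuous: "trig_poly L f \<Longrightarrow> continuous_on UNIV f"
  by (induction rule: trig_poly.induct) (auto intro!: continuous_intros)

lemma trig_poly_bounded: "trig_poly L f \<Longrightarrow> \<exists>B. \<forall>x. \<bar>f x\<bar> \<le> B"
proof (induction rule: trig_poly.induct)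
  case (cos t c b)
  have "\<bar>c * cos (t \<bullet> x + b)\<bar> \<le> \<bar>c\<bar>" for x
    using mult_left_mono[OF abs_cos_le_one, of "\<bar>c\<bar>"] by (simp add: abs_mult)
  then show ?case by blast
next
  case (add f g)
  then obtain A B where "\<And>x. \<bar>f x\<bar> \<le> A" "\<And>x. \<bar>g x\<bar> \<le> B" by metis
  then have "\<bar>f x + g x\<bar> \<le> A + B" for x by (rule order_trans[OF abs_triangle_ineq add_mono])
  then show ?case by blast
qed

text \<open>Every coordinate is reduced modulo \<open>2 * L\<close> into the cube, and one
  \<open>y\<close> serves all trigonometric polynomials simultaneously.\<close>

lemma trig_poly_periodic:
  assumes L: "0 < L"
  obtains y :: "real ^ 'd::finite" where "\<And>j. \<bar>y $ j\<bar> \<le> L" "\<And>f. trig_poly L f \<Longrightarrow> f y = f x"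
proof -
  define k where "k j = \<lfloor>(x $ j + L) / (2 * L)\<rfloor>" for j
  define y :: "real ^ 'd" where "y = (\<chi> j. x $ j - 2 * L * real_of_int (k j))"
  have "\<bar>y $ j\<bar> \<le> L" for j
  proof -
    have "real_of_int (k j) \<le> (x $ j + L) / (2 * L)" "(x $ j + L) / (2 * L) < real_of_int (k j) + 1"
      unfolding k_def by linarith+
    then show ?thesis using L by (simp add: y_def field_simps abs_le_iff)
  qed
  moreover have "f y = f x" if "trig_poly L f" for f
    using that
  proof induction
    case (cos t c b)
    have "(\<Sum>j\<in>UNIV. (t $ j * L / pi) * real_of_int (k j)) \<in> \<int>"
      using cos by (intro Ints_sum Ints_mult) auto
    then obtain m where m: "(\<Sum>j\<in>UNIV. (t $ j * L / pi) * real_of_int (k j)) = real_of_int m"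
      by (rule Ints_cases)
    have "t \<bullet> y = t \<bullet> x - 2 * pi * (\<Sum>j\<in>UNIV. (t $ j * L / pi) * real_of_int (k j))"
      by (simp add: inner_vec_def y_def right_diff_distrib sum_subtractf sum_distrib_left mult_ac)
    then have "t \<bullet> x + b = (t \<bullet> y + b) + 2 * pi * real_of_int m" unfolding m by simp
    moreover have "cos (a + 2 * pi * real_of_int m) = cos a" for a
      by (simp add: cos_add sin_int_2pin cos_int_2pin)
    ultimately have "cos (t \<bullet> x + b) = cos (t \<bullet> y + b)" by (simp only:)
    then show ?case by simp
  next
    case (add f g)
    then show ?case by simp
  qed
  ultimately show ?thesis by (rule that)
qed

text \<open>Stone-Weierstrass is applied on the torus, so that the approximating polynomial stays under
  control outside the cube.\<close>

lemma trig_poly_approx: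
  fixes f :: "real ^ 'd::finite \<Rightarrow> real"
  assumes L: "0 < L" and f: "continuous_on UNIV f" and \<epsilon>: "0 < \<epsilon>"
    and boundary: "\<And>x j. \<bar>x $ j\<bar> = L \<Longrightarrow> f x = 0"
  obtains g where "trig_poly L g" "\<And>x. (\<And>j. \<bar>x $ j\<bar> \<le> L) \<Longrightarrow> \<bar>f x - g x\<bar> < \<epsilon>"
proof -
  define S :: "(real ^ 'd) set" where "S = cbox (\<chi> j. - L) (\<chi> j. L)"
  have S: "x \<in> S \<longleftrightarrow> (\<forall>j. \<bar>x $ j\<bar> \<le> L)" for x
    by (auto simp: S_def mem_box_cart abs_le_iff minus_le_iff)
  have "compact S" unfolding S_def by (rule compact_cbox)
  \<comment> \<open>Wraps the cube onto a torus by gluing opposite faces; \<open>f\<close> factors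
    through \<open>\<phi>\<close> because it vanishes on the faces.\<close>
  define \<phi> :: "real ^ 'd \<Rightarrow> complex ^ 'd" where "\<phi> x = (\<chi> j. cis (pi / L * x $ j))" for x
  have \<phi>: "continuous_on A \<phi>" for A
    unfolding \<phi>_def by (intro continuous_intros)
  define T where "T = \<phi> ` S"
  have "compact T" unfolding T_def by (intro compact_continuous_image \<phi> \<open>compact S\<close>)
  have eq: "f x = f y" if "x \<in> S" "y \<in> S" "\<phi> x = \<phi> y" for x y
  proof (cases "x = y")
    case False
    then obtain j where j: "x $ j \<noteq> y $ j" by (auto simp: vec_eq_iff)
    have "cis (pi / L * x $ j) = cis (pi / L * y $ j)"
      using that(3) by (simp add: \<phi>_def vec_eq_iff)
    then have "cos (pi / L * x $ j) = cos (pi / L * y $ j)" "sin (pi / L * x $ j) = sin (pi / L * y $ j)"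
      by (auto simp: complex_eq_iff)
    then obtain m where "pi / L * x $ j = pi / L * y $ j + 2 * pi * real_of_int m"
      using sin_cos_eq_iff[of "pi / L * x $ j" "pi / L * y $ j"] by (auto simp: mult_ac)
    then have "pi * (x $ j - y $ j) = pi * (2 * L * m)"
      using L by (simp add: field_simps)
    then have m: "x $ j - y $ j = 2 * L * m" by simp
    have ab: "\<bar>x $ j\<bar> \<le> L" "\<bar>y $ j\<bar> \<le> L" using that by (auto simp: S)
    then have "\<bar>2 * L * m\<bar> \<le> 2 * L" unfolding m[symmetric] by linarith
    then have "\<bar>real_of_int m\<bar> \<le> 1" using L by (simp add: abs_mult)
    \<comment> \<open>Distinct points with equal image differ by exactly \<open>2 * L\<close> in
      coordinate \<open>j\<close>, so both lie on the boundary.\<close>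
    then have "m = 1 \<or> m = -1" using m j by (cases "m = 0") auto
    then have "\<bar>x $ j\<bar> = L" "\<bar>y $ j\<bar> = L" using m ab by auto
    then show ?thesis using boundary by metis
  qed simp
  define F where "F z = f (inv_into S \<phi> z)" for z
  have F: "F (\<phi> x) = f x" if "x \<in> S" for x
    unfolding F_def using that
    by (intro eq) (auto intro: inv_into_into f_inv_into_f)
  \<comment> \<open>On the compact cube \<open>\<phi>\<close> is a closed map, hence a quotient map,
    and continuity descends from \<open>f\<close> to \<open>F\<close>.\<close>
  have "continuous_on T F"
    unfolding continuous_on_closed_vimage[OF compact_imp_closed[OF \<open>compact T\<close>]]
  proof (intro allI impI)
    fix B :: "real set" assume "closed B"
    have "F -` B \<inter> T = \<phi> ` (f -` B \<inter> S)" by (auto simp: T_def F)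
    moreover have "closed (f -` B)" using f \<open>closed B\<close> by (simp add: continuous_closed_vimage continuous_on_eq_continuous_at)
    then have "compact (f -` B \<inter> S)" using \<open>compact S\<close> by (simp add: closed_Int_compact)
    then have "compact (\<phi> ` (f -` B \<inter> S))" by (intro compact_continuous_image \<phi>)
    ultimately show "closed (F -` B \<inter> T)" by (simp add: compact_imp_closed)
  qed
  define P where "P g \<longleftrightarrow> continuous_on T g \<and> trig_poly L (g \<circ> \<phi>)" for g
  have coord: "P (\<lambda>z. Re (z $ j))" "P (\<lambda>z. Im (z $ j))" for j
  proof -
    have ints: "(axis j (pi / L) :: real ^ 'd) $ i * L / pi \<in> \<int>" for i
      using L by (auto simp: axis_def)
    \<comment> \<open>Phase 0 yields the real part of a coordinate of \<open>\<phi>\<close>, phase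
      \<open>- (pi / 2)\<close> its imaginary part.\<close>
    have "trig_poly L (\<lambda>x. 1 * cos (axis j (pi / L) \<bullet> x + b))" for b
      by (rule trig_poly.cos) (rule ints)
    from this[of 0] this[of "- (pi / 2)"]
    show "P (\<lambda>z. Re (z $ j))" "P (\<lambda>z. Im (z $ j))"
      by (auto simp: P_def o_def \<phi>_def inner_axis' cos_diff intro!: continuous_intros)
  qed
  have "\<exists>g. P g \<and> (\<forall>z\<in>T. \<bar>F z - g z\<bar> < \<epsilon>)"
  proof (rule Stone_Weierstrass_HOL[OF \<open>compact T\<close>])
    show "\<exists>g. P g \<and> g z \<noteq> g w" if zw: "z \<in> T \<and> w \<in> T \<and> z \<noteq> w" for z w
    proof -
      obtain j where "z $ j \<noteq> w $ j" using zw by (auto simp: vec_eq_iff)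
      then have "Re (z $ j) \<noteq> Re (w $ j) \<or> Im (z $ j) \<noteq> Im (w $ j)" by (simp add: complex_eq_iff)
      then show ?thesis using coord[of j] by auto
    qed
  qed (use \<open>continuous_on T F\<close> \<epsilon> in \<open>auto simp: P_def o_def trig_poly_const trig_poly.add trig_poly_mult
        intro!: continuous_intros\<close>)
  then obtain g where g: "P g" "\<And>z. z \<in> T \<Longrightarrow> \<bar>F z - g z\<bar> < \<epsilon>" by blast
  show ?thesis
  proof (rule that[of "g \<circ> \<phi>"])
    fix x :: "real ^ 'd" assume "\<And>j. \<bar>x $ j\<bar> \<le> L"
    then have "x \<in> S" by (simp add: S)
    then show "\<bar>f x - (g \<circ> \<phi>) x\<bar> < \<epsilon>" using g(2)[of "\<phi> x"] by (simp add: F T_def)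
  qed (use g(1) in \<open>simp add: P_def\<close>)
qed

text \<open>A continuous substitute for the indicator of \<open>|y| > k\<close>, equal to 1 from
  \<open>k + 1\<close> on, so that tightness can be read off weak convergence.\<close>

definition excess :: "real \<Rightarrow> real \<Rightarrow> real" where
  "excess k y = min 1 (max 0 (\<bar>y\<bar> - k))"

lemma excess_bounds: "0 \<le> excess k y" "excess k y \<le> 1"
  by (auto simp: excess_def)

lemma continuous_on_excess: "continuous_on UNIV (excess k)"
  unfolding excess_def by (intro continuous_intros)

text \<open>Cosines of linear forms are bounded continuous functions of projections, so integrals of
  trigonometric polynomials converge by hypothesis. A general \<open>f\<close> is cut off,
  approximated on a large cube, and compared outside it by means of tightness, which itself follows
  from the coordinate projections.\<close>

proposition Cramer_Wold:
  fixes V :: "nat \<Rightarrow> 'w \<Rightarrow> real ^ 'd::finite" and W :: "'z \<Rightarrow> real ^ 'd"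
  assumes "prob_space M" "prob_space N"
    and V: "\<And>n. V n \<in> borel_measurable M" and W: "W \<in> borel_measurable N"
    and weak: "\<And>t. weak_conv_m (\<lambda>n. distr M borel (\<lambda>w. t \<bullet> V n w)) (distr N borel (\<lambda>w. t \<bullet> W w))"
    and f: "continuous_on UNIV f" and B: "\<And>x. \<bar>f x\<bar> \<le> B"
  shows "(\<lambda>n. \<integral>w. f (V n w) \<partial>M) \<longlonglongrightarrow> (\<integral>w. f (W w) \<partial>N :: real)"
proof -
  interpret M: prob_space M by fact
  interpret N: prob_space N by fact
  have V_t: "(\<lambda>w. t \<bullet> V n w) \<in> borel_measurable M" for t n
    using V[of n] by measurable
  have W_t: "(\<lambda>w. t \<bullet> W w) \<in> borel_measurable N" for t
    using W by measurable
  have one_dim: "(\<lambda>n. \<integral>w. h (t \<bullet> V n w) \<partial>M) \<longlonglongrightarrow> (\<integral>w. h (t \<bullet> W w) \<partial>N)"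
    if h: "continuous_on UNIV h" and b: "\<And>y. \<bar>h y\<bar> \<le> b" for h :: "real \<Rightarrow> real" and b t
  proof -
    have h_m: "h \<in> borel_measurable borel" using h by (rule borel_measurable_continuous_onI)
    have "(\<lambda>n. integral\<^sup>L (distr M borel (\<lambda>w. t \<bullet> V n w)) h) \<longlonglongrightarrow>
        integral\<^sup>L (distr N borel (\<lambda>w. t \<bullet> W w)) h"
    proof (rule weak_conv_imp_integral_bdd_continuous_conv[OF _ _ weak, where B = b])
      show "real_distribution (distr M borel (\<lambda>w. t \<bullet> V n w))" for n
        using V_t by (rule M.real_distribution_distr)
      show "real_distribution (distr N borel (\<lambda>w. t \<bullet> W w))"
        using W_t by (rule N.real_distribution_distr)
      show "isCont h x" for x using h by (simp add: continuous_on_eq_continuous_at)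
    qed (use b in simp)
    then show ?thesis by (simp add: integral_distr[OF V_t h_m] integral_distr[OF W_t h_m])
  qed
  have M_int: "integrable M (\<lambda>w. h (V n w))"
    if h: "continuous_on UNIV h" and b: "\<And>y. \<bar>h y\<bar> \<le> b" for h :: "real ^ 'd \<Rightarrow> real" and b n
    using b measurable_compose[OF V borel_measurable_continuous_onI[OF h]]
    by (intro M.integrable_const_bound[of _ b]) auto
  have N_int: "integrable N (\<lambda>w. h (W w))"
    if h: "continuous_on UNIV h" and b: "\<And>y. \<bar>h y\<bar> \<le> b" for h :: "real ^ 'd \<Rightarrow> real" and b
    using b measurable_compose[OF W borel_measurable_continuous_onI[OF h]]
    by (intro N.integrable_const_bound[of _ b]) auto
  have trig: "(\<lambda>n. \<integral>w. g (V n w) \<partial>M) \<longlonglongrightarrow> (\<integral>w. g (W w) \<partial>N)" if "trig_poly L g" for g L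
    using that
  proof induction
    case (cos t c b)
    have "\<bar>c * cos (y + b)\<bar> \<le> \<bar>c\<bar>" for y
      using mult_left_mono[OF abs_cos_le_one, of "\<bar>c\<bar>"] by (simp add: abs_mult)
    then show ?case
      by (intro one_dim[of "\<lambda>y. c * cos (y + b)"] continuous_intros)
  next
    case (add g h)
    obtain a b where "\<And>x. \<bar>g x\<bar> \<le> a" "\<And>x. \<bar>h x\<bar> \<le> b"
      using add.hyps trig_poly_bounded by metis
    note bounds = this
    have "(\<integral>w. g (V n w) + h (V n w) \<partial>M) = (\<integral>w. g (V n w) \<partial>M) + (\<integral>w. h (V n w) \<partial>M)" for n
      using add.hyps bounds by (intro Bochner_Integration.integral_add M_int trig_poly_continuous)
    moreover have "(\<integral>w. g (W w) + h (W w) \<partial>N) = (\<integral>w. g (W w) \<partial>N) + (\<integral>w. h (W w) \<partial>N)"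
      using add.hyps bounds by (intro Bochner_Integration.integral_add N_int trig_poly_continuous)
    ultimately show ?case using tendsto_add[OF add.IH] by simp
  qed
  \<comment> \<open>A sum over coordinates, so its integrals converge by the hypothesis along the
    axes; it is at least 1 outside the cube of half-width \<open>k + 1\<close>.\<close>
  define \<Psi> :: "real \<Rightarrow> real ^ 'd \<Rightarrow> real" where "\<Psi> k x = (\<Sum>j\<in>UNIV. excess k (x $ j))" for k x
  have \<Psi>_cont: "continuous_on UNIV (\<Psi> k)" for k
    unfolding \<Psi>_def
    by (intro continuous_intros continuous_on_compose2[OF continuous_on_excess]) auto
  have \<Psi>_nonneg: "0 \<le> \<Psi> k x" for k x
    unfolding \<Psi>_def by (intro sum_nonneg excess_bounds)
  have \<Psi>_bdd: "\<bar>\<Psi> k x\<bar> \<le> CARD('d)" for k x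
    using sum_mono[of UNIV "\<lambda>j. excess k (x $ j)" "\<lambda>_. 1"] \<Psi>_nonneg[of k x]
    by (simp add: \<Psi>_def excess_bounds)
  have ex_cont: "continuous_on UNIV (\<lambda>x::real ^ 'd. excess k (x $ j))" for k j
    by (intro continuous_intros continuous_on_compose2[OF continuous_on_excess]) auto
  have ex_bdd: "\<bar>excess k (x $ j)\<bar> \<le> 1" for k j and x :: "real ^ 'd"
    by (simp add: excess_bounds)
  have \<Psi>_V: "(\<lambda>n. \<integral>w. \<Psi> k (V n w) \<partial>M) \<longlonglongrightarrow> (\<integral>w. \<Psi> k (W w) \<partial>N)" for k
  proof -
    have "(\<lambda>n. \<Sum>j\<in>UNIV. \<integral>w. excess k (V n w $ j) \<partial>M) \<longlonglongrightarrow> (\<Sum>j\<in>UNIV. \<integral>w. excess k (W w $ j) \<partial>N)"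
    proof (intro tendsto_sum)
      fix j :: 'd
      show "(\<lambda>n. \<integral>w. excess k (V n w $ j) \<partial>M) \<longlonglongrightarrow> (\<integral>w. excess k (W w $ j) \<partial>N)"
        using one_dim[OF continuous_on_excess, of k 1 "axis j 1"]
        by (simp add: inner_axis' excess_bounds)
    qed
    moreover have "(\<integral>w. \<Psi> k (V n w) \<partial>M) = (\<Sum>j\<in>UNIV. \<integral>w. excess k (V n w $ j) \<partial>M)" for n
      unfolding \<Psi>_def by (intro Bochner_Integration.integral_sum M_int[OF ex_cont ex_bdd])
    moreover have "(\<integral>w. \<Psi> k (W w) \<partial>N) = (\<Sum>j\<in>UNIV. \<integral>w. excess k (W w $ j) \<partial>N)"
      unfolding \<Psi>_def by (intro Bochner_Integration.integral_sum N_int[OF ex_cont ex_bdd])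
    ultimately show ?thesis by simp
  qed
  have \<Psi>_W: "(\<lambda>k. \<integral>w. \<Psi> (real k) (W w) \<partial>N) \<longlonglongrightarrow> (\<integral>w. 0 \<partial>N)"
  proof (rule integral_dominated_convergence[where w = "\<lambda>_. real CARD('d)"])
    have "(\<lambda>k. \<Psi> (real k) x) \<longlonglongrightarrow> 0" for x
    proof (rule tendsto_eventually)
      show "\<forall>\<^sub>F k in sequentially. \<Psi> (real k) x = 0"
      proof (rule eventually_sequentiallyI)
        fix k assume k: "nat \<lceil>norm x\<rceil> \<le> k"
        have "excess k (x $ j) = 0" for j
          using component_le_norm_cart[of x j] k by (simp add: excess_def)
        then show "\<Psi> (real k) x = 0" by (simp add: \<Psi>_def)
      qed
    qed
    then show "AE w in N. (\<lambda>k. \<Psi> (real k) (W w)) \<longlonglongrightarrow> 0" by simp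
    show "(\<lambda>w. \<Psi> (real k) (W w)) \<in> borel_measurable N" for k
      using measurable_compose[OF W borel_measurable_continuous_onI[OF \<Psi>_cont]] .
  qed (use \<Psi>_bdd in auto)
  have B0: "0 \<le> B" using B[of 0] abs_ge_zero order_trans by blast
  show ?thesis
  proof (rule LIMSEQ_I)
    fix r :: real assume r: "0 < r"
    \<comment> \<open>The two comparisons with \<open>g\<close> cost
      \<open>\<epsilon> + 2 * B * \<epsilon>\<close> each and the convergence for \<open>g\<close>
      costs \<open>\<epsilon>\<close>, which leaves one \<open>\<epsilon>\<close> of
      \<open>r\<close> to spare.\<close>
    define \<epsilon> where "\<epsilon> = r / (4 + 4 * B)"
    have \<epsilon>: "0 < \<epsilon>" using r B0 by (simp add: \<epsilon>_def add_pos_nonneg)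
    have "eventually (\<lambda>k. (\<integral>w. \<Psi> (real k) (W w) \<partial>N) < \<epsilon>) sequentially"
      using \<Psi>_W \<epsilon> by (intro order_tendstoD) auto
    then obtain k :: nat where k: "(\<integral>w. \<Psi> (real k) (W w) \<partial>N) < \<epsilon>"
      by (auto simp: eventually_sequentially)
    define L where "L = real k + 1"
    have L: "0 < L" by (simp add: L_def)
    have \<Psi>_1: "1 \<le> \<Psi> k x" if "L \<le> \<bar>x $ j\<bar>" for x j
    proof -
      have "1 = excess k (x $ j)" using that by (simp add: excess_def L_def)
      also have "\<dots> \<le> \<Psi> k x" unfolding \<Psi>_def by (rule member_le_sum) (auto simp: excess_bounds)
      finally show ?thesis .
    qed
    \<comment> \<open>The cut-off makes the function vanish on the boundary of the cube, as the
      approximation requires, and changes \<open>f\<close> by at most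
      \<open>B * \<Psi> k x\<close>.\<close>
    define h where "h x = f x * max 0 (1 - \<Psi> k x)" for x
    have "continuous_on UNIV h" unfolding h_def by (intro continuous_intros f \<Psi>_cont)
    moreover have "h x = 0" if "\<bar>x $ j\<bar> = L" for x j
      using \<Psi>_1[of x j] that by (simp add: h_def)
    ultimately obtain g where g: "trig_poly L g" "\<And>x. (\<And>j. \<bar>x $ j\<bar> \<le> L) \<Longrightarrow> \<bar>h x - g x\<bar> < \<epsilon>"
      using trig_poly_approx[OF L _ \<epsilon>] by blast
    have h_le: "\<bar>h x\<bar> \<le> B" for x
    proof -
      have "\<bar>h x\<bar> \<le> B * 1" unfolding h_def abs_mult
        using B \<Psi>_nonneg[of k x] by (intro mult_mono) (auto simp: B0)
      then show ?thesis by simp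
    qed
    have near: "\<bar>f x - g x\<bar> \<le> \<epsilon> + 2 * B * \<Psi> k x" for x
    proof -
      have "f x - h x = f x * (1 - max 0 (1 - \<Psi> k x))" by (simp add: h_def algebra_simps)
      then have 1: "\<bar>f x - h x\<bar> \<le> B * \<Psi> k x"
        unfolding abs_mult using B \<Psi>_nonneg[of k x] by (simp only: abs_mult) (intro mult_mono, auto simp: B0)
      show ?thesis
      proof (cases "\<forall>j. \<bar>x $ j\<bar> \<le> L")
        case True
        then have "\<bar>h x - g x\<bar> < \<epsilon>" using g(2) by blast
        moreover have "0 \<le> B * \<Psi> k x" using B0 \<Psi>_nonneg by simp
        ultimately show ?thesis using 1 by linarith
      next
        case False
        then obtain j where "L \<le> \<bar>x $ j\<bar>" by (auto simp: not_le intro: less_imp_le)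
        then have big: "1 \<le> \<Psi> k x" by (rule \<Psi>_1)
        \<comment> \<open>Outside the cube nothing relates \<open>g\<close> to \<open>f\<close>, but
          periodicity still bounds \<open>g\<close> by its values inside.\<close>
        obtain y where y: "\<And>j. \<bar>y $ j\<bar> \<le> L" "g y = g x"
          using trig_poly_periodic[OF L, of x] g(1) by metis
        have "\<bar>g x\<bar> \<le> B + \<epsilon>" using g(2)[OF y(1)] h_le[of y] unfolding y(2) by linarith
        moreover have "B * 1 \<le> B * \<Psi> k x" using big B0 by (rule mult_left_mono)
        ultimately show ?thesis using B[of x] by linarith
      qed
    qed
    obtain b where b: "\<And>x. \<bar>g x\<bar> \<le> b" using trig_poly_bounded[OF g(1)] by blast
    note g_cont = trig_poly_continuous[OF g(1)]
    have diff_M: "\<bar>(\<integral>w. f (V n w) \<partial>M) - (\<integral>w. g (V n w) \<partial>M)\<bar> \<le> \<epsilon> + 2 * B * (\<integral>w. \<Psi> k (V n w) \<partial>M)" for n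
    proof -
      have "\<bar>(\<integral>w. f (V n w) \<partial>M) - (\<integral>w. g (V n w) \<partial>M)\<bar> = \<bar>\<integral>w. f (V n w) - g (V n w) \<partial>M\<bar>"
        using M_int[OF f B] M_int[OF g_cont b] by simp
      also have "\<dots> \<le> (\<integral>w. \<bar>f (V n w) - g (V n w)\<bar> \<partial>M)" by (rule integral_abs_bound)
      also have "\<dots> \<le> (\<integral>w. \<epsilon> + 2 * B * \<Psi> k (V n w) \<partial>M)"
        using M_int[OF f B] M_int[OF g_cont b] M_int[OF \<Psi>_cont \<Psi>_bdd] near by (intro integral_mono) auto
      also have "\<dots> = \<epsilon> + 2 * B * (\<integral>w. \<Psi> k (V n w) \<partial>M)"
        using M_int[OF \<Psi>_cont \<Psi>_bdd] by (simp add: M.prob_space)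
      finally show ?thesis .
    qed
    have diff_N: "\<bar>(\<integral>w. f (W w) \<partial>N) - (\<integral>w. g (W w) \<partial>N)\<bar> \<le> \<epsilon> + 2 * B * (\<integral>w. \<Psi> k (W w) \<partial>N)"
    proof -
      have "\<bar>(\<integral>w. f (W w) \<partial>N) - (\<integral>w. g (W w) \<partial>N)\<bar> = \<bar>\<integral>w. f (W w) - g (W w) \<partial>N\<bar>"
        using N_int[OF f B] N_int[OF g_cont b] by simp
      also have "\<dots> \<le> (\<integral>w. \<bar>f (W w) - g (W w)\<bar> \<partial>N)" by (rule integral_abs_bound)
      also have "\<dots> \<le> (\<integral>w. \<epsilon> + 2 * B * \<Psi> k (W w) \<partial>N)"
        using N_int[OF f B] N_int[OF g_cont b] N_int[OF \<Psi>_cont \<Psi>_bdd] near by (intro integral_mono) auto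
      also have "\<dots> = \<epsilon> + 2 * B * (\<integral>w. \<Psi> k (W w) \<partial>N)"
        using N_int[OF \<Psi>_cont \<Psi>_bdd] by (simp add: N.prob_space)
      finally show ?thesis .
    qed
    have "eventually (\<lambda>n. (\<integral>w. \<Psi> k (V n w) \<partial>M) < \<epsilon>) sequentially"
      using \<Psi>_V k by (intro order_tendstoD) auto
    moreover have "eventually (\<lambda>n. dist (\<integral>w. g (V n w) \<partial>M) (\<integral>w. g (W w) \<partial>N) < \<epsilon>) sequentially"
      using trig[OF g(1)] \<epsilon> by (rule tendstoD)
    ultimately have "eventually (\<lambda>n. norm ((\<integral>w. f (V n w) \<partial>M) - (\<integral>w. f (W w) \<partial>N)) < r) sequentially"
    proof eventually_elim
      case (elim n)
      have "2 * B * (\<integral>w. \<Psi> k (V n w) \<partial>M) \<le> 2 * B * \<epsilon>" "2 * B * (\<integral>w. \<Psi> k (W w) \<partial>N) \<le> 2 * B * \<epsilon>"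
        using elim(1) k B0 by (auto intro!: mult_left_mono)
      moreover have "r = 4 * \<epsilon> + 2 * (2 * B * \<epsilon>)" using B0 by (simp add: \<epsilon>_def field_simps add_nonneg_eq_0_iff)
      ultimately show ?case
        using elim(2) diff_M[of n] diff_N \<epsilon> unfolding dist_real_def real_norm_def by linarith
    qed
    then show "\<exists>m. \<forall>n\<ge>m. norm ((\<integral>w. f (V n w) \<partial>M) - (\<integral>w. f (W w) \<partial>N)) < r"
      by (simp add: eventually_sequentially)
  qed
qed

section \<open>Weak law of large numbers\<close>

text \<open>A supremum of affine functions of \<open>s\<close> is convex, and a finite convex
  function on a finite-dimensional space is continuous.\<close>

lemma quad_sup_continuous:
  fixes A :: "real ^ 'd::finite \<Rightarrow> real"
  assumes c: "0 < c" "\<And>\<zeta>. c * (norm \<zeta>)\<^sup>2 \<le> A \<zeta>"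
  shows "continuous_on UNIV (quad_sup A)"
proof (rule convex_on_continuous[OF open_UNIV])
  show "convex_on UNIV (quad_sup A)"
  proof (rule convex_onI)
    fix t :: real and x y :: "real ^ 'd" assume t: "0 < t" "t < 1"
    show "quad_sup A ((1 - t) *\<^sub>R x + t *\<^sub>R y) \<le> (1 - t) * quad_sup A x + t * quad_sup A y"
      unfolding quad_sup_def[of A "(1 - t) *\<^sub>R x + t *\<^sub>R y"]
    proof (rule cSUP_least)
      fix \<zeta>
      have le: "2 * (\<zeta> \<bullet> z) - A \<zeta> \<le> quad_sup A z" for z
        unfolding quad_sup_def by (rule cSUP_upper[OF _ quad_sup_bdd[OF c]]) auto
      have "2 * (\<zeta> \<bullet> ((1 - t) *\<^sub>R x + t *\<^sub>R y)) - A \<zeta> =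
          (1 - t) * (2 * (\<zeta> \<bullet> x) - A \<zeta>) + t * (2 * (\<zeta> \<bullet> y) - A \<zeta>)"
        by (simp add: algebra_simps inner_add_right)
      also have "\<dots> \<le> (1 - t) * quad_sup A x + t * quad_sup A y"
        using t le by (intro add_mono mult_left_mono) auto
      finally show "2 * (\<zeta> \<bullet> ((1 - t) *\<^sub>R x + t *\<^sub>R y)) - A \<zeta> \<le> (1 - t) * quad_sup A x + t * quad_sup A y" .
    qed simp
  qed simp
qed

lemma weak_conv_m_scale:
  assumes "prob_space M" "prob_space N" and T: "\<And>n. T n \<in> borel_measurable M" "U \<in> borel_measurable N"
    and weak: "weak_conv_m (\<lambda>n. distr M borel (T n)) (distr N borel U)"
  shows "weak_conv_m (\<lambda>n. distr M borel (\<lambda>w. k * T n w)) (distr N borel (\<lambda>w. (k :: real) * U w))"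
proof -
  interpret M: prob_space M by fact
  interpret N: prob_space N by fact
  have kT: "(\<lambda>w. k * T n w) \<in> borel_measurable M" "(\<lambda>w. k * U w) \<in> borel_measurable N" for n
    using T by measurable
  show ?thesis
  proof (rule integral_bdd_continuous_conv_imp_weak_conv)
    fix f :: "real \<Rightarrow> real" assume f: "\<And>x. isCont f x" "\<And>x. \<bar>f x\<bar> \<le> 1"
    have f_m: "f \<in> borel_measurable borel"
      using f(1) by (intro borel_measurable_continuous_onI) (simp add: continuous_at_imp_continuous_on)
    have g: "isCont (\<lambda>y. f (k * y)) x" for x
    proof -
      have "isCont (\<lambda>y. k * y) x" by (intro continuous_intros)
      then show ?thesis by (rule isCont_o2) (rule f(1))
    qed
    have g_m: "(\<lambda>y. f (k * y)) \<in> borel_measurable borel" using f_m by measurable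
    have "(\<lambda>n. integral\<^sup>L (distr M borel (T n)) (\<lambda>y. f (k * y))) \<longlonglongrightarrow> integral\<^sup>L (distr N borel U) (\<lambda>y. f (k * y))"
      using g f(2) T weak
      by (intro weak_conv_imp_integral_bdd_continuous_conv[where B = 1] M.real_distribution_distr N.real_distribution_distr) auto
    then show "(\<lambda>n. integral\<^sup>L (distr M borel (\<lambda>w. k * T n w)) f) \<longlonglongrightarrow> integral\<^sup>L (distr N borel (\<lambda>w. k * U w)) f"
      by (simp add: integral_distr[OF T(1) g_m] integral_distr[OF T(2) g_m] integral_distr[OF kT(1) f_m] integral_distr[OF kT(2) f_m])
  qed (use kT in auto)
qed

context prob_space
begin

text \<open>Observations are numbered from 1, whereas the central limit theorem sums over
  \<open>i < n\<close>.\<close>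

lemma indep_vars_Suc:
  assumes "indep_vars (\<lambda>_. N) U {1..}"
  shows "indep_vars (\<lambda>_. N) (\<lambda>i. U (Suc i)) UNIV"
proof -
  have ind: "indep_sets (\<lambda>i. {U i -` A \<inter> space M |A. A \<in> sets N}) {1..}"
    and rv: "\<And>i. i \<in> {1..} \<Longrightarrow> random_variable N (U i)"
    using assms by (auto simp: indep_vars_def2)
  let ?F = "\<lambda>i. {U i -` A \<inter> space M |A. A \<in> sets N}"
  have "indep_sets (\<lambda>i. ?F (Suc i)) UNIV"
  proof (rule indep_setsI)
    show "?F (Suc i) \<subseteq> events" for i
      using rv[of "Suc i"] by (auto intro: measurable_sets)
    fix A J assume J: "J \<noteq> {}" "finite J" "\<forall>j\<in>J. A j \<in> ?F (Suc j)"
    have "prob (\<Inter>j\<in>Suc ` J. A (j - 1)) = (\<Prod>j\<in>Suc ` J. prob (A (j - 1)))"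
      using J by (intro indep_setsD[OF ind]) auto
    then show "prob (\<Inter>j\<in>J. A j) = (\<Prod>j\<in>J. prob (A j))"
      by (simp add: prod.reindex)
  qed
  then show ?thesis using rv by (simp add: indep_vars_def2)
qed

text \<open>Preimages under \<open>f \<circ> X\<close> are preimages under \<open>X\<close>, and
  they form an intersection-stable family, so independence passes to the generated sigma-algebras.
  This makes the product rule for expectations available.\<close>

lemma independent_rvs_compose:
  fixes f :: "'b::topological_space \<Rightarrow> real" and g :: "'c::topological_space \<Rightarrow> real"
  assumes "independent_rvs M X Y" and [measurable]: "f \<in> borel_measurable borel" "g \<in> borel_measurable borel"
  shows "indep_var borel (\<lambda>w. f (X w)) borel (\<lambda>w. g (Y w))"
proof -
  have [measurable]: "random_variable borel X" "random_variable borel Y"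
    and ind: "indep_set {X -` A \<inter> space M |A. A \<in> sets borel} {Y -` B \<inter> space M |B. B \<in> sets borel}"
    using assms by (auto simp: independent_rvs_def)
  have stable: "Int_stable {V -` A \<inter> space M |A. A \<in> sets borel}" for V :: "'a \<Rightarrow> real"
  proof (rule Int_stableI)
    fix a b assume "a \<in> {V -` A \<inter> space M |A. A \<in> sets borel}" "b \<in> {V -` A \<inter> space M |A. A \<in> sets borel}"
    then obtain A B where "A \<in> sets borel" "B \<in> sets borel" "a \<inter> b = V -` (A \<inter> B) \<inter> space M" by blast
    then show "a \<inter> b \<in> {V -` A \<inter> space M |A. A \<in> sets borel}" by blast
  qed
  have pre: "\<exists>B. (\<lambda>w. h (V w)) -` A \<inter> space M = V -` B \<inter> space M \<and> B \<in> sets borel"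
    if "h \<in> borel_measurable borel" "A \<in> sets borel" for h :: "'e::topological_space \<Rightarrow> real" and V A
    using measurable_sets[OF that] by (intro exI[of _ "h -` A"]) auto
  have "indep_set {(\<lambda>w. f (X w)) -` A \<inter> space M |A. A \<in> sets borel}
      {(\<lambda>w. g (Y w)) -` B \<inter> space M |B. B \<in> sets borel}"
    using ind pre[of f _ X] pre[of g _ Y] unfolding indep_sets2_eq
    by (smt (verit) mem_Collect_eq subset_iff assms(2,3))
  then show ?thesis
    unfolding indep_var_eq by (intro conjI indep_set_sigma_sets stable) auto
qed

text \<open>With only a first moment at hand, the variables are truncated at a level
  \<open>k\<close>: Hoeffding's inequality handles the bounded part, Markov's inequality the
  nonnegative rest, whose mean is small for large \<open>k\<close>.\<close>

lemma weak_law_of_large_numbers: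
  fixes U :: "nat \<Rightarrow> 'a \<Rightarrow> real"
  assumes indep: "indep_vars (\<lambda>_. borel) U {1..}"
    and law: "\<And>i. i \<ge> 1 \<Longrightarrow> distr M borel (U i) = distr M borel V"
    and V: "integrable M V" "\<And>w. 0 \<le> V w" and U: "\<And>i w. 0 \<le> U i w" and \<epsilon>: "0 < \<epsilon>"
  shows "(\<lambda>n. prob {w \<in> space M. \<epsilon> \<le> \<bar>(\<Sum>i=1..n. U i w) / n - expectation V\<bar>}) \<longlonglongrightarrow> 0"
proof (rule LIMSEQ_I)
  fix r :: real assume r: "0 < r"
  have V_m [measurable]: "V \<in> borel_measurable M" using V(1) by simp
  have U_m: "U i \<in> borel_measurable M" if "1 \<le> i" for i
    using indep that by (auto simp: indep_vars_def)
  \<comment> \<open>The first bound limits the bias of the truncated mean to a third of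
    \<open>\<epsilon>\<close>, the second makes Markov's inequality give at most
    \<open>r / 2\<close>.\<close>
  define \<delta> where "\<delta> = min (\<epsilon> / 3) (\<epsilon> / 3 * (r / 2))"
  have \<delta>: "0 < \<delta>" "\<delta> \<le> \<epsilon> / 3" "\<delta> / (\<epsilon> / 3) \<le> r / 2"
    using \<epsilon> r by (auto simp: \<delta>_def divide_le_eq mult.commute)
  have "(\<lambda>k. \<integral>w. min (V w) (real k) \<partial>M) \<longlonglongrightarrow> (\<integral>w. V w \<partial>M)"
  proof (rule integral_dominated_convergence[where w = V])
    show "AE w in M. (\<lambda>k. min (V w) (real k)) \<longlonglongrightarrow> V w"
    proof (rule AE_I2, rule tendsto_eventually)
      fix w
      show "\<forall>\<^sub>F k in sequentially. min (V w) (real k) = V w"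
        by (rule eventually_sequentiallyI[of "nat \<lceil>V w\<rceil>"]) linarith
    qed
  qed (use V in auto)
  then have "\<forall>\<^sub>F k in sequentially. expectation V - \<delta> < (\<integral>w. min (V w) (real k) \<partial>M)"
    using \<delta>(1) by (intro order_tendstoD) auto
  then obtain k0 where k0: "\<And>k. k0 \<le> k \<Longrightarrow> expectation V - \<delta> < (\<integral>w. min (V w) (real k) \<partial>M)"
    by (auto simp: eventually_sequentially)
  \<comment> \<open>The successor keeps the truncation interval from \<open>0\<close> to
    \<open>k\<close> nondegenerate, so the exponent in Hoeffding's bound is negative.\<close>
  define k where "k = Suc k0"
  define T where "T = (\<lambda>w. min (V w) (real k))"
  define T' where "T' = (\<lambda>i w. min (U i w) (real k))"
  have T: "expectation V - \<delta> < expectation T"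
    unfolding T_def by (rule k0) (simp add: k_def)
  have T_int: "integrable M T"
    unfolding T_def by (rule Bochner_Integration.integrable_bound[OF V(1)]) (use V in auto)
  have law_min: "distr M borel (T' i) = distr M borel T" if "1 \<le> i" for i
  proof -
    have "distr (distr M borel (U i)) borel (\<lambda>y. min y (real k)) = distr (distr M borel V) borel (\<lambda>y. min y (real k))"
      by (simp only: law[OF that])
    then show ?thesis
      using U_m[OF that] by (simp add: distr_distr T_def T'_def o_def)
  qed
  have int_eq: "integrable M (\<lambda>w. U i w - T' i w)" "(\<integral>w. U i w - T' i w \<partial>M) = expectation V - expectation T"
    if "1 \<le> i" for i
  proof -
    have [measurable]: "U i \<in> borel_measurable M" using U_m that .
    have m: "(\<lambda>y. y - min y (real k)) \<in> borel_measurable borel" by measurable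
    have VT: "integrable M (\<lambda>w. V w - min (V w) (real k))"
      using V(1) T_int by (simp add: T_def)
    show "integrable M (\<lambda>w. U i w - T' i w)"
      using VT integrable_distr_eq[OF U_m[OF that] m] integrable_distr_eq[OF V_m m] law[OF that]
      by (simp add: T'_def)
    have "(\<integral>w. U i w - T' i w \<partial>M) = (\<integral>w. V w - min (V w) (real k) \<partial>M)"
      using integral_distr[OF U_m[OF that] m] integral_distr[OF V_m m] law[OF that]
      by (simp add: T'_def)
    then show "(\<integral>w. U i w - T' i w \<partial>M) = expectation V - expectation T"
      using V(1) T_int by (simp add: T_def)
  qed
  have hoeff: "prob {w \<in> space M. \<epsilon> / 3 \<le> \<bar>(\<Sum>i=1..n. T' i w) / n - expectation T\<bar>}
      \<le> 2 * exp (-2 * n * (\<epsilon> / 3)\<^sup>2 / (real k)\<^sup>2)" if n: "0 < n" for n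
  proof -
    interpret H: Hoeffding_ineq_iid M "{1..n}" T' T 0 "real k" "expectation T"
    proof unfold_locales
      have "indep_vars (\<lambda>_. borel) (\<lambda>i w. min (U i w) (real k)) {1..}"
        by (rule indep_vars_compose2[OF indep]) simp
      then show "indep_vars (\<lambda>_. borel) T' {1..n}"
        unfolding T'_def by (rule indep_vars_subset) auto
    qed (use law_min V T_int in \<open>auto simp: T_def\<close>)
    show ?thesis
      using H.Hoeffding_ineq_abs_ge'[of "\<epsilon> / 3"] \<epsilon> n by (simp add: k_def)
  qed
  have "(\<lambda>n. 2 * exp (-2 * real n * (\<epsilon> / 3)\<^sup>2 / (real k)\<^sup>2)) \<longlonglongrightarrow> 0"
  proof -
    define a where "a = 2 * (\<epsilon> / 3)\<^sup>2 / (real k)\<^sup>2"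
    have a: "0 < a" using \<epsilon> by (simp add: a_def k_def)
    have "(\<lambda>n. (exp (- a)) ^ n) \<longlonglongrightarrow> 0" using a by (intro LIMSEQ_power_zero) simp
    then have "(\<lambda>n. 2 * (exp (- a)) ^ n) \<longlonglongrightarrow> 2 * 0" by (rule tendsto_mult_left)
    moreover have "(exp (- a)) ^ n = exp (-2 * real n * (\<epsilon> / 3)\<^sup>2 / (real k)\<^sup>2)" for n
      by (simp add: exp_of_nat_mult[symmetric] a_def mult_ac)
    ultimately show ?thesis by simp
  qed
  then have "\<forall>\<^sub>F n in sequentially. 2 * exp (-2 * real n * (\<epsilon> / 3)\<^sup>2 / (real k)\<^sup>2) < r / 2"
    by (rule order_tendstoD) (use r in simp)
  then have "\<forall>\<^sub>F n in sequentially. norm (prob {w \<in> space M. \<epsilon> \<le> \<bar>(\<Sum>i=1..n. U i w) / n - expectation V\<bar>} - 0) < r"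
    using eventually_gt_at_top[of 0]
  proof eventually_elim
    case (elim n)
    define W where "W w = (\<Sum>i=1..n. U i w - T' i w) / n" for w
    have W_int: "integrable M W"
      unfolding W_def by (intro integrable_divide Bochner_Integration.integrable_sum int_eq(1)) auto
    have W_nonneg: "0 \<le> W w" for w
      unfolding W_def T'_def by (intro divide_nonneg_nonneg sum_nonneg) auto
    have W_exp: "expectation W = expectation V - expectation T"
      unfolding W_def using elim(2) int_eq by (simp add: Bochner_Integration.integral_sum)
    let ?A = "{w \<in> space M. \<epsilon> / 3 \<le> \<bar>(\<Sum>i=1..n. T' i w) / n - expectation T\<bar>}"
    let ?B = "{w \<in> space M. \<epsilon> / 3 \<le> W w}"
    have T'_m: "T' i \<in> borel_measurable M" if "i \<in> {1..n}" for i
      using U_m[of i] that unfolding T'_def by auto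
    have sets: "?A \<in> events" "?B \<in> events"
      using T'_m W_int by (auto intro!: borel_measurable_le borel_measurable_abs borel_measurable_diff
          borel_measurable_divide borel_measurable_sum)
    have "{w \<in> space M. \<epsilon> \<le> \<bar>(\<Sum>i=1..n. U i w) / n - expectation V\<bar>} \<subseteq> ?A \<union> ?B"
    proof safe
      fix w assume w: "\<epsilon> \<le> \<bar>(\<Sum>i=1..n. U i w) / n - expectation V\<bar>" "\<not> \<epsilon> / 3 \<le> W w"
      have "(\<Sum>i=1..n. U i w) / n = (\<Sum>i=1..n. T' i w) / n + W w"
        by (simp add: W_def sum_subtractf diff_divide_distrib)
      moreover have "expectation T \<le> expectation V"
        using T_int V(1) by (intro integral_mono) (auto simp: T_def)
      ultimately show "\<epsilon> / 3 \<le> \<bar>(\<Sum>i=1..n. T' i w) / n - expectation T\<bar>"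
        using w T \<delta>(2) W_nonneg[of w] by linarith
    qed
    then have "prob {w \<in> space M. \<epsilon> \<le> \<bar>(\<Sum>i=1..n. U i w) / n - expectation V\<bar>} \<le> prob (?A \<union> ?B)"
      using sets by (intro finite_measure_mono) auto
    also have "\<dots> \<le> prob ?A + prob ?B" using sets by (rule measure_Un_le)
    finally have "prob {w \<in> space M. \<epsilon> \<le> \<bar>(\<Sum>i=1..n. U i w) / n - expectation V\<bar>} \<le> prob ?A + prob ?B" .
    moreover have "prob ?B \<le> expectation W / (\<epsilon> / 3)"
      using \<epsilon> W_nonneg by (intro integral_Markov_inequality_measure[OF W_int sets.top]) auto
    moreover have "expectation W / (\<epsilon> / 3) \<le> \<delta> / (\<epsilon> / 3)"
      using T \<epsilon> unfolding W_exp by (intro divide_right_mono) auto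
    ultimately have "prob {w \<in> space M. \<epsilon> \<le> \<bar>(\<Sum>i=1..n. U i w) / n - expectation V\<bar>} < r"
      using hoeff[OF elim(2)] elim(1) \<delta>(3) by linarith
    then show ?case by simp
  qed
  then show "\<exists>m. \<forall>n\<ge>m. norm (prob {w \<in> space M. \<epsilon> \<le> \<bar>(\<Sum>i=1..n. U i w) / n - expectation V\<bar>} - 0) < r"
    by (simp add: eventually_sequentially)
qed

end

section \<open>The linear model\<close>

locale linear_model = prob_space M + conjugate_exponents p q
  for M :: "'w measure" and p q :: ereal +
  fixes X :: "'w \<Rightarrow> real ^ 'd::finite" and e :: "'w \<Rightarrow> real"
    and s :: "nat \<Rightarrow> 'w \<Rightarrow> (real ^ 'd) \<times> real" and \<beta> :: "real ^ 'd" and \<sigma> :: real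
  assumes indep_Xe: "independent_rvs M X e"
    and e_integrable: "integrable M e" and mean_e: "expectation e = 0"
    and e2_integrable: "integrable M (\<lambda>w. (e w)\<^sup>2)" and e2: "expectation (\<lambda>w. (e w)\<^sup>2) = \<sigma>\<^sup>2" and \<sigma>: "0 < \<sigma>"
    and XX_integrable: "\<And>i j. integrable M (\<lambda>w. X w $ i * X w $ j)"
    and sample_indep: "indep_vars (\<lambda>_. borel) s {1..}"
    and sample_law: "\<And>i. 1 \<le> i \<Longrightarrow> distr M borel (s i) = distr M borel (\<lambda>w. (X w, \<beta> \<bullet> X w + e w))"
begin

definition obs :: "'w \<Rightarrow> (real ^ 'd) \<times> real" where
  "obs w = (X w, \<beta> \<bullet> X w + e w)"

definition A :: "real ^ 'd \<Rightarrow> real" where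
  "A \<zeta> = expectation (\<lambda>w. (lnorm p (e w *\<^sub>R \<zeta> - (\<zeta> \<bullet> X w) *\<^sub>R \<beta>))\<^sup>2)"

lemma resid_obs [simp]: "resid \<beta> (obs w) = e w" and fst_obs [simp]: "fst (obs w) = X w"
  by (simp_all add: obs_def resid_def)

lemma tilt_obs: "tilt \<beta> (obs w) \<zeta> = e w *\<^sub>R \<zeta> - (\<zeta> \<bullet> X w) *\<^sub>R \<beta>"
  by (simp add: tilt_def)

lemma X_measurable [measurable]: "X \<in> borel_measurable M"
  and e_measurable [measurable]: "e \<in> borel_measurable M"
  using indep_Xe by (auto simp: independent_rvs_def)

lemma obs_measurable [measurable]: "obs \<in> borel_measurable M"
  unfolding obs_def[abs_def] by measurable

lemma s_measurable: "1 \<le> i \<Longrightarrow> s i \<in> borel_measurable M"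
  using sample_indep by (auto simp: indep_vars_def)

lemma sample_law_compose:
  assumes "\<phi> \<in> measurable borel N" "1 \<le> i"
  shows "distr M N (\<lambda>w. \<phi> (s i w)) = distr M N (\<lambda>w. \<phi> (obs w))"
proof -
  have "distr (distr M borel (s i)) N \<phi> = distr (distr M borel obs) N \<phi>"
    using sample_law[OF assms(2)] by (simp add: obs_def[abs_def])
  then show ?thesis
    using distr_distr[OF assms(1) s_measurable[OF assms(2)]] distr_distr[OF assms(1) obs_measurable]
    by (simp add: o_def)
qed

lemma sample_indep_compose:
  "\<phi> \<in> borel_measurable borel \<Longrightarrow> indep_vars (\<lambda>_. borel) (\<lambda>i w. \<phi> (s i w)) {1..}"
  by (rule indep_vars_compose2[OF sample_indep])

section \<open>Moments under independence of covariate and error\<close>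

lemma X_norm2_integrable: "integrable M (\<lambda>w. (norm (X w))\<^sup>2)"
  using XX_integrable by (simp add: power2_norm_eq_inner inner_vec_def)

lemma inner_X2_integrable: "integrable M (\<lambda>w. (t \<bullet> X w)\<^sup>2)"
proof (rule Bochner_Integration.integrable_bound)
  show "integrable M (\<lambda>w. (norm t)\<^sup>2 * (norm (X w))\<^sup>2)" using X_norm2_integrable by simp
  show "AE w in M. norm ((t \<bullet> X w)\<^sup>2) \<le> norm ((norm t)\<^sup>2 * (norm (X w))\<^sup>2)"
    using Cauchy_Schwarz_ineq[of t] by (simp add: power2_norm_eq_inner power_mult_distrib abs_mult)
qed simp

lemma inner_X_integrable: "integrable M (\<lambda>w. t \<bullet> X w)"
  by (rule square_integrable_imp_integrable[OF _ inner_X2_integrable]) simp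

lemma cross: "integrable M (\<lambda>w. (t \<bullet> X w) * e w)" "expectation (\<lambda>w. (t \<bullet> X w) * e w) = 0"
proof -
  have "indep_var borel (\<lambda>w. t \<bullet> X w) borel (\<lambda>w. e w)"
    by (rule independent_rvs_compose[OF indep_Xe]) auto
  then show "integrable M (\<lambda>w. (t \<bullet> X w) * e w)" "expectation (\<lambda>w. (t \<bullet> X w) * e w) = 0"
    using indep_var_integrable[OF _ inner_X_integrable e_integrable]
      indep_var_lebesgue_integral[OF _ inner_X_integrable e_integrable] mean_e by auto
qed

text \<open>Independence gives integrability of the product from second moments alone; the value is
  the variance in the central limit theorem.\<close>

lemma cross2: "integrable M (\<lambda>w. (t \<bullet> X w)\<^sup>2 * (e w)\<^sup>2)"
  "expectation (\<lambda>w. (t \<bullet> X w)\<^sup>2 * (e w)\<^sup>2) = expectation (\<lambda>w. (t \<bullet> X w)\<^sup>2) * \<sigma>\<^sup>2"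
proof -
  have "indep_var borel (\<lambda>w. (t \<bullet> X w)\<^sup>2) borel (\<lambda>w. (e w)\<^sup>2)"
    by (rule independent_rvs_compose[OF indep_Xe]) auto
  then show "integrable M (\<lambda>w. (t \<bullet> X w)\<^sup>2 * (e w)\<^sup>2)"
    "expectation (\<lambda>w. (t \<bullet> X w)\<^sup>2 * (e w)\<^sup>2) = expectation (\<lambda>w. (t \<bullet> X w)\<^sup>2) * \<sigma>\<^sup>2"
    using indep_var_integrable[OF _ inner_X2_integrable e2_integrable]
      indep_var_lebesgue_integral[OF _ inner_X2_integrable e2_integrable] e2 by auto
qed

text \<open>A factor depending on the observation only with \<open>norm (tilt \<beta> a \<zeta>)
  \<le> norm \<zeta> * envelope a\<close>, so that one law of large numbers controls the oscillation
  in \<open>\<zeta>\<close> everywhere.\<close>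

definition envelope :: "(real ^ 'd) \<times> real \<Rightarrow> real" where
  "envelope a = \<bar>resid \<beta> a\<bar> + norm (fst a) * norm \<beta>"

lemma envelope_nonneg: "0 \<le> envelope a"
  by (simp add: envelope_def)

lemma resid_measurable [measurable]: "resid \<beta> \<in> borel_measurable borel"
  unfolding resid_def[abs_def] borel_prod[symmetric] by measurable

lemma fst_measurable' [measurable]: "fst \<in> borel_measurable (borel :: ((real ^ 'd) \<times> real) measure)"
  by (rule measurable_fst_borel)

lemma envelope_measurable [measurable]: "envelope \<in> borel_measurable borel"
  unfolding envelope_def[abs_def] by measurable

lemma tilt_measurable [measurable]: "(\<lambda>a. tilt \<beta> a \<zeta>) \<in> borel_measurable borel"
  unfolding tilt_def by measurable

lemma envelope2_integrable: "integrable M (\<lambda>w. (envelope (obs w))\<^sup>2)"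
proof (rule Bochner_Integration.integrable_bound)
  show "integrable M (\<lambda>w. 2 * (e w)\<^sup>2 + 2 * (norm \<beta>)\<^sup>2 * (norm (X w))\<^sup>2)"
    using e2_integrable X_norm2_integrable by simp
  show "AE w in M. norm ((envelope (obs w))\<^sup>2) \<le> norm (2 * (e w)\<^sup>2 + 2 * (norm \<beta>)\<^sup>2 * (norm (X w))\<^sup>2)"
  proof (rule AE_I2)
    fix w
    have "0 \<le> (\<bar>e w\<bar> - norm (X w) * norm \<beta>)\<^sup>2" by simp
    then have "(\<bar>e w\<bar> + norm (X w) * norm \<beta>)\<^sup>2 \<le> 2 * (e w)\<^sup>2 + 2 * (norm \<beta>)\<^sup>2 * (norm (X w))\<^sup>2"
      unfolding power2_sum power2_diff by (simp add: power_mult_distrib mult_ac)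
    then show "norm ((envelope (obs w))\<^sup>2) \<le> norm (2 * (e w)\<^sup>2 + 2 * (norm \<beta>)\<^sup>2 * (norm (X w))\<^sup>2)"
      by (simp add: envelope_def)
  qed
qed simp

lemma lnorm_tilt_le: "lnorm p (tilt \<beta> a \<zeta>) \<le> CARD('d) * norm \<zeta> * envelope a"
proof -
  have "norm (tilt \<beta> a \<zeta>) \<le> \<bar>resid \<beta> a\<bar> * norm \<zeta> + \<bar>\<zeta> \<bullet> fst a\<bar> * norm \<beta>"
    unfolding tilt_def by (rule order_trans[OF norm_triangle_ineq4]) simp
  also have "\<dots> \<le> \<bar>resid \<beta> a\<bar> * norm \<zeta> + (norm \<zeta> * norm (fst a)) * norm \<beta>"
    by (intro add_left_mono mult_right_mono Cauchy_Schwarz_ineq2) auto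
  also have "\<dots> = norm \<zeta> * envelope a" by (simp add: envelope_def algebra_simps)
  finally have "CARD('d) * norm (tilt \<beta> a \<zeta>) \<le> CARD('d) * (norm \<zeta> * envelope a)"
    by (rule mult_left_mono) simp
  then show ?thesis
    using lnorm_le_norm[OF p_ge_1, of "tilt \<beta> a \<zeta>"] unfolding mult.assoc by linarith
qed

text \<open>A difference of squares, where linearity of the tilt in the multiplier makes the first
  factor small.\<close>

lemma lnorm_tilt_diff:
  "\<bar>(lnorm p (tilt \<beta> a \<zeta>))\<^sup>2 - (lnorm p (tilt \<beta> a \<xi>))\<^sup>2\<bar>
    \<le> (real CARD('d))\<^sup>2 * norm (\<zeta> - \<xi>) * (norm \<zeta> + norm \<xi>) * (envelope a)\<^sup>2"
proof -
  have "\<bar>(lnorm p (tilt \<beta> a \<zeta>))\<^sup>2 - (lnorm p (tilt \<beta> a \<xi>))\<^sup>2\<bar> =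
      \<bar>lnorm p (tilt \<beta> a \<zeta>) - lnorm p (tilt \<beta> a \<xi>)\<bar> * (lnorm p (tilt \<beta> a \<zeta>) + lnorm p (tilt \<beta> a \<xi>))"
    by (simp add: power2_eq_square square_diff_square_factored abs_mult lnorm_nonneg abs_of_nonneg mult.commute)
  also have "\<dots> \<le> (CARD('d) * norm (\<zeta> - \<xi>) * envelope a) *
      (CARD('d) * norm \<zeta> * envelope a + CARD('d) * norm \<xi> * envelope a)"
  proof (intro mult_mono add_mono lnorm_tilt_le)
    show "\<bar>lnorm p (tilt \<beta> a \<zeta>) - lnorm p (tilt \<beta> a \<xi>)\<bar> \<le> CARD('d) * norm (\<zeta> - \<xi>) * envelope a"
      using lnorm_diff_triangle[of "tilt \<beta> a \<zeta>" "tilt \<beta> a \<xi>"] lnorm_tilt_le[of a "\<zeta> - \<xi>"]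
      by (simp add: tilt_diff)
  qed (auto simp: envelope_nonneg intro!: add_nonneg_nonneg lnorm_nonneg)
  also have "\<dots> = (real CARD('d))\<^sup>2 * norm (\<zeta> - \<xi>) * (norm \<zeta> + norm \<xi>) * (envelope a)\<^sup>2"
    by (simp add: power2_eq_square algebra_simps)
  finally show ?thesis .
qed

lemma A_alt: "A \<zeta> = expectation (\<lambda>w. (lnorm p (tilt \<beta> (obs w) \<zeta>))\<^sup>2)"
  by (simp add: A_def tilt_obs)

lemma tilt2_integrable: "integrable M (\<lambda>w. (lnorm p (tilt \<beta> (obs w) \<zeta>))\<^sup>2)"
proof (rule Bochner_Integration.integrable_bound)
  show "integrable M (\<lambda>w. (real CARD('d))\<^sup>2 * norm \<zeta> * norm \<zeta> * (envelope (obs w))\<^sup>2)"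
    using envelope2_integrable by simp
  show "AE w in M. norm ((lnorm p (tilt \<beta> (obs w) \<zeta>))\<^sup>2) \<le>
      norm ((real CARD('d))\<^sup>2 * norm \<zeta> * norm \<zeta> * (envelope (obs w))\<^sup>2)"
  proof (rule AE_I2)
    fix w
    have "tilt \<beta> (obs w) 0 = 0" by (simp add: tilt_def)
    then show "norm ((lnorm p (tilt \<beta> (obs w) \<zeta>))\<^sup>2) \<le>
      norm ((real CARD('d))\<^sup>2 * norm \<zeta> * norm \<zeta> * (envelope (obs w))\<^sup>2)"
      using lnorm_tilt_diff[of "obs w" \<zeta> 0] by (simp add: lnorm_zero p_ge_1)
  qed
qed simp

lemma A_scaleR: "A (t *\<^sub>R \<zeta>) = t\<^sup>2 * A \<zeta>"
  unfolding A_alt by (simp add: tilt_scaleR lnorm_scaleR p_ge_1 power_mult_distrib)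

lemma A_diff:
  "\<bar>A \<zeta> - A \<xi>\<bar> \<le> (real CARD('d))\<^sup>2 * norm (\<zeta> - \<xi>) * (norm \<zeta> + norm \<xi>) * expectation (\<lambda>w. (envelope (obs w))\<^sup>2)"
proof -
  have "\<bar>A \<zeta> - A \<xi>\<bar> = \<bar>expectation (\<lambda>w. (lnorm p (tilt \<beta> (obs w) \<zeta>))\<^sup>2 - (lnorm p (tilt \<beta> (obs w) \<xi>))\<^sup>2)\<bar>"
    unfolding A_alt using tilt2_integrable by simp
  also have "\<dots> \<le> expectation (\<lambda>w. \<bar>(lnorm p (tilt \<beta> (obs w) \<zeta>))\<^sup>2 - (lnorm p (tilt \<beta> (obs w) \<xi>))\<^sup>2\<bar>)"
    by (rule integral_abs_bound)
  also have "\<dots> \<le> expectation (\<lambda>w. (real CARD('d))\<^sup>2 * norm (\<zeta> - \<xi>) * (norm \<zeta> + norm \<xi>) * (envelope (obs w))\<^sup>2)"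
    using tilt2_integrable envelope2_integrable by (intro integral_mono lnorm_tilt_diff) auto
  finally show ?thesis by simp
qed

text \<open>The coercivity constant of \<open>A\<close>. The denominator comes from replacing the
  q-norm of the multiplier by its Euclidean norm in Hoelder's inequality, which is then
  squared.\<close>

definition c :: real where "c = \<sigma>\<^sup>2 / (real CARD('d))\<^sup>2"

lemma c_pos: "0 < c"
  using \<sigma> by (simp add: c_def)

text \<open>Testing the tilt against the multiplier itself; the cross term vanishes by independence.\<close>

lemma A_lower: "c * (norm \<zeta>)\<^sup>2 \<le> A \<zeta>"
proof (cases "\<zeta> = 0")
  case False
  define b where "b = \<beta> \<bullet> \<zeta>"
  define z where "z = \<zeta> \<bullet> \<zeta>"
  have z: "z = (norm \<zeta>)\<^sup>2" "0 < z" using False by (auto simp: z_def power2_norm_eq_inner)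
  have eq: "(tilt \<beta> (obs w) \<zeta> \<bullet> \<zeta>)\<^sup>2 = z\<^sup>2 * (e w)\<^sup>2 - 2 * z * b * ((\<zeta> \<bullet> X w) * e w) + b\<^sup>2 * (\<zeta> \<bullet> X w)\<^sup>2" for w
  proof -
    have "tilt \<beta> (obs w) \<zeta> \<bullet> \<zeta> = e w * z - (\<zeta> \<bullet> X w) * b"
      by (simp add: tilt_obs inner_diff_left z_def b_def)
    then show ?thesis by (simp add: power2_diff power_mult_distrib mult_ac)
  qed
  have int: "integrable M (\<lambda>w. z\<^sup>2 * (e w)\<^sup>2)" "integrable M (\<lambda>w. 2 * z * b * ((\<zeta> \<bullet> X w) * e w))"
    "integrable M (\<lambda>w. b\<^sup>2 * (\<zeta> \<bullet> X w)\<^sup>2)"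
    using e2_integrable cross(1) inner_X2_integrable by auto
  have "z\<^sup>2 * \<sigma>\<^sup>2 \<le> z\<^sup>2 * \<sigma>\<^sup>2 - 2 * z * b * 0 + b\<^sup>2 * expectation (\<lambda>w. (\<zeta> \<bullet> X w)\<^sup>2)"
    by simp
  also have "\<dots> = expectation (\<lambda>w. (tilt \<beta> (obs w) \<zeta> \<bullet> \<zeta>)\<^sup>2)"
    unfolding eq using int by (simp add: cross(2) e2)
  also have "\<dots> \<le> expectation (\<lambda>w. (CARD('d) * norm \<zeta>)\<^sup>2 * (lnorm p (tilt \<beta> (obs w) \<zeta>))\<^sup>2)"
  proof (rule integral_mono)
    show "integrable M (\<lambda>w. (tilt \<beta> (obs w) \<zeta> \<bullet> \<zeta>)\<^sup>2)" unfolding eq using int by auto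
    show "integrable M (\<lambda>w. (CARD('d) * norm \<zeta>)\<^sup>2 * (lnorm p (tilt \<beta> (obs w) \<zeta>))\<^sup>2)"
      using tilt2_integrable by simp
    fix w
    have "\<bar>tilt \<beta> (obs w) \<zeta> \<bullet> \<zeta>\<bar> \<le> lnorm p (tilt \<beta> (obs w) \<zeta>) * (CARD('d) * norm \<zeta>)"
      using lnorm_Holder[of "tilt \<beta> (obs w) \<zeta>" \<zeta>]
        mult_left_mono[OF lnorm_le_norm[OF q_ge_1, of \<zeta>] lnorm_nonneg[of p "tilt \<beta> (obs w) \<zeta>"]] by linarith
    then have "\<bar>tilt \<beta> (obs w) \<zeta> \<bullet> \<zeta>\<bar>\<^sup>2 \<le> (lnorm p (tilt \<beta> (obs w) \<zeta>) * (CARD('d) * norm \<zeta>))\<^sup>2"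
      by (intro power_mono) auto
    then show "(tilt \<beta> (obs w) \<zeta> \<bullet> \<zeta>)\<^sup>2 \<le> (CARD('d) * norm \<zeta>)\<^sup>2 * (lnorm p (tilt \<beta> (obs w) \<zeta>))\<^sup>2"
      by (simp add: power_mult_distrib mult_ac)
  qed
  also have "\<dots> = (real CARD('d))\<^sup>2 * z * A \<zeta>" by (simp add: A_alt power_mult_distrib z)
  finally have "z * (z * \<sigma>\<^sup>2) \<le> z * ((real CARD('d))\<^sup>2 * A \<zeta>)" by (simp add: power2_eq_square mult_ac)
  then have "z * \<sigma>\<^sup>2 \<le> (real CARD('d))\<^sup>2 * A \<zeta>" using z(2) by simp
  then show ?thesis by (simp add: c_def z(1) field_simps)
qed (use A_scaleR[of 0 0] in simp)

lemma A_continuous: "continuous_on UNIV A"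
  unfolding continuous_on_def
proof
  fix x :: "real ^ 'd"
  let ?b = "\<lambda>y. (real CARD('d))\<^sup>2 * norm (y - x) * (norm y + norm x) * expectation (\<lambda>w. (envelope (obs w))\<^sup>2)"
  have "((\<lambda>y. A y - A x) \<longlongrightarrow> 0) (at x)"
  proof (rule Lim_null_comparison)
    show "\<forall>\<^sub>F y in at x. norm (A y - A x) \<le> ?b y" using A_diff by (intro always_eventually) simp
    have "(?b \<longlongrightarrow> (real CARD('d))\<^sup>2 * norm (x - x) * (norm x + norm x) * expectation (\<lambda>w. (envelope (obs w))\<^sup>2)) (at x)"
      by (intro tendsto_intros)
    then show "(?b \<longlongrightarrow> 0) (at x)" by simp
  qed
  then show "(A \<longlongrightarrow> A x) (at x within UNIV)" by (simp add: Lim_null[symmetric])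
qed

section \<open>Sample means of the squared tilt norm, uniformly in the multiplier\<close>

lemma tilt_mean_diff:
  "\<bar>tilt_mean p \<beta> n a \<zeta> - tilt_mean p \<beta> n a \<xi>\<bar> \<le>
    (real CARD('d))\<^sup>2 * norm (\<zeta> - \<xi>) * (norm \<zeta> + norm \<xi>) * ((\<Sum>i=1..n. (envelope (a i))\<^sup>2) / n)"
proof -
  have "tilt_mean p \<beta> n a \<zeta> - tilt_mean p \<beta> n a \<xi> =
      (\<Sum>i=1..n. (lnorm p (tilt \<beta> (a i) \<zeta>))\<^sup>2 - (lnorm p (tilt \<beta> (a i) \<xi>))\<^sup>2) / n"
    by (simp add: tilt_mean_def sum_subtractf diff_divide_distrib)
  then have "\<bar>tilt_mean p \<beta> n a \<zeta> - tilt_mean p \<beta> n a \<xi>\<bar> \<le>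
      (\<Sum>i=1..n. \<bar>(lnorm p (tilt \<beta> (a i) \<zeta>))\<^sup>2 - (lnorm p (tilt \<beta> (a i) \<xi>))\<^sup>2\<bar>) / n"
    by (simp add: divide_right_mono)
  also have "\<dots> \<le> (\<Sum>i=1..n. (real CARD('d))\<^sup>2 * norm (\<zeta> - \<xi>) * (norm \<zeta> + norm \<xi>) * (envelope (a i))\<^sup>2) / n"
    by (intro divide_right_mono sum_mono lnorm_tilt_diff) auto
  finally show ?thesis by (simp add: sum_distrib_left)
qed

lemma tilt_mean_scaleR: "tilt_mean p \<beta> n a (t *\<^sub>R \<zeta>) = t\<^sup>2 * tilt_mean p \<beta> n a \<zeta>"
  by (simp add: tilt_mean_def tilt_scaleR lnorm_scaleR p_ge_1 power_mult_distrib sum_distrib_left)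

lemma lln_sample:
  assumes \<phi>: "\<phi> \<in> borel_measurable borel" "\<And>a. 0 \<le> \<phi> a" "integrable M (\<lambda>w. \<phi> (obs w))" and \<epsilon>: "0 < \<epsilon>"
  shows "{w \<in> space M. \<epsilon> \<le> \<bar>(\<Sum>i=1..n. \<phi> (s i w)) / n - expectation (\<lambda>w. \<phi> (obs w))\<bar>} \<in> events"
    and "(\<lambda>n. prob {w \<in> space M. \<epsilon> \<le> \<bar>(\<Sum>i=1..n. \<phi> (s i w)) / n - expectation (\<lambda>w. \<phi> (obs w))\<bar>}) \<longlonglongrightarrow> 0"
proof -
  have m: "(\<lambda>w. \<phi> (s i w)) \<in> borel_measurable M" if "i \<in> {1..n}" for i
    using that measurable_compose[OF s_measurable \<phi>(1)] by auto
  then show "{w \<in> space M. \<epsilon> \<le> \<bar>(\<Sum>i=1..n. \<phi> (s i w)) / n - expectation (\<lambda>w. \<phi> (obs w))\<bar>} \<in> events"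
    by (intro borel_measurable_le borel_measurable_abs borel_measurable_diff borel_measurable_divide
        borel_measurable_sum borel_measurable_const) auto
  show "(\<lambda>n. prob {w \<in> space M. \<epsilon> \<le> \<bar>(\<Sum>i=1..n. \<phi> (s i w)) / n - expectation (\<lambda>w. \<phi> (obs w))\<bar>}) \<longlonglongrightarrow> 0"
    using \<phi> \<epsilon> sample_indep_compose[OF \<phi>(1)] sample_law_compose[OF \<phi>(1)]
    by (intro weak_law_of_large_numbers) auto
qed

text \<open>A finite net of the unit ball reduces uniformity to finitely many laws of large numbers,
  and the one for the squared envelope bounds the oscillation between net points. The exceptional
  set is a finite union of explicit events, so no supremum over multipliers has to be measurable.
  Coercivity turns the additive error on the sphere into a relative one.\<close>

lemma uniform_law:
  assumes \<eta>: "0 < \<eta>"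
  obtains Bad where "\<And>n. Bad n \<in> events" "(\<lambda>n. prob (Bad n)) \<longlonglongrightarrow> 0"
    "\<And>n w \<zeta>. w \<in> space M - Bad n \<Longrightarrow> \<bar>tilt_mean p \<beta> n (\<lambda>i. s i w) \<zeta> - A \<zeta>\<bar> \<le> \<eta> * A \<zeta>"
proof -
  define E where "E = expectation (\<lambda>w. (envelope (obs w))\<^sup>2)"
  have E: "0 \<le> E" by (simp add: E_def)
  \<comment> \<open>A Lipschitz constant on the unit ball for \<open>A\<close> and, off
    \<open>B0 n\<close>, for the sample mean: 2 bounds the sum of the two norms and
    \<open>E + 1\<close> the mean squared envelope.\<close>
  define k where "k = 2 * (real CARD('d))\<^sup>2 * (E + 1)"
  have k: "0 < k" using E by (simp add: k_def)
  \<comment> \<open>Three errors of size \<open>\<epsilon>\<close> add up to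
    \<open>\<eta> * c\<close>, which is at most \<open>\<eta> * A z\<close> on the unit
    sphere.\<close>
  define \<epsilon> where "\<epsilon> = \<eta> * c / 3"
  have \<epsilon>: "0 < \<epsilon>" using \<eta> c_pos by (simp add: \<epsilon>_def)
  have "seq_compact (cball (0 :: real ^ 'd) 1)" by (simp add: compact_imp_seq_compact)
  moreover have "0 < \<epsilon> / k" using \<epsilon> k by simp
  ultimately obtain F where F: "finite F" "F \<subseteq> cball (0 :: real ^ 'd) 1" "cball 0 1 \<subseteq> (\<Union>x\<in>F. ball x (\<epsilon> / k))"
    using seq_compact_imp_totally_bounded by metis
  define B0 where "B0 n = {w \<in> space M. 1 \<le> \<bar>(\<Sum>i=1..n. (envelope (s i w))\<^sup>2) / n - E\<bar>}" for n
  define B where "B \<xi> n = {w \<in> space M. \<epsilon> \<le> \<bar>(\<Sum>i=1..n. (lnorm p (tilt \<beta> (s i w) \<xi>))\<^sup>2) / n - A \<xi>\<bar>}" for \<xi> n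
  have B0: "B0 n \<in> events" for n
    unfolding B0_def E_def
    by (rule lln_sample(1)[where \<phi> = "\<lambda>a. (envelope a)\<^sup>2"]) (use envelope2_integrable in simp_all)
  have B0_lim: "(\<lambda>n. prob (B0 n)) \<longlonglongrightarrow> 0"
    unfolding B0_def E_def
    by (rule lln_sample(2)[where \<phi> = "\<lambda>a. (envelope a)\<^sup>2"]) (use envelope2_integrable in simp_all)
  have B: "B \<xi> n \<in> events" for \<xi> n
    unfolding B_def A_alt
    by (rule lln_sample(1)[where \<phi> = "\<lambda>a. (lnorm p (tilt \<beta> a \<xi>))\<^sup>2"]) (use tilt2_integrable \<epsilon> in simp_all)
  have B_lim: "(\<lambda>n. prob (B \<xi> n)) \<longlonglongrightarrow> 0" for \<xi>
    unfolding B_def A_alt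
    by (rule lln_sample(2)[where \<phi> = "\<lambda>a. (lnorm p (tilt \<beta> a \<xi>))\<^sup>2"]) (use tilt2_integrable \<epsilon> in simp_all)
  define Bad where "Bad n = B0 n \<union> (\<Union>\<xi>\<in>F. B \<xi> n)" for n
  have Bad: "Bad n \<in> events" for n 
    unfolding Bad_def by (intro sets.Un sets.finite_UN F(1) B0 B)
  moreover have "(\<lambda>n. prob (Bad n)) \<longlonglongrightarrow> 0"
  proof (rule tendsto_sandwich[of "\<lambda>_. 0"])
    have "prob (Bad n) \<le> prob (B0 n) + (\<Sum>\<xi>\<in>F. prob (B \<xi> n))" for n
    proof -
      have "prob (Bad n) \<le> prob (B0 n) + prob (\<Union>\<xi>\<in>F. B \<xi> n)"
        unfolding Bad_def by (intro measure_Un_le sets.finite_UN F(1) B0 B)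
      moreover have "prob (\<Union>\<xi>\<in>F. B \<xi> n) \<le> (\<Sum>\<xi>\<in>F. prob (B \<xi> n))"
        using F(1) B by (intro finite_measure_subadditive_finite) auto
      ultimately show ?thesis by linarith
    qed
    then show "\<forall>\<^sub>F n in sequentially. prob (Bad n) \<le> prob (B0 n) + (\<Sum>\<xi>\<in>F. prob (B \<xi> n))" by simp
    have "(\<lambda>n. prob (B0 n) + (\<Sum>\<xi>\<in>F. prob (B \<xi> n))) \<longlonglongrightarrow> 0 + (\<Sum>\<xi>\<in>F. 0)"
      by (intro tendsto_add tendsto_sum B0_lim B_lim)
    then show "(\<lambda>n. prob (B0 n) + (\<Sum>\<xi>\<in>F. prob (B \<xi> n))) \<longlonglongrightarrow> 0" by simp
  qed auto
  moreover have "\<bar>tilt_mean p \<beta> n (\<lambda>i. s i w) \<zeta> - A \<zeta>\<bar> \<le> \<eta> * A \<zeta>" if w: "w \<in> space M - Bad n" for n w \<zeta>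
  proof -
    have unit: "\<bar>tilt_mean p \<beta> n (\<lambda>i. s i w) z - A z\<bar> \<le> 3 * \<epsilon>" if z: "norm z = 1" for z
    proof -
      obtain \<xi> where \<xi>: "\<xi> \<in> F" "dist \<xi> z < \<epsilon> / k" using F(3) z by force
      have \<xi>1: "norm \<xi> \<le> 1" using F(2) \<xi>(1) by auto
      define d where "d = (real CARD('d))\<^sup>2 * norm (z - \<xi>) * (norm z + norm \<xi>)"
      have "norm (z - \<xi>) \<le> \<epsilon> / k" using \<xi>(2) by (simp add: dist_norm norm_minus_commute)
      then have "d \<le> (real CARD('d))\<^sup>2 * (\<epsilon> / k) * 2"
        unfolding d_def using z \<xi>1 \<epsilon> k by (intro mult_mono) auto
      then have "d * (E + 1) \<le> (real CARD('d))\<^sup>2 * (\<epsilon> / k) * 2 * (E + 1)"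
        using E by (intro mult_right_mono) auto
      also have "(real CARD('d))\<^sup>2 * x * 2 * (E + 1) = x * k" for x by (simp add: k_def)
      also have "\<epsilon> / k * k = \<epsilon>" using k by simp
      finally have d: "d * (E + 1) \<le> \<epsilon>" "0 \<le> d" by (auto simp: d_def)
      have "(\<Sum>i=1..n. (envelope (s i w))\<^sup>2) / n \<le> E + 1" using w by (auto simp: Bad_def B0_def)
      then have "d * ((\<Sum>i=1..n. (envelope (s i w))\<^sup>2) / n) \<le> d * (E + 1)" using d(2) by (rule mult_left_mono)
      then have "\<bar>tilt_mean p \<beta> n (\<lambda>i. s i w) z - tilt_mean p \<beta> n (\<lambda>i. s i w) \<xi>\<bar> \<le> \<epsilon>"
        using tilt_mean_diff[of n "\<lambda>i. s i w" z \<xi>] d(1) unfolding d_def by linarith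
      moreover have "d * E \<le> d * (E + 1)" using d(2) by (simp add: mult_left_mono)
      then have "\<bar>A z - A \<xi>\<bar> \<le> \<epsilon>" using A_diff[of z \<xi>] d(1) unfolding d_def E_def by linarith
      moreover have "\<bar>tilt_mean p \<beta> n (\<lambda>i. s i w) \<xi> - A \<xi>\<bar> < \<epsilon>"
        using w \<xi>(1) by (auto simp: Bad_def B_def tilt_mean_def)
      ultimately show ?thesis by linarith
    qed
    show ?thesis
    proof (cases "\<zeta> = 0")
      case True
      then show ?thesis using A_scaleR[of 0 0] tilt_mean_scaleR[of n "\<lambda>i. s i w" 0 0] by simp
    next
      case False
      define z where "z = \<zeta> /\<^sub>R norm \<zeta>"
      have \<zeta>: "\<zeta> = norm \<zeta> *\<^sub>R z" "norm z = 1" using False by (auto simp: z_def)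
      have "tilt_mean p \<beta> n (\<lambda>i. s i w) \<zeta> - A \<zeta> = (norm \<zeta>)\<^sup>2 * (tilt_mean p \<beta> n (\<lambda>i. s i w) z - A z)"
        by (subst (1 2) \<zeta>(1)) (simp only: tilt_mean_scaleR A_scaleR right_diff_distrib)
      then have "\<bar>tilt_mean p \<beta> n (\<lambda>i. s i w) \<zeta> - A \<zeta>\<bar> \<le> (norm \<zeta>)\<^sup>2 * (3 * \<epsilon>)"
        using unit[OF \<zeta>(2)] by (simp add: abs_mult mult_left_mono)
      also have "\<dots> = \<eta> * (c * (norm \<zeta>)\<^sup>2)" by (simp add: \<epsilon>_def)
      also have "\<dots> \<le> \<eta> * A \<zeta>" using \<eta> A_lower by (intro mult_left_mono) auto
      finally show ?thesis .
    qed
  qed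
  ultimately show ?thesis by (rule that)
qed

end

section \<open>Convergence of the profile function\<close>

context linear_model
begin

lemma second_moment_form: "t \<bullet> (second_moment M X *v t) = expectation (\<lambda>w. (t \<bullet> X w)\<^sup>2)"
proof -
  have sq: "(t \<bullet> X w)\<^sup>2 = (\<Sum>i\<in>UNIV. \<Sum>j\<in>UNIV. t $ i * t $ j * (X w $ i * X w $ j))" for w
    by (simp add: power2_eq_square inner_vec_def sum_product mult_ac)
  have "expectation (\<lambda>w. (t \<bullet> X w)\<^sup>2) = (\<Sum>i\<in>UNIV. \<Sum>j\<in>UNIV. t $ i * t $ j * expectation (\<lambda>w. X w $ i * X w $ j))"
    unfolding sq using XX_integrable by (simp add: Bochner_Integration.integral_sum Bochner_Integration.integrable_sum)
  then show ?thesis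
    by (simp add: second_moment_def matrix_vector_mult_def inner_vec_def sum_distrib_left mult_ac)
qed

lemma score_sum_measurable: "(\<lambda>w. score_sum \<beta> n (\<lambda>i. s i w)) \<in> borel_measurable M"
proof -
  have m: "(\<lambda>a. resid \<beta> a *\<^sub>R fst a) \<in> borel_measurable borel" by measurable
  have "(\<lambda>w. resid \<beta> (s i w) *\<^sub>R fst (s i w)) \<in> borel_measurable M" if "i \<in> {1..n}" for i
    using measurable_compose[OF s_measurable m] that by auto
  then show ?thesis unfolding score_sum_def
    by (intro borel_measurable_scaleR[OF borel_measurable_const] borel_measurable_sum)
qed

text \<open>Each projection is a normalised sum of independent copies of
  \<open>(t \<bullet> X w) * e w\<close>, centred with variance \<open>\<sigma>\<^sup>2\<close>
  times the second moment of \<open>t \<bullet> X\<close>. Zero variance is treated apart because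
  the central limit theorem divides by it.\<close>

lemma score_sum_weak_conv:
  assumes "prob_space N" and gaussian: "centered_gaussian N Z (second_moment M X)"
  shows "weak_conv_m (\<lambda>n. distr M borel (\<lambda>w. t \<bullet> score_sum \<beta> n (\<lambda>i. s i w))) (distr N borel (\<lambda>w. t \<bullet> (\<sigma> *\<^sub>R Z w)))"
proof -
  interpret N: prob_space N by fact
  have Z_m [measurable]: "Z \<in> borel_measurable N"
    and Z_law: "distr N borel (\<lambda>w. u \<bullet> Z w) = normal_law 0 (expectation (\<lambda>w. (u \<bullet> X w)\<^sup>2))" for u
    using gaussian by (auto simp: centered_gaussian_def second_moment_form)
  define v where "v = expectation (\<lambda>w. (t \<bullet> X w)\<^sup>2)"
  have v0: "0 \<le> v" by (simp add: v_def)
  define \<phi> where "\<phi> a = (t \<bullet> fst a) * resid \<beta> a" for a :: "(real ^ 'd) \<times> real"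
  have \<phi>_m: "\<phi> \<in> borel_measurable borel" unfolding \<phi>_def[abs_def] by measurable
  have \<phi>_obs: "\<phi> (obs w) = (t \<bullet> X w) * e w" for w by (simp add: \<phi>_def)
  have sum: "t \<bullet> score_sum \<beta> n (\<lambda>i. s i w) = (\<Sum>i=1..n. \<phi> (s i w)) / sqrt n" for n w
    by (simp add: score_sum_def inner_sum_right \<phi>_def divide_inverse mult_ac)
  show ?thesis
  proof (cases "v = 0")
    case True
    \<comment> \<open>In a null direction of the second moment matrix every summand vanishes almost
      surely, and the Gaussian projection is the point mass that \<open>normal_law\<close> assigns
      to variance 0.\<close>
    have "AE w in M. (t \<bullet> X w)\<^sup>2 = 0"
      using True inner_X2_integrable integral_nonneg_eq_0_iff_AE[of M "\<lambda>w. (t \<bullet> X w)\<^sup>2"] by (simp add: v_def)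
    then have "AE w in M. \<phi> (obs w) = 0" by (simp add: \<phi>_obs) auto
    then have zero: "AE w in distr M borel (\<lambda>w. \<phi> (obs w)). w = 0"
      using measurable_compose[OF obs_measurable \<phi>_m] by (subst AE_distr_iff) auto
    have "AE w in M. \<phi> (s i w) = 0" if "1 \<le> i" for i
      using zero unfolding sample_law_compose[OF \<phi>_m that, symmetric]
      by (subst (asm) AE_distr_iff) (auto intro: measurable_compose[OF s_measurable[OF that] \<phi>_m])
    then have all: "AE w in M. \<forall>i\<in>{1..n}. \<phi> (s i w) = 0" for n
      by (intro AE_finite_allI) auto
    have "AE w in M. t \<bullet> score_sum \<beta> n (\<lambda>i. s i w) = 0" for n
      using all[of n] by eventually_elim (simp add: sum sum.neutral)
    then have "distr M borel (\<lambda>w. t \<bullet> score_sum \<beta> n (\<lambda>i. s i w)) = distr M borel (\<lambda>w. 0 :: real)" for n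
      using score_sum_measurable by (intro distr_cong_AE) auto
    moreover have "distr N borel (\<lambda>w. t \<bullet> (\<sigma> *\<^sub>R Z w)) = return borel (0 :: real)"
    proof -
      have "distr N borel (\<lambda>w. t \<bullet> (\<sigma> *\<^sub>R Z w)) = distr (distr N borel (\<lambda>w. t \<bullet> Z w)) borel (\<lambda>x. \<sigma> * x)"
        by (subst distr_distr) (auto simp: o_def)
      then show ?thesis
        using True by (simp add: Z_law v_def[symmetric] normal_law_def distr_return)
    qed
    ultimately show ?thesis
      by (simp add: weak_conv_m_def weak_conv_def)
  next
    case False
    then have v: "0 < v" using v0 by simp
    define \<kappa> where "\<kappa> = \<sigma> * sqrt v"
    have \<kappa>: "0 < \<kappa>" "\<kappa>\<^sup>2 = \<sigma>\<^sup>2 * v" using v \<sigma> by (auto simp: \<kappa>_def power_mult_distrib)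
    define U where "U w = (1 / sqrt v) * (t \<bullet> Z w)" for w
    define T where "T n w = (\<Sum>i<n. \<phi> (s (Suc i) w)) / sqrt (real n * \<kappa>\<^sup>2)" for n w
    have transfer: "integral\<^sup>L M (\<lambda>w. h (\<phi> (s (Suc i) w))) = integral\<^sup>L M (\<lambda>w. h (\<phi> (obs w)))"
      "integrable M (\<lambda>w. h (\<phi> (s (Suc i) w))) \<longleftrightarrow> integrable M (\<lambda>w. h (\<phi> (obs w)))"
      if [measurable]: "h \<in> borel_measurable borel" for h :: "real \<Rightarrow> real" and i
    proof -
      have m: "(\<lambda>w. \<phi> (s (Suc i) w)) \<in> borel_measurable M" "(\<lambda>w. \<phi> (obs w)) \<in> borel_measurable M"
        using measurable_compose[OF s_measurable \<phi>_m] measurable_compose[OF obs_measurable \<phi>_m] by auto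
      show "integral\<^sup>L M (\<lambda>w. h (\<phi> (s (Suc i) w))) = integral\<^sup>L M (\<lambda>w. h (\<phi> (obs w)))"
        using integral_distr[OF m(1) that] integral_distr[OF m(2) that] sample_law_compose[OF \<phi>_m, of "Suc i"] by simp
      show "integrable M (\<lambda>w. h (\<phi> (s (Suc i) w))) \<longleftrightarrow> integrable M (\<lambda>w. h (\<phi> (obs w)))"
        using integrable_distr_eq[OF m(1) that] integrable_distr_eq[OF m(2) that] sample_law_compose[OF \<phi>_m, of "Suc i"] by simp
    qed
    have mean: "expectation (\<lambda>w. \<phi> (s (Suc i) w)) = 0" for i
      using transfer(1)[of "\<lambda>x. x" i] cross(2)[of t] by (simp add: \<phi>_obs)
    have square: "integrable M (\<lambda>w. (\<phi> (s (Suc i) w))\<^sup>2)" "expectation (\<lambda>w. (\<phi> (s (Suc i) w))\<^sup>2) = \<kappa>\<^sup>2" for i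
      using transfer[of "\<lambda>x. x\<^sup>2" i] cross2[of t] by (auto simp: \<phi>_obs power_mult_distrib \<kappa>(2) v_def mult.commute)
    have "weak_conv_m (\<lambda>n. distr M borel (\<lambda>x. (\<Sum>i<n. \<phi> (s (Suc i) x)) / sqrt (real n * \<kappa>\<^sup>2))) std_normal_distribution"
    proof (rule central_limit_theorem_zero_mean[where \<mu> = "distr M borel (\<lambda>w. \<phi> (obs w))"])
      show "indep_vars (\<lambda>i. borel) (\<lambda>i w. \<phi> (s (Suc i) w)) UNIV"
        using indep_vars_Suc[OF sample_indep_compose[OF \<phi>_m]] .
      show "variance (\<lambda>w. \<phi> (s (Suc n) w)) = \<kappa>\<^sup>2" for n by (simp add: mean square(2))
      show "distr M borel (\<lambda>w. \<phi> (s (Suc n) w)) = distr M borel (\<lambda>w. \<phi> (obs w))" for n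
        by (rule sample_law_compose[OF \<phi>_m]) simp
    qed (use \<kappa> mean square in auto)
    moreover have "distr N borel U = std_normal_distribution"
    proof -
      have "distr N borel U = distr N borel (\<lambda>w. ((1 / sqrt v) *\<^sub>R t) \<bullet> Z w)"
        by (simp add: U_def[abs_def])
      also have "\<dots> = normal_law 0 (expectation (\<lambda>w. (((1 / sqrt v) *\<^sub>R t) \<bullet> X w)\<^sup>2))" by (rule Z_law)
      also have "expectation (\<lambda>w. (((1 / sqrt v) *\<^sub>R t) \<bullet> X w)\<^sup>2) = 1"
        using v by (simp add: power_divide v_def[symmetric])
      finally show ?thesis by (simp add: normal_law_def)
    qed
    ultimately have "weak_conv_m (\<lambda>n. distr M borel (T n)) (distr N borel U)"
      by (simp add: T_def[abs_def])
    moreover have "T n \<in> borel_measurable M" for n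
      unfolding T_def[abs_def] using measurable_compose[OF s_measurable \<phi>_m]
      by (intro borel_measurable_divide borel_measurable_sum) auto
    moreover have "U \<in> borel_measurable N" unfolding U_def[abs_def] by measurable
    ultimately have "weak_conv_m (\<lambda>n. distr M borel (\<lambda>w. \<kappa> * T n w)) (distr N borel (\<lambda>w. \<kappa> * U w))"
      by (intro weak_conv_m_scale prob_space_axioms N.prob_space_axioms)
    moreover have "\<kappa> * T n w = t \<bullet> score_sum \<beta> n (\<lambda>i. s i w)" for n w
    proof -
      have "(\<Sum>i<n. \<phi> (s (Suc i) w)) = (\<Sum>i=1..n. \<phi> (s i w))"
        by (rule sum.reindex_bij_witness[of _ "\<lambda>i. i - 1" Suc]) auto
      then show ?thesis
        using \<kappa>(1) by (simp add: T_def sum real_sqrt_mult)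
    qed
    moreover have "\<kappa> * U w = t \<bullet> (\<sigma> *\<^sub>R Z w)" for w
      using v by (simp add: \<kappa>_def U_def)
    ultimately show ?thesis by simp
  qed
qed

text \<open>At \<open>n = 0\<close> the factor \<open>n\<close> makes the variable constantly 0,
  whatever the profile of the degenerate empirical measure is.\<close>

lemma scaled_profile_measurable:
  "(\<lambda>w. n * enn2real (profile q (empirical n (\<lambda>i. s i w)) \<beta>)) \<in> borel_measurable M"
proof (cases "n = 0")
  case False
  then have [measurable]: "(\<lambda>w. profile q (empirical n (\<lambda>i. s i w)) \<beta>) \<in> borel_measurable M"
    using s_measurable by (intro measurable_profile_empirical) auto
  show ?thesis by measurable
qed simp

lemma quad_sup_A_le: "quad_sup A z \<le> (norm z)\<^sup>2 / c"
  unfolding quad_sup_def using quad_le[OF c_pos A_lower] by (intro cSUP_least) auto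

lemma sandwich_close:
  assumes \<eta>: "0 < \<eta>" "\<eta> \<le> 1 / 2" and Q: "0 \<le> Q"
    and R: "(1 - \<eta>) / (1 + \<eta>) * Q \<le> R" "R \<le> Q / (1 - \<eta>)\<^sup>2"
  shows "\<bar>R - Q\<bar> \<le> 8 * \<eta> * (Q :: real)"
proof -
  have "1 - 2 * \<eta> \<le> (1 - \<eta>) / (1 + \<eta>)"
    using \<eta> by (simp add: le_divide_eq algebra_simps)
  then have "(1 - 2 * \<eta>) * Q \<le> R" using R(1) mult_right_mono[OF _ Q] order_trans by blast
  moreover have "R \<le> (1 + 8 * \<eta>) * Q"
  proof -
    \<comment> \<open>This is \<open>(1 + 8 * \<eta>) * (1 - \<eta>)\<^sup>2 - 1\<close>, arranged
      so that every factor is visibly nonnegative for \<open>\<eta> \<le> 1 / 2\<close>.\<close>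
    have "0 \<le> \<eta> * ((1 / 2 - \<eta>) * (11 - 8 * \<eta>) + 1 / 2)"
      using \<eta> by (intro mult_nonneg_nonneg add_nonneg_nonneg) auto
    also have "\<dots> = (1 + 8 * \<eta>) * (1 - \<eta>)\<^sup>2 - 1"
      by (simp add: power2_eq_square algebra_simps)
    finally have "1 / (1 - \<eta>)\<^sup>2 \<le> 1 + 8 * \<eta>" using \<eta> by (simp add: divide_le_eq)
    then show ?thesis using R(2) mult_right_mono[OF _ Q, of "1 / (1 - \<eta>)\<^sup>2"] by fastforce
  qed
  moreover have "0 \<le> \<eta> * Q" using \<eta> Q by simp
  ultimately show ?thesis by (simp add: algebra_simps abs_le_iff)
qed

text \<open>Continuity of the conjugate and the limit theorem for the score sum settle the
  convergence of \<open>quad_sup A (S n w)\<close>. What remains is a Slutsky argument: against a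
  uniformly continuous step function, the scaled profile and this variable have asymptotically equal
  expectations.\<close>

proposition profile_weak_conv:
  assumes "prob_space N" and gaussian: "centered_gaussian N Z (second_moment M X)"
  shows "weak_conv_m (\<lambda>n. distr M borel (\<lambda>w. n * enn2real (profile q (empirical n (\<lambda>i. s i w)) \<beta>)))
    (distr N borel (\<lambda>w. quad_sup A (\<sigma> *\<^sub>R Z w)))"
proof -
  interpret N: prob_space N by fact
  have Z_m [measurable]: "Z \<in> borel_measurable N" using gaussian by (simp add: centered_gaussian_def)
  define S where "S n w = score_sum \<beta> n (\<lambda>i. s i w)" for n w
  define R where "R n w = n * enn2real (profile q (empirical n (\<lambda>i. s i w)) \<beta>)" for n :: nat and w
  have S_m [measurable]: "S n \<in> borel_measurable M" for n
    unfolding S_def[abs_def] by (rule score_sum_measurable)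
  have R_m [measurable]: "R n \<in> borel_measurable M" for n
    unfolding R_def[abs_def] by (rule scaled_profile_measurable)
  have q_cont: "continuous_on UNIV (quad_sup A)" by (rule quad_sup_continuous[OF c_pos A_lower])
  have [measurable]: "quad_sup A \<in> borel_measurable borel" using q_cont by (rule borel_measurable_continuous_onI)
  have clt: "(\<lambda>n. \<integral>w. f (S n w) \<partial>M) \<longlonglongrightarrow> (\<integral>w. f (\<sigma> *\<^sub>R Z w) \<partial>N)"
    if "continuous_on UNIV f" "\<And>x. \<bar>f x\<bar> \<le> B" for f :: "real ^ 'd \<Rightarrow> real" and B
    using score_sum_weak_conv[OF assms] that unfolding S_def[symmetric]
    by (intro Cramer_Wold prob_space_axioms N.prob_space_axioms) auto
  have "weak_conv_m (\<lambda>n. distr M borel (R n)) (distr N borel (\<lambda>w. quad_sup A (\<sigma> *\<^sub>R Z w)))"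
  proof (rule integral_cts_step_conv_imp_weak_conv)
    fix x y :: real assume xy: "x < y"
    let ?g = "cts_step x y"
    have g_unif: "uniformly_continuous_on UNIV ?g" by (rule cts_step_uniformly_continuous[OF xy])
    have g_cont: "continuous_on UNIV ?g" by (rule uniformly_continuous_imp_continuous[OF g_unif])
    have [measurable]: "?g \<in> borel_measurable borel" using g_cont by (rule borel_measurable_continuous_onI)
    have g_bounds: "0 \<le> ?g u" "?g u \<le> 1" for u using xy by (auto simp: cts_step_def)
    have g_int: "integrable M (\<lambda>w. ?g (h w))" if [measurable]: "h \<in> borel_measurable M" for h
      using g_bounds by (intro integrable_const_bound[of _ 1]) auto
    have "(\<lambda>n. \<integral>w. ?g (quad_sup A (S n w)) \<partial>M) \<longlonglongrightarrow> (\<integral>w. ?g (quad_sup A (\<sigma> *\<^sub>R Z w)) \<partial>N)"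
      using g_bounds
      by (intro clt[of "\<lambda>z. ?g (quad_sup A z)" 1] continuous_on_compose2[OF g_cont q_cont]) (auto simp: abs_le_iff intro: order_trans[of _ 0])
    moreover have "(\<lambda>n. (\<integral>w. ?g (R n w) \<partial>M) - (\<integral>w. ?g (quad_sup A (S n w)) \<partial>M)) \<longlonglongrightarrow> 0"
    proof (rule LIMSEQ_I)
      fix r :: real assume "0 < r"
      define \<epsilon> where "\<epsilon> = r / 3"
      have \<epsilon>: "0 < \<epsilon>" using \<open>0 < r\<close> by (simp add: \<epsilon>_def)
      have ex_cont: "continuous_on UNIV (\<lambda>z::real ^ 'd. excess k (norm z))" for k
        by (intro continuous_intros continuous_on_compose2[OF continuous_on_excess]) auto
      have [measurable]: "excess k \<in> borel_measurable borel" for k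
        using continuous_on_excess by (rule borel_measurable_continuous_onI)
      have "(\<lambda>k. \<integral>w. excess (real k) (norm (\<sigma> *\<^sub>R Z w)) \<partial>N) \<longlonglongrightarrow> (\<integral>w. 0 \<partial>N)"
      proof (rule integral_dominated_convergence[where w = "\<lambda>_. 1"])
        have "(\<lambda>k. excess (real k) (norm z)) \<longlonglongrightarrow> 0" for z :: "real ^ 'd"
          by (rule tendsto_eventually, rule eventually_sequentiallyI[of "nat \<lceil>norm z\<rceil>"]) (simp add: excess_def)
        then show "AE w in N. (\<lambda>k. excess (real k) (norm (\<sigma> *\<^sub>R Z w))) \<longlonglongrightarrow> 0" by blast
      qed (auto simp: excess_bounds)
      then have "\<forall>\<^sub>F k in sequentially. (\<integral>w. excess (real k) (norm (\<sigma> *\<^sub>R Z w)) \<partial>N) < \<epsilon>"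
        using \<epsilon> by (intro order_tendstoD) auto
      then obtain k :: nat where k: "(\<integral>w. excess (real k) (norm (\<sigma> *\<^sub>R Z w)) \<partial>N) < \<epsilon>"
        by (auto simp: eventually_sequentially)
      have "(\<lambda>n. \<integral>w. excess (real k) (norm (S n w)) \<partial>M) \<longlonglongrightarrow> (\<integral>w. excess (real k) (norm (\<sigma> *\<^sub>R Z w)) \<partial>N)"
        by (rule clt[OF ex_cont, of _ 1]) (simp add: excess_bounds)
      then have tight: "\<forall>\<^sub>F n in sequentially. (\<integral>w. excess (real k) (norm (S n w)) \<partial>M) < \<epsilon>"
        using k by (rule order_tendstoD)
      define L where "L = real k + 1"
      have L: "0 < L" by (simp add: L_def)
      obtain d where d: "0 < d" "\<And>u v. dist u v < d \<Longrightarrow> dist (?g u) (?g v) < \<epsilon>"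
        using g_unif \<epsilon> unfolding uniformly_continuous_on_def by (metis UNIV_I)
      \<comment> \<open>On \<open>norm (S n w) \<le> L\<close> the conjugate is at most
        \<open>L\<^sup>2 / c\<close>, so the relative error \<open>8 * \<eta>\<close> amounts to at
        most \<open>d / 2\<close>.\<close>
      define \<eta> where "\<eta> = min (1 / 2) (d * c / (16 * L\<^sup>2))"
      have \<eta>: "0 < \<eta>" "\<eta> \<le> 1 / 2" using d c_pos L by (auto simp: \<eta>_def)
      have \<eta>d: "8 * \<eta> * (L\<^sup>2 / c) < d"
      proof -
        have "8 * \<eta> * (L\<^sup>2 / c) \<le> 8 * (d * c / (16 * L\<^sup>2)) * (L\<^sup>2 / c)"
          using c_pos L by (intro mult_right_mono mult_left_mono) (auto simp: \<eta>_def)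
        also have "\<dots> = d / 2" using c_pos L by simp
        finally show ?thesis using d(1) by simp
      qed
      obtain Bad where Bad: "\<And>n. Bad n \<in> events" "(\<lambda>n. prob (Bad n)) \<longlonglongrightarrow> 0"
        "\<And>n w \<zeta>. w \<in> space M - Bad n \<Longrightarrow> \<bar>tilt_mean p \<beta> n (\<lambda>i. s i w) \<zeta> - A \<zeta>\<bar> \<le> \<eta> * A \<zeta>"
        by (rule uniform_law[OF \<eta>(1)]) (rule that)
      have few: "\<forall>\<^sub>F n in sequentially. prob (Bad n) < \<epsilon>"
        using Bad(2) \<epsilon> by (rule order_tendstoD)
      have "(\<lambda>n. 2 * lnorm p \<beta> * (real CARD('d) * (8 * L / c + 1)) / sqrt (real n)) \<longlonglongrightarrow> 0"
        by (rule tendsto_divide_0[OF tendsto_const], rule filterlim_at_top_imp_at_infinity,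
            rule filterlim_compose[OF sqrt_at_top filterlim_real_sequentially])
      then have large: "\<forall>\<^sub>F n in sequentially. 2 * lnorm p \<beta> * (real CARD('d) * (8 * L / c + 1)) / sqrt (real n) < \<eta>"
        using \<eta>(1) by (rule order_tendstoD)
      have "\<forall>\<^sub>F n in sequentially. norm ((\<integral>w. ?g (R n w) \<partial>M) - (\<integral>w. ?g (quad_sup A (S n w)) \<partial>M) - 0) < r"
        using tight few large eventually_gt_at_top[of 0]
      proof eventually_elim
        case (elim n)
        \<comment> \<open>The step function takes values between 0 and 1, so an exceptional point
          costs at most 1; on such points the indicator or the excess already equals 1.\<close>
        have point: "\<bar>?g (R n w) - ?g (quad_sup A (S n w))\<bar> \<le> \<epsilon> + indicator (Bad n) w + excess k (norm (S n w))"
          if w: "w \<in> space M" for w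
        proof (cases "w \<in> Bad n \<or> L \<le> norm (S n w)")
          case True
          have "\<bar>?g (R n w) - ?g (quad_sup A (S n w))\<bar> \<le> 1"
            using g_bounds[of "R n w"] g_bounds[of "quad_sup A (S n w)"] by linarith
          moreover have "1 \<le> indicator (Bad n) w + excess k (norm (S n w))"
            using True excess_bounds(1)[of k "norm (S n w)"] by (auto simp: indicator_def excess_def L_def)
          ultimately show ?thesis using \<epsilon> by linarith
        next
          case False
          then have lln: "\<bar>tilt_mean p \<beta> n (\<lambda>i. s i w) \<zeta> - A \<zeta>\<bar> \<le> \<eta> * A \<zeta>" for \<zeta>
            using Bad(3) w by blast
          have close: "(1 - \<eta>) * A \<zeta> \<le> tilt_mean p \<beta> n (\<lambda>i. s i w) \<zeta>"
            "tilt_mean p \<beta> n (\<lambda>i. s i w) \<zeta> \<le> (1 + \<eta>) * A \<zeta>" for \<zeta>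
            using lln[of \<zeta>] by (auto simp: algebra_simps abs_le_iff)
          have norm_S: "norm (S n w) \<le> L" using False by simp
          have "(1 - \<eta>) / (1 + \<eta>) * quad_sup A (S n w) \<le> R n w" "R n w \<le> quad_sup A (S n w) / (1 - \<eta>)\<^sup>2"
            unfolding S_def R_def using norm_S elim(3)
            by (intro profile_sandwich[OF elim(4) c_pos A_lower A_scaleR \<eta> close, of L]; simp add: S_def)+
          then have "\<bar>R n w - quad_sup A (S n w)\<bar> \<le> 8 * \<eta> * quad_sup A (S n w)"
            using A_scaleR[of 0 0] by (intro sandwich_close \<eta> quad_sup_nonneg[OF c_pos A_lower]) auto
          also have "\<dots> \<le> 8 * \<eta> * (L\<^sup>2 / c)"
          proof (intro mult_left_mono)
            have "(norm (S n w))\<^sup>2 / c \<le> L\<^sup>2 / c" using norm_S c_pos by (intro divide_right_mono power_mono) auto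
            then show "quad_sup A (S n w) \<le> L\<^sup>2 / c" using quad_sup_A_le order_trans by blast
          qed (use \<eta> in simp)
          finally have "dist (R n w) (quad_sup A (S n w)) < d" using \<eta>d by (simp add: dist_real_def)
          then have "\<bar>?g (R n w) - ?g (quad_sup A (S n w))\<bar> < \<epsilon>" using d(2) by (simp add: dist_real_def)
          moreover have "0 \<le> indicator (Bad n) w + excess k (norm (S n w))"
            by (simp add: excess_bounds)
          ultimately show ?thesis by linarith
        qed
        have ex_int: "integrable M (\<lambda>w. excess k (norm (S n w)))"
          by (intro integrable_const_bound[of _ 1]) (auto simp: excess_bounds)
        have ind_int: "integrable M (\<lambda>w. indicator (Bad n) w :: real)"
          using Bad(1) by (simp add: integrable_indicator_iff emeasure_eq_measure)
        have "\<bar>(\<integral>w. ?g (R n w) \<partial>M) - (\<integral>w. ?g (quad_sup A (S n w)) \<partial>M)\<bar> =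
            \<bar>\<integral>w. ?g (R n w) - ?g (quad_sup A (S n w)) \<partial>M\<bar>"
          using g_int by simp
        also have "\<dots> \<le> (\<integral>w. \<bar>?g (R n w) - ?g (quad_sup A (S n w))\<bar> \<partial>M)" by (rule integral_abs_bound)
        also have "\<dots> \<le> (\<integral>w. \<epsilon> + indicator (Bad n) w + excess k (norm (S n w)) \<partial>M)"
          using point g_int ex_int ind_int by (intro integral_mono) auto
        also have "\<dots> = \<epsilon> + prob (Bad n) + (\<integral>w. excess k (norm (S n w)) \<partial>M)"
          using ex_int ind_int Bad(1) by (simp add: prob_space)
        also have "\<dots> < r" using elim(1,2) by (simp add: \<epsilon>_def)
        finally show ?case by simp
      qed
      then show "\<exists>m. \<forall>n\<ge>m. norm ((\<integral>w. ?g (R n w) \<partial>M) - (\<integral>w. ?g (quad_sup A (S n w)) \<partial>M) - 0) < r"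
        by (simp add: eventually_sequentially)
    qed
    ultimately have "(\<lambda>n. \<integral>w. ?g (R n w) \<partial>M) \<longlonglongrightarrow> (\<integral>w. ?g (quad_sup A (\<sigma> *\<^sub>R Z w)) \<partial>N)"
      by (rule Lim_transform)
    then show "(\<lambda>n. integral\<^sup>L (distr M borel (R n)) ?g) \<longlonglongrightarrow>
        integral\<^sup>L (distr N borel (\<lambda>w. quad_sup A (\<sigma> *\<^sub>R Z w))) ?g"
      by (simp add: integral_distr)
  qed auto
  then show ?thesis by (simp add: R_def[abs_def])
qed

end

section \<open>The limit and its upper bounds\<close>

context linear_model
begin

lemma L1_objective_eq: "L1_objective M X e \<beta> \<sigma> p z \<xi> = 2 * (\<xi> \<bullet> (\<sigma> *\<^sub>R z)) - A \<xi>"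
  by (simp add: L1_objective_def A_def)

lemma L1_eq: "L1 M X e \<beta> \<sigma> p z = quad_sup A (\<sigma> *\<^sub>R z)"
  unfolding L1_def quad_sup_def L1_objective_eq ..

text \<open>By coercivity the objective is at most 0, its value at the origin, outside the ball of
  radius \<open>2 * norm u / c\<close>; inside, a continuous function on a compact set attains its
  maximum.\<close>

lemma L1_objective_attains_max:
  "\<exists>\<xi>. \<forall>\<xi>'. L1_objective M X e \<beta> \<sigma> p z \<xi>' \<le> L1_objective M X e \<beta> \<sigma> p z \<xi>"
proof -
  define u where "u = \<sigma> *\<^sub>R z"
  define f where "f \<xi> = 2 * (\<xi> \<bullet> u) - A \<xi>" for \<xi>
  define K where "K = 2 * norm u / c"
  have K: "0 \<le> K" using c_pos by (simp add: K_def)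
  have A0: "A 0 = 0" using A_scaleR[of 0 0] by simp
  have "continuous_on (cball 0 K) f"
    unfolding f_def by (intro continuous_intros continuous_on_subset[OF A_continuous]) auto
  then obtain \<xi> where \<xi>: "\<xi> \<in> cball 0 K" "\<And>y. y \<in> cball 0 K \<Longrightarrow> f y \<le> f \<xi>"
    using continuous_attains_sup[of "cball 0 K" f] K by (metis compact_cball cball_eq_empty not_less)
  have "f y \<le> f \<xi>" for y
  proof (cases "norm y \<le> K")
    case False
    have "f y \<le> norm y * (2 * norm u - c * norm y)"
      using norm_cauchy_schwarz[of y u] A_lower[of y] by (simp add: f_def power2_eq_square algebra_simps)
    also have "\<dots> \<le> 0"
      using False c_pos by (intro mult_nonneg_nonpos) (auto simp: K_def field_simps)
    also have "0 \<le> f \<xi>" using \<xi>(2)[of 0] K by (simp add: f_def A0)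
    finally show ?thesis .
  qed (use \<xi>(2) in simp)
  then show ?thesis unfolding L1_objective_eq f_def u_def by blast
qed

section \<open>Upper bounds for the limit\<close>

lemma abs_e_integrable: "integrable M (\<lambda>w. \<bar>e w\<bar>)"
  using e_integrable by simp

lemma abs_e_moment_le: "(expectation (\<lambda>w. \<bar>e w\<bar>))\<^sup>2 \<le> expectation (\<lambda>w. (e w)\<^sup>2)"
  using variance_eq[OF abs_e_integrable] variance_positive[of "\<lambda>w. \<bar>e w\<bar>"] e2_integrable by simp

text \<open>The reverse triangle inequality bounds the norm of the tilt below by the distance
  between \<open>|e| * a\<close> and \<open>|\<xi> \<bullet> X| * b\<close>. Independence factors
  the cross term, Jensen's inequality gives \<open>k1\<^sup>2 \<le> k2\<close>, and dropping the
  square of \<open>a * m1 - b * k1\<close> leaves the variance of \<open>|e|\<close> times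
  \<open>a\<^sup>2\<close>.\<close>

lemma A_ge_abs_variance:
  "(expectation (\<lambda>w. (e w)\<^sup>2) - (expectation (\<lambda>w. \<bar>e w\<bar>))\<^sup>2) * (lnorm p \<xi>)\<^sup>2 \<le> A \<xi>"
proof -
  define a b where "a = lnorm p \<xi>" and "b = lnorm p \<beta>"
  define m1 m2 where "m1 = expectation (\<lambda>w. \<bar>e w\<bar>)" and "m2 = expectation (\<lambda>w. (e w)\<^sup>2)"
  define k1 k2 where "k1 = expectation (\<lambda>w. \<bar>\<xi> \<bullet> X w\<bar>)" and "k2 = expectation (\<lambda>w. (\<xi> \<bullet> X w)\<^sup>2)"
  have abs_X: "integrable M (\<lambda>w. \<bar>\<xi> \<bullet> X w\<bar>)" using inner_X_integrable by simp
  have k: "k1\<^sup>2 \<le> k2"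
    using variance_eq[OF abs_X] variance_positive[of "\<lambda>w. \<bar>\<xi> \<bullet> X w\<bar>"] inner_X2_integrable by (simp add: k1_def k2_def)
  have "indep_var borel (\<lambda>w. \<bar>\<xi> \<bullet> X w\<bar>) borel (\<lambda>w. \<bar>e w\<bar>)"
    by (rule independent_rvs_compose[OF indep_Xe]) auto
  note prod = indep_var_integrable[OF this abs_X abs_e_integrable] indep_var_lebesgue_integral[OF this abs_X abs_e_integrable]
  have int: "integrable M (\<lambda>w. a\<^sup>2 * (e w)\<^sup>2)" "integrable M (\<lambda>w. 2 * a * b * (\<bar>\<xi> \<bullet> X w\<bar> * \<bar>e w\<bar>))"
    "integrable M (\<lambda>w. b\<^sup>2 * (\<xi> \<bullet> X w)\<^sup>2)"
    using e2_integrable prod(1) inner_X2_integrable by auto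
  have "b\<^sup>2 * k1\<^sup>2 \<le> b\<^sup>2 * k2" using k by (rule mult_left_mono) simp
  moreover have "0 \<le> (a * m1 - b * k1)\<^sup>2" by simp
  ultimately have "(m2 - m1\<^sup>2) * a\<^sup>2 \<le> a\<^sup>2 * m2 - 2 * a * b * (k1 * m1) + b\<^sup>2 * k2"
    by (simp add: power2_eq_square algebra_simps)
  also have "\<dots> = expectation (\<lambda>w. a\<^sup>2 * (e w)\<^sup>2 - 2 * a * b * (\<bar>\<xi> \<bullet> X w\<bar> * \<bar>e w\<bar>) + b\<^sup>2 * (\<xi> \<bullet> X w)\<^sup>2)"
    using int by (simp add: prod(2) m1_def m2_def k1_def k2_def)
  also have "\<dots> \<le> A \<xi>"
    unfolding A_alt
  proof (intro integral_mono tilt2_integrable)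
    show "integrable M (\<lambda>w. a\<^sup>2 * (e w)\<^sup>2 - 2 * a * b * (\<bar>\<xi> \<bullet> X w\<bar> * \<bar>e w\<bar>) + b\<^sup>2 * (\<xi> \<bullet> X w)\<^sup>2)"
      using int by auto
    fix w
    have "\<bar>\<bar>e w\<bar> * a - \<bar>\<xi> \<bullet> X w\<bar> * b\<bar> \<le> lnorm p (tilt \<beta> (obs w) \<xi>)"
      using lnorm_diff_triangle[of "e w *\<^sub>R \<xi>" "(\<xi> \<bullet> X w) *\<^sub>R \<beta>"]
      by (simp add: tilt_obs lnorm_scaleR p_ge_1 a_def b_def)
    then have "\<bar>\<bar>e w\<bar> * a - \<bar>\<xi> \<bullet> X w\<bar> * b\<bar>\<^sup>2 \<le> (lnorm p (tilt \<beta> (obs w) \<xi>))\<^sup>2"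
      by (intro power_mono) auto
    then show "a\<^sup>2 * (e w)\<^sup>2 - 2 * a * b * (\<bar>\<xi> \<bullet> X w\<bar> * \<bar>e w\<bar>) + b\<^sup>2 * (\<xi> \<bullet> X w)\<^sup>2 \<le> (lnorm p (tilt \<beta> (obs w) \<xi>))\<^sup>2"
      by (simp add: power2_diff power_mult_distrib mult_ac)
  qed
  finally show ?thesis by (simp add: m1_def m2_def a_def)
qed

text \<open>Pointwise in \<open>z\<close>: Hoelder's inequality leaves
  \<open>2 * \<sigma> * a * t - v * a\<^sup>2\<close> with \<open>a\<close> the p-norm of the
  multiplier and \<open>t\<close> the q-norm of \<open>z\<close>, and completing the square in
  \<open>a\<close> bounds this by \<open>\<sigma>\<^sup>2 / v * t\<^sup>2\<close>.\<close>

lemma L1_le: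
  assumes "expectation (\<lambda>w. (e w)\<^sup>2) \<noteq> (expectation (\<lambda>w. \<bar>e w\<bar>))\<^sup>2"
  shows "L1 M X e \<beta> \<sigma> p z \<le> expectation (\<lambda>w. (e w)\<^sup>2) /
    (expectation (\<lambda>w. (e w)\<^sup>2) - (expectation (\<lambda>w. \<bar>e w\<bar>))\<^sup>2) * (lnorm q z)\<^sup>2"
proof -
  define v where "v = expectation (\<lambda>w. (e w)\<^sup>2) - (expectation (\<lambda>w. \<bar>e w\<bar>))\<^sup>2"
  have v: "0 < v" using assms abs_e_moment_le by (simp add: v_def)
  have "2 * (\<xi> \<bullet> (\<sigma> *\<^sub>R z)) - A \<xi> \<le> \<sigma>\<^sup>2 / v * (lnorm q z)\<^sup>2" for \<xi>
  proof -
    define a t where "a = lnorm p \<xi>" and "t = lnorm q z"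
    have "\<xi> \<bullet> z \<le> a * t" using lnorm_Holder[of \<xi> z] by (simp add: a_def t_def abs_le_iff)
    then have "\<sigma> * (\<xi> \<bullet> z) \<le> \<sigma> * (a * t)" using \<sigma> by simp
    moreover have "v * a\<^sup>2 \<le> A \<xi>" using A_ge_abs_variance[of \<xi>] by (simp add: v_def a_def)
    moreover have "0 \<le> (v * a - \<sigma> * t)\<^sup>2 / v" using v by simp
    then have "2 * (\<sigma> * (a * t)) - v * a\<^sup>2 \<le> \<sigma>\<^sup>2 / v * t\<^sup>2"
      using v by (simp add: field_simps power2_eq_square)
    ultimately show ?thesis by (simp add: t_def)
  qed
  then show ?thesis
    unfolding L1_eq quad_sup_def e2[symmetric] v_def by (intro cSUP_least) auto
qed

lemma abs_moment_normal:
  assumes "distributed M lborel e (normal_density 0 \<sigma>)"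
  shows "expectation (\<lambda>w. \<bar>e w\<bar>) = \<sigma> * sqrt (2 / pi)"
proof -
  have "expectation (\<lambda>w. \<bar>e w\<bar>) = (\<integral>x. normal_density 0 \<sigma> x * \<bar>x\<bar> \<partial>lborel)"
    by (rule distributed_integral[OF assms, symmetric]) auto
  also have "\<dots> = \<sigma> * sqrt (2 / pi)"
    using integral_normal_moment_abs_odd[OF \<sigma>, of 0 0] by simp
  finally show ?thesis .
qed

end

text \<open>Both variables live on one space, so pointwise domination is inclusion of superlevel
  sets.\<close>

lemma stoch_leI:
  assumes "prob_space N" "B \<in> borel_measurable N" "\<And>w. C w \<le> B w"
  shows "stoch_le N C B"
proof -
  interpret prob_space N by fact
  show ?thesis
    unfolding stoch_le_def
  proof
    fix x
    have "{w \<in> space N. x \<le> B w} \<in> sets N"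
      by (rule borel_measurable_le) (use assms(2) in auto)
    moreover have "{w \<in> space N. x \<le> C w} \<subseteq> {w \<in> space N. x \<le> B w}"
      using assms(3) order_trans by blast
    ultimately show "measure N {w \<in> space N. x \<le> C w} \<le> measure N {w \<in> space N. x \<le> B w}"
      by (intro finite_measure_mono)
  qed
qed

theorem theorem5:
  fixes M :: "'w measure" and N :: "'z measure"
    and X :: "'w \<Rightarrow> real ^ 'd::finite" and e Y :: "'w \<Rightarrow> real"
    and Xs :: "nat \<Rightarrow> 'w \<Rightarrow> real ^ 'd" and Ys :: "nat \<Rightarrow> 'w \<Rightarrow> real"
    and Z :: "'z \<Rightarrow> real ^ 'd"
    and \<beta> :: "real ^ 'd" and \<sigma> :: real and p q :: ereal
  assumes "prob_space M" and "prob_space N"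
    and model: "\<And>w. w \<in> space M \<Longrightarrow> Y w = \<beta> \<bullet> X w + e w"
    and indep_Xe: "independent_rvs M X e"
    and mean_e: "integrable M e" "prob_space.expectation M e = 0"
    and var_e: "integrable M (\<lambda>w. (e w)\<^sup>2)" "prob_space.variance M e = \<sigma>\<^sup>2" "\<sigma> > 0"
    and Sigma_finite: "\<And>i j. integrable M (\<lambda>w. X w $ i * X w $ j)"
    and sample_indep: "prob_space.indep_vars M (\<lambda>_. borel) (\<lambda>i w. (Xs i w, Ys i w)) {1..}"
    and sample_law: "\<And>i. i \<ge> 1 \<Longrightarrow>
      distr M borel (\<lambda>w. (Xs i w, Ys i w)) = distr M borel (\<lambda>w. (X w, Y w))"
    and exponents: "1 < q" "1 / p + 1 / q = 1"
    and gaussian: "centered_gaussian N Z (second_moment M X)"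
  shows "(\<forall>z. \<exists>\<xi>. \<forall>\<xi>'. L1_objective M X e \<beta> \<sigma> p z \<xi>' \<le> L1_objective M X e \<beta> \<sigma> p z \<xi>) \<and>
    converges_in_distribution
      M (\<lambda>n w. real n * enn2real (profile q (empirical n (\<lambda>i. (Xs i w, Ys i w))) \<beta>))
      N (\<lambda>w. L1 M X e \<beta> \<sigma> p (Z w)) \<and>
    (let m2 = prob_space.expectation M (\<lambda>w. (e w)\<^sup>2);
         m1 = prob_space.expectation M (\<lambda>w. \<bar>e w\<bar>)
     in m2 \<noteq> m1\<^sup>2 \<longrightarrow>
        stoch_le N (\<lambda>w. L1 M X e \<beta> \<sigma> p (Z w))
                   (\<lambda>w. m2 / (m2 - m1\<^sup>2) * (lnorm q (Z w))\<^sup>2)) \<and>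
    (distributed M lborel e (normal_density 0 \<sigma>) \<longrightarrow>
        stoch_le N (\<lambda>w. L1 M X e \<beta> \<sigma> p (Z w))
                   (\<lambda>w. pi / (pi - 2) * (lnorm q (Z w))\<^sup>2))"
proof -
  interpret M: prob_space M by fact
  interpret N: prob_space N by fact
  interpret linear_model M p q X e "\<lambda>i w. (Xs i w, Ys i w)" \<beta> \<sigma>
  proof unfold_locales
    show "M.expectation (\<lambda>w. (e w)\<^sup>2) = \<sigma>\<^sup>2" using var_e(2) mean_e(2) by simp
    show "distr M borel (\<lambda>w. (Xs i w, Ys i w)) = distr M borel (\<lambda>w. (X w, \<beta> \<bullet> X w + e w))" if "1 \<le> i" for i
      unfolding sample_law[OF that] by (intro distr_cong) (auto simp: model)
  qed fact+
  have [measurable]: "Z \<in> borel_measurable N" using gaussian by (simp add: centered_gaussian_def)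
  have [measurable]: "quad_sup A \<in> borel_measurable borel"
    by (rule borel_measurable_continuous_onI[OF quad_sup_continuous[OF c_pos A_lower]])
  have "converges_in_distribution
      M (\<lambda>n w. real n * enn2real (profile q (empirical n (\<lambda>i. (Xs i w, Ys i w))) \<beta>))
      N (\<lambda>w. L1 M X e \<beta> \<sigma> p (Z w))"
    unfolding converges_in_distribution_def L1_eq
    using scaled_profile_measurable profile_weak_conv[OF N.prob_space_axioms gaussian] by simp
  moreover have general: "stoch_le N (\<lambda>w. L1 M X e \<beta> \<sigma> p (Z w))
      (\<lambda>w. m2 / (m2 - m1\<^sup>2) * (lnorm q (Z w))\<^sup>2)"
    if "m2 = M.expectation (\<lambda>w. (e w)\<^sup>2)" "m1 = M.expectation (\<lambda>w. \<bar>e w\<bar>)" "m2 \<noteq> m1\<^sup>2" for m1 m2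
    using L1_le that by (intro stoch_leI N.prob_space_axioms) auto
  moreover have "stoch_le N (\<lambda>w. L1 M X e \<beta> \<sigma> p (Z w)) (\<lambda>w. pi / (pi - 2) * (lnorm q (Z w))\<^sup>2)"
    if normal: "distributed M lborel e (normal_density 0 \<sigma>)"
  proof -
    \<comment> \<open>The squared first absolute moment is \<open>2 * \<sigma>\<^sup>2 / pi\<close>,
      strictly below \<open>\<sigma>\<^sup>2\<close>, so the general bound is not void and its
      factor simplifies to \<open>pi / (pi - 2)\<close>.\<close>
    have "2 < pi" using pi_gt3 by simp
    then have "\<sigma>\<^sup>2 \<noteq> (\<sigma> * sqrt (2 / pi))\<^sup>2" "\<sigma>\<^sup>2 / (\<sigma>\<^sup>2 - (\<sigma> * sqrt (2 / pi))\<^sup>2) = pi / (pi - 2)"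
      using var_e(3) by (auto simp: power_mult_distrib field_simps)
    then show ?thesis
      using general[OF e2[symmetric] abs_moment_normal[OF normal, symmetric]] by simp
  qed
  ultimately show ?thesis
    using L1_objective_attains_max by (simp add: Let_def)
qed

end
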